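(* Let $p,q,\sigma$ be real numbers with $q>p-1>0$, $\sigma\ne-p$, and let $N=p$. Consider the positive solutions of $$-(|w'|^{p-2}w')'-\frac{p-1}{r}|w'|^{p-2}w'=\varepsilon r^{\sigma}w^{q},\qquad \varepsilon=\pm1 .$$ (1) Assume $p=N>-\sigma$. • For $\varepsilon=\pm1$ and any $w_0>0$ there exists a unique local solution near $0$ such that $\lim_{r\to0}w=w_0$ and $\lim_{r\to0}r^{-\frac{\sigma+1}{p-1}}w'=-\varepsilon c(w_0)$, $c(w_0)>0$. • For $\varepsilon=1$ there exist infinitely many local solutions near $0$ such that $\lim_{r\to0}|\ln r|^{-1}w=C>0$ and $\lim_{r\to0}rw'=-C$. • For $\varepsilon=-1$ there exists the particular solution $w^*=a^*r^{-\frac{p+\sigma}{q+1-p}}$. There exist local solutions near $0$ such that $w\sim w^*$ as $r\to0$, and local solutions near $\infty$ such that $w\sim w^*$ as $r\to\infty$. There exist infinitely many solutions on $(0,\infty)$ such that $\lim_{r\to0}|\ln r|^{-1}w=C>0$, $\lim_{r\to0}rw'=-C$ and $w\sim w^*$ as $r\to\infty$. (2) Assume $p=N<-\sigma$. Then the same holds after changing $r$ into $1/r$, namely: • For $\varepsilon=\pm1$ and any $w_0>0$ there exists a unique local solution near $\infty$ such that $\lim_{r\to\infty}w=w_0$ and $\lim_{r\to\infty}r^{-\frac{\sigma+1}{p-1}}w'=\varepsilon c(w_0)$, $c(w_0)>0$. • For $\varepsilon=1$ there exist infinitely many local solutions near $\infty$ such that $\lim_{r\to\infty}(\ln r)^{-1}w=C>0$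 and $\lim_{r\to\infty}rw'=C$. • For $\varepsilon=-1$ there exists the particular solution $w^*=a^*r^{-\frac{p+\sigma}{q+1-p}}$; there exist local solutions near $0$ such that $w\sim w^*$ as $r\to0$, and local solutions near $\infty$ such that $w\sim w^*$ as $r\to\infty$; and there exist infinitely many solutions on $(0,\infty)$ such that $\lim_{r\to\infty}(\ln r)^{-1}w=C>0$, $\lim_{r\to\infty}rw'=C$ and $w\sim w^*$ as $r\to0$.
   Context: $p=N$ is not necessarily an integer. With $\gamma=\frac{p+\sigma}{q+1-p}$, $a^*>0$ is defined by $(a^* )^{q-p+1}=-\varepsilon(p-1)|\gamma|^{p}$ with $\varepsilon=-1$. A local solution near $0$ (resp. near $\infty$) is a positive solution on $(0,r_0)$ (resp. $(r_0,\infty)$) for some $r_0>0$. $c(\cdot)$ denotes a positive constant depending on its argument. $f\sim g$ means $f/g\to1$. *)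

theory Defs
  imports "HOL-Analysis.Analysis" "HOL-Library.Landau_Symbols"
begin

definition p_flux :: "real \<Rightarrow> real \<Rightarrow> real" where
  "p_flux p x = \<bar>x\<bar> powr (p - 2) * x"

text \<open>
  The derivatives are meant pointwise. On an open interval of positive numbers a function
  satisfying this is automatically \<open>C\<^sup>1\<close>, and so is \<open>\<bar>w'\<bar>\<^sup>p\<^sup>-\<^sup>2 w'\<close>: the latter is differentiable,
  hence continuous, and its derivative is continuous by the equation. The equation is the
  radial one with \<open>N = p\<close>.
\<close>

definition positive_solution ::
    "real \<Rightarrow> real \<Rightarrow> real \<Rightarrow> real \<Rightarrow> real set \<Rightarrow> (real \<Rightarrow> real) \<Rightarrow> bool" where
  "positive_solution p q \<sigma> \<epsilon> I w \<longleftrightarrow>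
     (\<forall>r\<in>I. 0 < w r
        \<and> w differentiable (at r)
        \<and> (\<lambda>s. p_flux p (deriv w s)) differentiable (at r)
        \<and> - deriv (\<lambda>s. p_flux p (deriv w s)) r - (p - 1) / r * p_flux p (deriv w r)
            = \<epsilon> * r powr \<sigma> * w r powr q)"

definition local_solution_zero ::
    "real \<Rightarrow> real \<Rightarrow> real \<Rightarrow> real \<Rightarrow> (real \<Rightarrow> real) \<Rightarrow> bool" where
  "local_solution_zero p q \<sigma> \<epsilon> w \<longleftrightarrow> (\<exists>r0>0. positive_solution p q \<sigma> \<epsilon> {0<..<r0} w)"

definition local_solution_infinity ::
    "real \<Rightarrow> real \<Rightarrow> real \<Rightarrow> real \<Rightarrow> (real \<Rightarrow> real) \<Rightarrow> bool" where
  "local_solution_infinity p q \<sigma> \<epsilon> w \<longleftrightarrow> (\<exists>r0>0. positive_solution p q \<sigma> \<epsilon> {r0<..} w)"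

text \<open>
  Uniqueness of a local solution: any two of them, possibly given on different intervals,
  coincide wherever both are defined. Values outside the intervals are irrelevant.
\<close>

definition unique_local_solution_zero ::
    "real \<Rightarrow> real \<Rightarrow> real \<Rightarrow> real \<Rightarrow> ((real \<Rightarrow> real) \<Rightarrow> bool) \<Rightarrow> bool" where
  "unique_local_solution_zero p q \<sigma> \<epsilon> P \<longleftrightarrow>
     (\<exists>w. local_solution_zero p q \<sigma> \<epsilon> w \<and> P w)
     \<and> (\<forall>r1>0. \<forall>r2>0. \<forall>w1 w2.
          positive_solution p q \<sigma> \<epsilon> {0<..<r1} w1 \<and> P w1
          \<and> positive_solution p q \<sigma> \<epsilon> {0<..<r2} w2 \<and> P w2
          \<longrightarrow> (\<forall>r\<in>{0<..<r1} \<inter> {0<..<r2}. w1 r = w2 r))"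

definition unique_local_solution_infinity ::
    "real \<Rightarrow> real \<Rightarrow> real \<Rightarrow> real \<Rightarrow> ((real \<Rightarrow> real) \<Rightarrow> bool) \<Rightarrow> bool" where
  "unique_local_solution_infinity p q \<sigma> \<epsilon> P \<longleftrightarrow>
     (\<exists>w. local_solution_infinity p q \<sigma> \<epsilon> w \<and> P w)
     \<and> (\<forall>r1>0. \<forall>r2>0. \<forall>w1 w2.
          positive_solution p q \<sigma> \<epsilon> {r1<..} w1 \<and> P w1
          \<and> positive_solution p q \<sigma> \<epsilon> {r2<..} w2 \<and> P w2
          \<longrightarrow> (\<forall>r\<in>{r1<..} \<inter> {r2<..}. w1 r = w2 r))"

text \<open>
  Infinitely many functions with property \<open>P\<close> that are pairwise different along the filter
  \<open>F\<close>. With \<open>F = at_right 0\<close> or \<open>F = at_top\<close>, a local solution and its restrictions to smaller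
  intervals count once; with \<open>F = principal {0<..}\<close>, functions equal on \<open>(0, \<infinity>)\<close> count once.
\<close>

definition infinitely_many_along ::
    "real filter \<Rightarrow> ((real \<Rightarrow> real) \<Rightarrow> bool) \<Rightarrow> bool" where
  "infinitely_many_along F P \<longleftrightarrow>
     (\<exists>S. infinite S \<and> (\<forall>w\<in>S. P w) \<and> pairwise (\<lambda>v w. \<not> (\<forall>\<^sub>F r in F. v r = w r)) S)"

definition gamma_exp :: "real \<Rightarrow> real \<Rightarrow> real \<Rightarrow> real" where
  "gamma_exp p q \<sigma> = (p + \<sigma>) / (q + 1 - p)"

text \<open>The right-hand side of the equation for \<open>a\<close> is \<open>- \<epsilon> (p - 1) \<bar>\<gamma>\<bar>\<^sup>p\<close> for \<open>\<epsilon> = - 1\<close>.\<close>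

definition a_star :: "real \<Rightarrow> real \<Rightarrow> real \<Rightarrow> real" where
  "a_star p q \<sigma> =
     (THE a. 0 < a \<and> a powr (q - p + 1) = (p - 1) * \<bar>gamma_exp p q \<sigma>\<bar> powr p)"

lemma a_star_ex1:
  assumes "q > p - 1" "p - 1 > 0" "\<sigma> \<noteq> - p"
  shows "\<exists>!a::real. 0 < a \<and> a powr (q - p + 1) = (p - 1) * \<bar>gamma_exp p q \<sigma>\<bar> powr p"
proof -
  let ?m = "q - p + 1" and ?K = "(p - 1) * \<bar>gamma_exp p q \<sigma>\<bar> powr p"
  have m: "?m > 0" using assms by simp
  have g: "gamma_exp p q \<sigma> \<noteq> 0" using assms by (auto simp: gamma_exp_def)
  then have K: "?K > 0" using assms by simp
  show ?thesis
  proof (rule ex1I[of _ "?K powr (1 / ?m)"])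
    show "0 < ?K powr (1 / ?m) \<and> (?K powr (1 / ?m)) powr ?m = ?K"
      using m K g assms by (simp add: powr_powr)
  next
    fix a :: real assume a: "0 < a \<and> a powr ?m = ?K"
    then have "?K powr (1 / ?m) = (a powr ?m) powr (1 / ?m)" by metis
    also have "\<dots> = a" using m conjunct1[OF a] by (simp add: powr_powr)
    finally show "a = ?K powr (1 / ?m)" ..
  qed
qed

definition w_star :: "real \<Rightarrow> real \<Rightarrow> real \<Rightarrow> real \<Rightarrow> real" where
  "w_star p q \<sigma> r = a_star p q \<sigma> * r powr (- gamma_exp p q \<sigma>)"

end

theory Submission
  imports Defs
begin

text \<open>
  Because \<open>N = p\<close>, the substitution \<open>w r = u t\<close>, \<open>r = exp (s * t)\<close> with \<open>s = 1\<close> or \<open>s = - 1\<close> removes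
  the damping term: the flux \<open>y\<close> of \<open>u'\<close> satisfies \<open>y' = - \<epsilon> exp (\<beta> t) u\<^sup>q\<close> with
  \<open>\<beta> = s (p + \<sigma>)\<close>. Taking for \<open>s\<close> the sign of \<open>p + \<sigma>\<close> makes \<open>\<beta>\<close> positive, so that the two halves
  of the theorem are one statement about \<open>t \<rightarrow> - \<infinity>\<close> and \<open>t \<rightarrow> \<infinity>\<close>, read with \<open>r\<close> or with \<open>1 / r\<close>.
  The equation in \<open>t\<close> is invariant under \<open>u \<mapsto> exp (\<gamma> \<tau>) u (t + \<tau>)\<close> with \<open>\<gamma> = \<beta> / (q - p + 1)\<close>.
  This multiplies \<open>w\<^sub>0\<close> and \<open>C\<close> by \<open>exp (\<gamma> \<tau>)\<close>, so one solution of each kind yields a regular solution for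
  every \<open>w\<^sub>0\<close> and infinitely many solutions of logarithmic growth.

  Two mechanisms produce solutions. First, \<open>S = - u' / u\<close> and \<open>X = - y' / y\<close> satisfy the autonomous
  Lotka-Volterra system \<open>S' = S (S - X / (p - 1))\<close>, \<open>X' = X (\<beta> - q S + X)\<close>, for either sign \<open>\<epsilon>\<close>,
  and \<open>u\<close> is an explicit function of \<open>S\<close>, \<open>X\<close> and \<open>t\<close>. Regular solutions belong to the
  saddle \<open>(0, - \<beta>)\<close> and the power solution \<open>w\<^sup>*\<close> is the saddle \<open>(\<gamma>, (p - 1) \<gamma>)\<close>. The invariant
  curves of these saddles are convergent power series in \<open>exp (\<mu> t)\<close>, \<open>\<mu>\<close> an eigenvalue
  (\<open>lotka_volterra_invariant_curve\<close>). They give the regular solutions and, on the stable and the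
  unstable curve of the second saddle, solutions asymptotic to \<open>w\<^sup>*\<close> but different from it.

  Second, logarithmic growth belongs to the degenerate equilibrium \<open>(0, 0)\<close>. With the value of \<open>u\<close> fixed at
  some \<open>b\<close> and the flux fixed at \<open>- \<infinity>\<close> (for \<open>\<epsilon> = 1\<close>) or at \<open>b\<close> (for \<open>\<epsilon> = - 1\<close>), a decreasing
  solution on \<open>(- \<infinity>, b]\<close> is a fixed point of an integral operator that is increasing in \<open>u\<close>, and a fixed
  point is obtained by the Knaster-Tarski argument below a barrier (\<open>monotone_integral_equation\<close>).
  For \<open>\<epsilon> = 1\<close> a linear barrier works when \<open>b\<close> is very negative. For \<open>\<epsilon> = - 1\<close> the stable branch of
  the saddle lies below the power solution and has a smaller logarithmic slope; an exponential with a rate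
  slightly below \<open>\<gamma>\<close> is then a barrier, the branch extends to \<open>- \<infinity>\<close>, and its flux has a finite limit there
  (\<open>backward_continuation\<close>, \<open>flux_converges_at_bot\<close>). This is the global solution joining logarithmic
  growth to \<open>w\<^sup>*\<close>.

  Uniqueness of regular solutions (\<open>log_system_unique\<close>) is a contraction argument in a weighted supremum
  norm. The inverse flux need not be Lipschitz at zero, but the flux of a regular solution is comparable to
  \<open>exp (\<beta> t)\<close>, and by homogeneity only the quotient of the two matters.
\<close>

section \<open>The flux and its inverse\<close>

lemma p_flux_pos: "x > 0 \<Longrightarrow> p_flux p x = x powr (p - 1)"
  by (simp add: p_flux_def powr_diff power2_eq_square)

lemma p_flux_minus: "p_flux p (- x) = - p_flux p x"
  by (simp add: p_flux_def)

lemma p_flux_mult_pos: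
  assumes "c > 0"
  shows "p_flux p (c * x) = c powr (p - 1) * p_flux p x"
  using assms by (simp add: p_flux_def abs_mult powr_mult powr_diff power2_eq_square field_simps)

lemma p_flux_conjugate_pos:
  assumes "p > 1" "x > 0"
  shows "p_flux (p / (p - 1)) x = x powr (1 / (p - 1))"
proof -
  have "p / (p - 1) - 1 = 1 / (p - 1)" using assms by (simp add: field_simps)
  then show ?thesis using p_flux_pos[OF assms(2), of "p / (p - 1)"] by simp
qed

lemma p_flux_inverse:
  assumes "p > 1"
  shows "p_flux p (p_flux (p / (p - 1)) x) = x"
proof -
  have pos: "p_flux p (p_flux (p / (p - 1)) x) = x" if "x > 0" for x
    using that assms by (simp add: p_flux_conjugate_pos p_flux_pos[of "_ powr _"] powr_powr)
  consider "x > 0" | "x = 0" | "x < 0" by linarith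
  then show ?thesis
  proof cases
    case 3
    then show ?thesis using pos[of "- x"] by (simp add: p_flux_minus)
  qed (auto simp: pos, simp add: p_flux_def)
qed

lemma p_flux_inverse':
  assumes "p > 1"
  shows "p_flux (p / (p - 1)) (p_flux p x) = x"
proof -
  have "p / (p - 1) > 1" "p / (p - 1) / (p / (p - 1) - 1) = p"
    using assms by (auto simp: field_simps)
  then show ?thesis using p_flux_inverse[of "p / (p - 1)" x] by simp
qed

text \<open>
  A first-order form in \<open>w\<close> and its flux: changes of variables become applications of the chain rule, and
  no second derivative of \<open>w\<close>, which may fail to exist where \<open>w'\<close> vanishes, is involved.
\<close>
lemma positive_solution_iff_system:
  assumes "p > 1" "open I"
  shows "positive_solution p q \<sigma> \<epsilon> I w \<longleftrightarrow>
    (\<exists>Y. \<forall>r\<in>I. 0 < w r \<and> (w has_real_derivative p_flux (p / (p - 1)) (Y r)) (at r) \<and>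
       (Y has_real_derivative - \<epsilon> * r powr \<sigma> * w r powr q - (p - 1) / r * Y r) (at r))"
    (is "?L \<longleftrightarrow> (\<exists>Y. ?R Y)")
proof
  assume L: ?L
  have "?R (\<lambda>s. p_flux p (deriv w s))"
  proof (intro ballI conjI)
    fix r assume "r \<in> I"
    with L have *: "0 < w r" "w differentiable (at r)"
      "(\<lambda>s. p_flux p (deriv w s)) differentiable (at r)"
      "- deriv (\<lambda>s. p_flux p (deriv w s)) r - (p - 1) / r * p_flux p (deriv w r)
            = \<epsilon> * r powr \<sigma> * w r powr q"
      by (auto simp: positive_solution_def)
    show "0 < w r" by fact
    show "(w has_real_derivative p_flux (p / (p - 1)) (p_flux p (deriv w r))) (at r)"
      using *(2) by (simp add: p_flux_inverse'[OF assms(1)] DERIV_deriv_iff_real_differentiable)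
    have "((\<lambda>s. p_flux p (deriv w s)) has_real_derivative
        deriv (\<lambda>s. p_flux p (deriv w s)) r) (at r)"
      using *(3) by (simp add: DERIV_deriv_iff_real_differentiable)
    moreover have "deriv (\<lambda>s. p_flux p (deriv w s)) r =
        - \<epsilon> * r powr \<sigma> * w r powr q - (p - 1) / r * p_flux p (deriv w r)"
      using *(4) by linarith
    ultimately show "((\<lambda>s. p_flux p (deriv w s)) has_real_derivative
        - \<epsilon> * r powr \<sigma> * w r powr q - (p - 1) / r * p_flux p (deriv w r)) (at r)"
      by simp
  qed
  then show "\<exists>Y. ?R Y" by (rule exI[of _ "\<lambda>s. p_flux p (deriv w s)"])
next
  assume "\<exists>Y. ?R Y"
  then obtain Y where Y: "?R Y" by blast
  have flux: "p_flux p (deriv w r) = Y r" if "r \<in> I" for r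
    using Y that p_flux_inverse[OF assms(1)] by (metis DERIV_imp_deriv)
  show ?L
    unfolding positive_solution_def
  proof (intro ballI conjI)
    fix r assume r: "r \<in> I"
    show "0 < w r" "w differentiable (at r)"
      using Y r real_differentiable_def by blast+
    have d: "((\<lambda>s. p_flux p (deriv w s)) has_real_derivative
        - \<epsilon> * r powr \<sigma> * w r powr q - (p - 1) / r * Y r) (at r)"
    proof (rule has_field_derivative_transform_within_open[OF _ assms(2) r])
      show "(Y has_real_derivative - \<epsilon> * r powr \<sigma> * w r powr q - (p - 1) / r * Y r) (at r)"
        using Y r by blast
    qed (simp add: flux)
    then show "(\<lambda>s. p_flux p (deriv w s)) differentiable (at r)"
      using real_differentiable_def by blast
    show "- deriv (\<lambda>s. p_flux p (deriv w s)) r - (p - 1) / r * p_flux p (deriv w r)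
        = \<epsilon> * r powr \<sigma> * w r powr q"
      using DERIV_imp_deriv[OF d] flux[OF r] by simp
  qed
qed

section \<open>The equation in the logarithmic variable\<close>

text \<open>
  The second unknown \<open>y\<close> is the flux of \<open>u'\<close>; the exponent \<open>p / (p - 1)\<close> is the conjugate one, whose
  flux is the inverse function.
\<close>
definition log_system ::
    "real \<Rightarrow> real \<Rightarrow> real \<Rightarrow> real \<Rightarrow> real set \<Rightarrow> (real \<Rightarrow> real) \<Rightarrow> (real \<Rightarrow> real) \<Rightarrow> bool" where
  "log_system p q \<beta> \<epsilon> J u y \<longleftrightarrow>
     (\<forall>t\<in>J. 0 < u t \<and> (u has_real_derivative p_flux (p / (p - 1)) (y t)) (at t) \<and>
        (y has_real_derivative - \<epsilon> * exp (\<beta> * t) * u t powr q) (at t))"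

text \<open>
  The fluxes in \<open>r\<close> and \<open>t\<close> differ by the factor \<open>s * r powr (1 - p)\<close>. Its logarithmic derivative is
  \<open>(1 - p) / r\<close>, which is the damping term of the radial equation.
\<close>
lemma positive_solution_of_log_system:
  assumes p: "p > 1" and s: "s \<in> {1, -1::real}"
    and sys: "log_system p q (s * (p + \<sigma>)) \<epsilon> J u y"
    and I: "open I" "\<And>r. r \<in> I \<Longrightarrow> 0 < r \<and> s * ln r \<in> J"
  shows "positive_solution p q \<sigma> \<epsilon> I (\<lambda>r. u (s * ln r))"
    and "\<And>r. r \<in> I \<Longrightarrow> ((\<lambda>r. u (s * ln r)) has_real_derivative
            s / r * p_flux (p / (p - 1)) (y (s * ln r))) (at r)"
proof -
  define Y where "Y r = s * (r powr (1 - p) * y (s * ln r))" for r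
  have ss: "s * s = 1" using s by auto
  have fluxY: "p_flux (p / (p - 1)) (Y r) = s / r * p_flux (p / (p - 1)) (y (s * ln r))"
    if "0 < r" for r
  proof -
    have e: "p / (p - 1) - 1 = 1 / (p - 1)" "(1 - p) / (p - 1) = - 1"
      using p by (auto simp: field_simps)
    have "p_flux (p / (p - 1)) (r powr (1 - p) * y (s * ln r))
        = (1 / r) * p_flux (p / (p - 1)) (y (s * ln r))"
      using that by (simp add: p_flux_mult_pos e powr_powr powr_minus_divide)
    then show ?thesis using s by (auto simp: Y_def p_flux_minus)
  qed
  have du: "((\<lambda>r. u (s * ln r)) has_real_derivative
      s / r * p_flux (p / (p - 1)) (y (s * ln r))) (at r)" if r: "r \<in> I" for r
  proof -
    have "(u has_real_derivative p_flux (p / (p - 1)) (y (s * ln r))) (at (s * ln r))"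
      using sys I(2)[OF r] by (auto simp: log_system_def)
    moreover have "((\<lambda>r. s * ln r) has_real_derivative s / r) (at r)"
      using I(2)[OF r] by (auto intro!: derivative_eq_intros)
    ultimately have "(u \<circ> (\<lambda>r. s * ln r) has_real_derivative
        p_flux (p / (p - 1)) (y (s * ln r)) * (s / r)) (at r)"
      by (rule DERIV_chain)
    then show ?thesis by (simp add: o_def mult.commute)
  qed
  then show "\<And>r. r \<in> I \<Longrightarrow> ((\<lambda>r. u (s * ln r)) has_real_derivative
            s / r * p_flux (p / (p - 1)) (y (s * ln r))) (at r)" .
  show "positive_solution p q \<sigma> \<epsilon> I (\<lambda>r. u (s * ln r))"
    unfolding positive_solution_iff_system[OF p I(1)]
  proof (intro exI[of _ Y] ballI conjI)
    fix r assume r: "r \<in> I"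
    then have r0: "0 < r" and J: "s * ln r \<in> J" using I(2) by auto
    show "0 < u (s * ln r)" using sys J by (auto simp: log_system_def)
    show "((\<lambda>r. u (s * ln r)) has_real_derivative p_flux (p / (p - 1)) (Y r)) (at r)"
      using du[OF r] fluxY[OF r0] by simp
    have "(y has_real_derivative - \<epsilon> * exp (s * (p + \<sigma>) * (s * ln r)) * u (s * ln r) powr q)
        (at (s * ln r))"
      using sys J by (auto simp: log_system_def)
    moreover have "((\<lambda>r. s * ln r) has_real_derivative s / r) (at r)"
      using r0 by (auto intro!: derivative_eq_intros)
    ultimately have "(y \<circ> (\<lambda>r. s * ln r) has_real_derivative
        - \<epsilon> * exp (s * (p + \<sigma>) * (s * ln r)) * u (s * ln r) powr q * (s / r)) (at r)"
      by (rule DERIV_chain)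
    moreover have "exp (s * (p + \<sigma>) * (s * ln r)) = r powr (p + \<sigma>)"
      using s r0 by (auto simp: powr_def)
    ultimately have dy: "((\<lambda>r. y (s * ln r)) has_real_derivative
        - \<epsilon> * r powr (p + \<sigma>) * u (s * ln r) powr q * (s / r)) (at r)"
      by (simp add: o_def)
    have "(Y has_real_derivative s * ((1 - p) * r powr (1 - p - 1) * y (s * ln r) +
        (- \<epsilon> * r powr (p + \<sigma>) * u (s * ln r) powr q * (s / r)) * r powr (1 - p))) (at r)"
      unfolding Y_def using r0 dy
      by (auto intro!: derivative_eq_intros)
    moreover have "r powr (p + \<sigma>) * r powr (1 - p) = r * r powr \<sigma>"
      using r0 by (simp add: powr_add[symmetric] powr_mult_base add.commute)
    then have "s * ((1 - p) * r powr (1 - p - 1) * y (s * ln r) +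
        (- \<epsilon> * r powr (p + \<sigma>) * u (s * ln r) powr q * (s / r)) * r powr (1 - p))
      = (s * s) * (- \<epsilon> * (r * r powr \<sigma>) * u (s * ln r) powr q / r) +
        s * ((1 - p) * (r powr (1 - p) / r) * y (s * ln r))"
    proof -
      assume e: "r powr (p + \<sigma>) * r powr (1 - p) = r * r powr \<sigma>"
      have e': "r powr (1 - p - 1) = r powr (1 - p) / r" using r0 powr_diff[of r "1 - p" 1] by simp
      show ?thesis unfolding e' e[symmetric] by (simp add: algebra_simps)
    qed
    moreover have "\<dots> = - \<epsilon> * r powr \<sigma> * u (s * ln r) powr q - (p - 1) / r * Y r"
      unfolding ss using r0 by (simp add: Y_def field_simps)
    ultimately show "(Y has_real_derivative
        - \<epsilon> * r powr \<sigma> * u (s * ln r) powr q - (p - 1) / r * Y r) (at r)"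
      by simp
  qed
qed

lemma log_system_of_positive_solution:
  assumes p: "p > 1" and s: "s \<in> {1, -1::real}" and I: "open I"
    and w: "positive_solution p q \<sigma> \<epsilon> I w"
    and J: "\<And>t. t \<in> J \<Longrightarrow> exp (s * t) \<in> I"
  shows "\<exists>y. log_system p q (s * (p + \<sigma>)) \<epsilon> J (\<lambda>t. w (exp (s * t))) y \<and>
     (\<forall>t\<in>J. p_flux (p / (p - 1)) (y t) = s * exp (s * t) * deriv w (exp (s * t)))"
proof -
  obtain Y where Y: "\<And>r. r \<in> I \<Longrightarrow> 0 < w r"
      "\<And>r. r \<in> I \<Longrightarrow> (w has_real_derivative p_flux (p / (p - 1)) (Y r)) (at r)"
      "\<And>r. r \<in> I \<Longrightarrow>
        (Y has_real_derivative - \<epsilon> * r powr \<sigma> * w r powr q - (p - 1) / r * Y r) (at r)"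
    using w unfolding positive_solution_iff_system[OF p I] by blast
  define y where "y t = s * (exp (s * t) powr (p - 1) * Y (exp (s * t)))" for t
  have ss: "s * s = 1" using s by auto
  have fluxy: "p_flux (p / (p - 1)) (y t) = s * exp (s * t) * p_flux (p / (p - 1)) (Y (exp (s * t)))"
    for t
  proof -
    have e: "p / (p - 1) - 1 = 1 / (p - 1)"
      using p by (auto simp: field_simps)
    have "p_flux (p / (p - 1)) (exp (s * t) powr (p - 1) * Y (exp (s * t)))
        = exp (s * t) * p_flux (p / (p - 1)) (Y (exp (s * t)))"
      using p by (simp add: p_flux_mult_pos e powr_powr)
    then show ?thesis using s by (auto simp: y_def p_flux_minus)
  qed
  have dexp: "((\<lambda>t. exp (s * t)) has_real_derivative s * exp (s * t)) (at t)" for t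
    by (auto intro!: derivative_eq_intros)
  show ?thesis
    unfolding log_system_def
  proof (intro exI[of _ y] conjI ballI)
    fix t assume "t \<in> J"
    let ?r = "exp (s * t)"
    have r: "?r \<in> I" using J \<open>t \<in> J\<close> by auto
    show "0 < w ?r" using Y r by blast
    have "(w \<circ> (\<lambda>t. exp (s * t)) has_real_derivative
        p_flux (p / (p - 1)) (Y ?r) * (s * ?r)) (at t)"
      by (rule DERIV_chain) (use Y(2)[OF r] dexp in auto)
    then show "((\<lambda>t. w (exp (s * t))) has_real_derivative p_flux (p / (p - 1)) (y t)) (at t)"
      by (simp add: o_def fluxy mult.commute)
    have "(Y \<circ> (\<lambda>t. exp (s * t)) has_real_derivative
        (- \<epsilon> * ?r powr \<sigma> * w ?r powr q - (p - 1) / ?r * Y ?r) * (s * ?r)) (at t)"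
      by (rule DERIV_chain) (use Y(3)[OF r] dexp in auto)
    then have dY: "((\<lambda>t. Y (exp (s * t))) has_real_derivative
        (- \<epsilon> * ?r powr \<sigma> * w ?r powr q - (p - 1) / ?r * Y ?r) * (s * ?r)) (at t)"
      by (simp add: o_def)
    have dpow: "((\<lambda>t. exp (s * t) powr (p - 1)) has_real_derivative
        s * (p - 1) * ?r powr (p - 1)) (at t)"
      by (auto intro!: derivative_eq_intros simp: powr_diff divide_simps)
        (simp add: algebra_simps)
    have "(y has_real_derivative s * (s * (p - 1) * ?r powr (p - 1) * Y ?r +
        (- \<epsilon> * ?r powr \<sigma> * w ?r powr q - (p - 1) / ?r * Y ?r) * (s * ?r) * ?r powr (p - 1))) (at t)"
      unfolding y_def using DERIV_cmult[OF DERIV_mult[OF dpow dY], of s] by simp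
    moreover have "s * (s * (p - 1) * ?r powr (p - 1) * Y ?r +
        (- \<epsilon> * ?r powr \<sigma> * w ?r powr q - (p - 1) / ?r * Y ?r) * (s * ?r) * ?r powr (p - 1))
      = (s * s) * (- \<epsilon> * (?r powr \<sigma> * ?r * ?r powr (p - 1)) * w ?r powr q)"
      by (simp add: field_simps)
    moreover have "?r powr \<sigma> * ?r * ?r powr (p - 1) = exp (s * (p + \<sigma>) * t)"
      by (simp add: powr_def exp_add[symmetric] algebra_simps)
    ultimately show "(y has_real_derivative
        - \<epsilon> * exp (s * (p + \<sigma>) * t) * w ?r powr q) (at t)"
      by (simp add: ss)
  next
    fix t assume "t \<in> J"
    then show "p_flux (p / (p - 1)) (y t) = s * exp (s * t) * deriv w (exp (s * t))"
      using fluxy DERIV_imp_deriv[OF Y(2)[OF J]] by simp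
  qed
qed

lemma log_system_subset:
  "log_system p q \<beta> \<epsilon> J u y \<Longrightarrow> K \<subseteq> J \<Longrightarrow> log_system p q \<beta> \<epsilon> K u y"
  by (auto simp: log_system_def)

section \<open>Comparison and uniqueness at minus infinity\<close>

text \<open>
  The difference \<open>g - f\<close> is nondecreasing and starts from \<open>0\<close> at minus infinity.
\<close>
lemma le_of_deriv_le_at_bot:
  fixes f g f' g' :: "real \<Rightarrow> real"
  assumes f: "\<And>t. t \<le> T \<Longrightarrow> (f has_real_derivative f' t) (at t)"
    and g: "\<And>t. t \<le> T \<Longrightarrow> (g has_real_derivative g' t) (at t)"
    and le: "\<And>t. t \<le> T \<Longrightarrow> f' t \<le> g' t"
    and f0: "(f \<longlongrightarrow> 0) at_bot" and g0: "(g \<longlongrightarrow> 0) at_bot" and t: "t \<le> T"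
  shows "f t \<le> g t"
proof -
  have mono: "g s - f s \<le> g t - f t" if "s \<le> t" for s
  proof (rule DERIV_nonneg_imp_nondecreasing[OF that])
    fix x assume "s \<le> x" "x \<le> t"
    then have "((\<lambda>x. g x - f x) has_real_derivative g' x - f' x) (at x)"
      using f g t by (intro DERIV_diff) auto
    then show "\<exists>y. ((\<lambda>x. g x - f x) has_real_derivative y) (at x) \<and> 0 \<le> y"
      using le[of x] \<open>x \<le> t\<close> t by (intro exI[of _ "g' x - f' x"]) auto
  qed
  have "((\<lambda>t. g t - f t) \<longlongrightarrow> 0 - 0) at_bot" by (intro tendsto_diff f0 g0)
  moreover have "\<forall>\<^sub>F s in at_bot. g s - f s \<le> g t - f t"
    using eventually_le_at_bot[of t] by eventually_elim (rule mono)
  ultimately have "0 - 0 \<le> g t - f t" by (intro tendsto_upperbound) auto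
  then show ?thesis by simp
qed

lemma abs_le_of_abs_deriv_le_at_bot:
  fixes f g f' g' :: "real \<Rightarrow> real"
  assumes "\<And>t. t \<le> T \<Longrightarrow> (f has_real_derivative f' t) (at t)"
    and "\<And>t. t \<le> T \<Longrightarrow> (g has_real_derivative g' t) (at t)"
    and "\<And>t. t \<le> T \<Longrightarrow> \<bar>f' t\<bar> \<le> g' t"
    and "(f \<longlongrightarrow> 0) at_bot" and "(g \<longlongrightarrow> 0) at_bot" and "t \<le> T"
  shows "\<bar>f t\<bar> \<le> g t"
proof -
  have "f t \<le> g t"
    by (rule le_of_deriv_le_at_bot[of T f f' g g'])
      (use assms in \<open>auto simp: abs_le_iff\<close>)
  moreover have "- f t \<le> g t"
  proof (rule le_of_deriv_le_at_bot[of T "\<lambda>t. - f t" "\<lambda>t. - f' t" g g'])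
    show "((\<lambda>t. - f t) \<longlongrightarrow> 0) at_bot" using tendsto_minus[OF assms(4)] by simp
  qed (use assms in \<open>auto simp: abs_le_iff intro: DERIV_minus\<close>)
  ultimately show ?thesis by simp
qed

lemma exp_mult_at_bot:
  fixes k :: real
  assumes "k > 0"
  shows "((\<lambda>t. exp (k * t)) \<longlongrightarrow> 0) at_bot"
proof -
  have "filterlim (\<lambda>t. k * t) at_bot at_bot"
    by (rule filterlim_tendsto_pos_mult_at_bot[OF tendsto_const assms filterlim_ident])
  then show ?thesis by (rule filterlim_compose[OF exp_at_bot])
qed

lemma powr_lipschitz_on_compact:
  fixes l h k :: real
  assumes "0 < l"
  shows "\<exists>L>0. \<forall>x\<in>{l..h}. \<forall>y\<in>{l..h}. \<bar>x powr k - y powr k\<bar> \<le> L * \<bar>x - y\<bar>"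
proof -
  define L where "L = \<bar>k\<bar> * (l powr (k - 1) + h powr (k - 1)) + 1"
  have bd: "\<bar>k * x powr (k - 1)\<bar> \<le> L" if "x \<in> {l..h}" for x
  proof -
    have "x powr (k - 1) \<le> l powr (k - 1) + h powr (k - 1)"
    proof (cases "k \<ge> 1")
      case True
      then have "x powr (k - 1) \<le> h powr (k - 1)"
        using that assms by (intro powr_mono2) auto
      then show ?thesis by (simp add: add_increasing)
    next
      case False
      then have "x powr (k - 1) \<le> l powr (k - 1)"
        using that assms by (intro powr_mono2') auto
      then show ?thesis by (simp add: add_increasing2)
    qed
    then have "\<bar>k\<bar> * x powr (k - 1) \<le> \<bar>k\<bar> * (l powr (k - 1) + h powr (k - 1))"
      by (intro mult_left_mono) auto
    then show ?thesis by (simp add: L_def abs_mult)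
  qed
  have "\<bar>x powr k - y powr k\<bar> \<le> L * \<bar>x - y\<bar>" if xy: "x \<in> {l..h}" "y \<in> {l..h}" for x y
  proof -
    have "norm (x powr k - y powr k) \<le> L * norm (x - y)"
    proof (rule field_differentiable_bound[of "{l..h}" _ "\<lambda>x. k * x powr (k - 1)"])
      show "((\<lambda>x. x powr k) has_real_derivative k * z powr (k - 1)) (at z within {l..h})"
        if "z \<in> {l..h}" for z
        using that assms by (auto intro!: has_field_derivative_at_within has_real_derivative_powr)
    qed (use bd xy in auto)
    then show ?thesis by simp
  qed
  moreover have "L > 0" by (auto simp: L_def intro!: add_nonneg_pos)
  ultimately show ?thesis by blast
qed

lemma positive_bounds_of_tendsto_at_bot:
  fixes u :: "real \<Rightarrow> real"
  assumes cont: "continuous_on {..T} u" and pos: "\<And>t. t \<le> T \<Longrightarrow> 0 < u t"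
    and lim: "(u \<longlongrightarrow> c) at_bot" and c: "0 < c"
  shows "\<exists>l h. 0 < l \<and> (\<forall>t\<le>T. l \<le> u t \<and> u t \<le> h)"
proof -
  have "\<forall>\<^sub>F t in at_bot. c / 2 < u t \<and> u t < 2 * c"
    using order_tendstoD(1)[OF lim, of "c / 2"] order_tendstoD(2)[OF lim, of "2 * c"] c
    by (simp add: eventually_conj)
  then obtain N where N: "\<And>t. t \<le> N \<Longrightarrow> c / 2 < u t \<and> u t < 2 * c"
    by (auto simp: eventually_at_bot_linorder)
  let ?K = "{min N T..T}"
  have cK: "continuous_on ?K u" by (rule continuous_on_subset[OF cont]) auto
  obtain x where x: "x \<in> ?K" "\<forall>t\<in>?K. u x \<le> u t"
    using continuous_attains_inf[OF _ _ cK] by auto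
  obtain y where y: "y \<in> ?K" "\<forall>t\<in>?K. u t \<le> u y"
    using continuous_attains_sup[OF _ _ cK] by auto
  have "min (c / 2) (u x) \<le> u t \<and> u t \<le> max (2 * c) (u y)" if "t \<le> T" for t
  proof (cases "t \<le> N")
    case True
    then show ?thesis using N[OF True] by auto
  next
    case False
    then have "t \<in> ?K" using that by auto
    then show ?thesis using x y by (meson max.coboundedI2 min.coboundedI2)
  qed
  moreover have "0 < min (c / 2) (u x)" using c pos x by auto
  ultimately show ?thesis by blast
qed

text \<open>
  Two solutions with the same data at minus infinity satisfy \<open>\<bar>u1 - u2\<bar> \<le> M * W\<close> on the half-line for some
  \<open>M\<close>, where \<open>W t = exp (\<omega> * exp (\<alpha> * t))\<close>. Integrating the system twice reproduces this bound with
  \<open>M / 2\<close> once \<open>\<omega>\<close> is large, because the integrals of \<open>exp (\<beta> * t) * W\<close> and \<open>exp (\<alpha> * t) * W\<close> from minus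
  infinity are at most \<open>exp (\<beta> * t) * W / \<beta>\<close> and \<open>W / (\<omega> * \<alpha>)\<close>.
\<close>
lemma log_system_unique:
  fixes p q \<beta> \<epsilon> :: real
  assumes pq: "q > p - 1" "p > 1" and \<beta>: "\<beta> > 0" and \<epsilon>: "\<epsilon> \<in> {1, -1}"
    and sys1: "log_system p q \<beta> \<epsilon> {..<T} u1 y1" and sys2: "log_system p q \<beta> \<epsilon> {..<T} u2 y2"
    and w0: "w0 > 0" and lim: "(u1 \<longlongrightarrow> w0) at_bot" "(u2 \<longlongrightarrow> w0) at_bot"
    and ylim: "(y1 \<longlongrightarrow> 0) at_bot" "(y2 \<longlongrightarrow> 0) at_bot" and t0: "t0 < T"
  shows "u1 t0 = u2 t0"
proof -
  define \<kappa> where "\<kappa> = 1 / (p - 1)"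
  define \<alpha> where "\<alpha> = \<beta> * \<kappa>"
  have \<alpha>: "\<alpha> > 0" and \<kappa>: "\<kappa> > 0" using pq \<beta> by (auto simp: \<alpha>_def \<kappa>_def)
  have \<epsilon>\<epsilon>: "\<epsilon> * \<epsilon> = 1" "\<bar>\<epsilon>\<bar> = 1" using \<epsilon> by auto
  define z where "z y t = - \<epsilon> * y t" for y :: "real \<Rightarrow> real" and t
  have dz: "(z y has_real_derivative exp (\<beta> * t) * u t powr q) (at t)"
    if "log_system p q \<beta> \<epsilon> {..<T} u y" "t \<le> t0" for u y t
  proof -
    have "(y has_real_derivative - \<epsilon> * exp (\<beta> * t) * u t powr q) (at t)"
      using that t0 by (auto simp: log_system_def)
    from DERIV_cmult[OF this, of "- \<epsilon>"] show ?thesis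
      unfolding z_def using \<epsilon>\<epsilon>(1) by (simp add: mult.assoc[symmetric])
  qed
  have zlim: "(z y \<longlongrightarrow> 0) at_bot" if "(y \<longlongrightarrow> 0) at_bot" for y
    unfolding z_def using tendsto_mult_right_zero[OF that, of "- \<epsilon>"] by simp
  have bounds: "\<exists>l h. 0 < l \<and> (\<forall>t\<le>t0. l \<le> u t \<and> u t \<le> h)"
    if "log_system p q \<beta> \<epsilon> {..<T} u y" "(u \<longlongrightarrow> w0) at_bot" for u y
  proof (rule positive_bounds_of_tendsto_at_bot[OF _ _ that(2) w0])
    show "continuous_on {..t0} u"
      using that(1) t0 unfolding log_system_def
      by (intro continuous_at_imp_continuous_on) (auto intro: DERIV_isCont)
  qed (use that t0 in \<open>auto simp: log_system_def\<close>)
  obtain l1 h1 where 1: "0 < l1" "\<And>t. t \<le> t0 \<Longrightarrow> l1 \<le> u1 t \<and> u1 t \<le> h1"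
    using bounds[OF sys1 lim(1)] by blast
  obtain l2 h2 where 2: "0 < l2" "\<And>t. t \<le> t0 \<Longrightarrow> l2 \<le> u2 t \<and> u2 t \<le> h2"
    using bounds[OF sys2 lim(2)] by blast
  define l h where "l = min l1 l2" and "h = max h1 h2"
  have l: "0 < l" and ub: "\<And>t. t \<le> t0 \<Longrightarrow> u1 t \<in> {l..h}" "\<And>t. t \<le> t0 \<Longrightarrow> u2 t \<in> {l..h}"
    using 1 2 by (force simp: l_def h_def)+
  have h: "0 < h" using ub[of t0] l by auto
  \<comment> \<open>The integrated nonlinearity is comparable to \<open>exp (\<beta> * t)\<close>: after division by this
      exponential it stays in a compact subset of the positive reals, where the power function is
      Lipschitz although the inverse flux need not be so at zero.\<close>
  define c1 c2 where "c1 = l powr q / \<beta>" and "c2 = h powr q / \<beta>"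
  have c1: "c1 > 0" using l \<beta> by (simp add: c1_def)
  have dexp: "((\<lambda>t. c * exp (\<beta> * t)) has_real_derivative c * \<beta> * exp (\<beta> * t)) (at t)" for c t
    by (auto intro!: derivative_eq_intros)
  have explim: "((\<lambda>t. c * exp (\<beta> * t)) \<longlongrightarrow> 0) at_bot" for c
    using tendsto_mult_right_zero[OF exp_mult_at_bot[OF \<beta>]] .
  have zb: "exp (- \<beta> * t) * z y t \<in> {c1..c2}"
    if sys: "log_system p q \<beta> \<epsilon> {..<T} u y" and y0: "(y \<longlongrightarrow> 0) at_bot"
      and b: "\<And>t. t \<le> t0 \<Longrightarrow> u t \<in> {l..h}" and t: "t \<le> t0" for u y t
  proof -
    have "c1 * exp (\<beta> * t) \<le> z y t"
    proof (rule le_of_deriv_le_at_bot[OF dexp dz[OF sys] _ explim zlim[OF y0] t])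
      fix t assume "t \<le> t0"
      then have "l powr q \<le> u t powr q" using b[of t] l pq by (intro powr_mono2) auto
      then show "c1 * \<beta> * exp (\<beta> * t) \<le> exp (\<beta> * t) * u t powr q"
        using \<beta> by (simp add: c1_def mult.commute)
    qed
    moreover have "z y t \<le> c2 * exp (\<beta> * t)"
    proof (rule le_of_deriv_le_at_bot[OF dz[OF sys] dexp _ zlim[OF y0] explim t])
      fix t assume "t \<le> t0"
      then have "u t powr q \<le> h powr q" using b[of t] l pq by (intro powr_mono2) auto
      then show "exp (\<beta> * t) * u t powr q \<le> c2 * \<beta> * exp (\<beta> * t)"
        using \<beta> by (simp add: c2_def mult.commute)
    qed
    ultimately show ?thesis by (simp add: exp_minus field_simps)
  qed
  have zpos: "0 < z y t" and zpow: "z y t powr \<kappa> = exp (\<alpha> * t) * (exp (- \<beta> * t) * z y t) powr \<kappa>"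
    if "exp (- \<beta> * t) * z y t \<in> {c1..c2}" for y t
  proof -
    show "0 < z y t" using that c1 by (smt (verit) atLeastAtMost_iff exp_gt_zero zero_less_mult_iff)
    have "(exp (- \<beta> * t) * z y t) powr \<kappa> = exp (- (\<alpha> * t)) * z y t powr \<kappa>"
      using \<open>0 < z y t\<close> by (subst powr_mult) (auto simp: powr_def[of "exp _"] \<alpha>_def mult_ac)
    then show "z y t powr \<kappa> = exp (\<alpha> * t) * (exp (- \<beta> * t) * z y t) powr \<kappa>"
      by (simp add: exp_minus)
  qed
  obtain L where L: "L > 0" "\<And>x y. x \<in> {l..h} \<Longrightarrow> y \<in> {l..h} \<Longrightarrow>
      \<bar>x powr q - y powr q\<bar> \<le> L * \<bar>x - y\<bar>"
    using powr_lipschitz_on_compact[OF l] by meson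
  obtain L' where L': "L' > 0" "\<And>x y. x \<in> {c1..c2} \<Longrightarrow> y \<in> {c1..c2} \<Longrightarrow>
      \<bar>x powr \<kappa> - y powr \<kappa>\<bar> \<le> L' * \<bar>x - y\<bar>"
    using powr_lipschitz_on_compact[OF c1] by meson
  define \<omega> where "\<omega> = 2 * L' * L / (\<beta> * \<alpha>)"
  have \<omega>: "\<omega> > 0" using L L' \<alpha> \<beta> by (simp add: \<omega>_def)
  define W where "W t = exp (\<omega> * exp (\<alpha> * t))" for t
  have W: "W t > 0" for t by (simp add: W_def)
  have dW: "(W has_real_derivative \<omega> * \<alpha> * exp (\<alpha> * t) * W t) (at t)" for t
    unfolding W_def by (auto intro!: derivative_eq_intros)
  have W0: "(W \<longlongrightarrow> 1) at_bot"
  proof -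
    have "((\<lambda>t. exp (\<omega> * exp (\<alpha> * t))) \<longlongrightarrow> exp (\<omega> * 0)) at_bot"
      by (intro tendsto_intros exp_mult_at_bot \<alpha>)
    then show ?thesis by (simp add: W_def[abs_def])
  qed
  have step: "\<forall>t\<le>t0. \<bar>u1 t - u2 t\<bar> \<le> M / 2 * W t"
    if M: "\<forall>t\<le>t0. \<bar>u1 t - u2 t\<bar> \<le> M * W t" for M
  proof -
    have M0: "0 \<le> M" using M[rule_format, of t0] W[of t0]
      by (smt (verit) mult_neg_pos)
    have zdiff: "\<bar>z y1 t - z y2 t\<bar> \<le> L * M / \<beta> * (exp (\<beta> * t) * W t)" if "t \<le> t0" for t
    proof (rule abs_le_of_abs_deriv_le_at_bot[OF _ _ _ _ _ that])
      fix t assume t: "t \<le> t0"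
      show "((\<lambda>t. z y1 t - z y2 t) has_real_derivative
          exp (\<beta> * t) * u1 t powr q - exp (\<beta> * t) * u2 t powr q) (at t)"
        by (intro DERIV_diff dz[OF sys1 t] dz[OF sys2 t])
      show "((\<lambda>t. L * M / \<beta> * (exp (\<beta> * t) * W t)) has_real_derivative
          L * M / \<beta> * (exp (\<beta> * t) * \<beta> * W t + \<omega> * \<alpha> * exp (\<alpha> * t) * W t * exp (\<beta> * t))) (at t)"
        by (rule DERIV_cmult, rule DERIV_mult[OF _ dW]) (auto intro!: derivative_eq_intros)
      have "\<bar>u1 t powr q - u2 t powr q\<bar> \<le> L * \<bar>u1 t - u2 t\<bar>"
        using L(2) ub t by auto
      also have "\<dots> \<le> L * (M * W t)" using M t L(1) by (intro mult_left_mono) auto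
      finally have "exp (\<beta> * t) * \<bar>u1 t powr q - u2 t powr q\<bar> \<le> exp (\<beta> * t) * (L * (M * W t))"
        by (intro mult_left_mono) auto
      also have "\<dots> = L * M / \<beta> * (exp (\<beta> * t) * \<beta> * W t)" using \<beta> by simp
      also have "\<dots> \<le> L * M / \<beta> * (exp (\<beta> * t) * \<beta> * W t +
          \<omega> * \<alpha> * exp (\<alpha> * t) * W t * exp (\<beta> * t))"
        using L(1) M0 \<beta> \<omega> \<alpha> W[of t] by (intro mult_left_mono) auto
      finally show "\<bar>exp (\<beta> * t) * u1 t powr q - exp (\<beta> * t) * u2 t powr q\<bar> \<le>
          L * M / \<beta> * (exp (\<beta> * t) * \<beta> * W t + \<omega> * \<alpha> * exp (\<alpha> * t) * W t * exp (\<beta> * t))"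
        by (simp add: right_diff_distrib[symmetric] abs_mult)
    next
      show "((\<lambda>t. z y1 t - z y2 t) \<longlongrightarrow> 0) at_bot"
        using tendsto_diff[OF zlim[OF ylim(1)] zlim[OF ylim(2)]] by simp
      have "((\<lambda>t. L * M / \<beta> * (exp (\<beta> * t) * W t)) \<longlongrightarrow> L * M / \<beta> * (0 * 1)) at_bot"
        by (intro tendsto_intros exp_mult_at_bot \<beta> W0)
      then show "((\<lambda>t. L * M / \<beta> * (exp (\<beta> * t) * W t)) \<longlongrightarrow> 0) at_bot" by simp
    qed
    have "\<bar>u1 t - u2 t\<bar> \<le> M / 2 * (W t - 1)" if "t \<le> t0" for t
    proof (rule abs_le_of_abs_deriv_le_at_bot[OF _ _ _ _ _ that])
      fix t assume t: "t \<le> t0"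
      have du: "(u has_real_derivative - \<epsilon> * z y t powr \<kappa>) (at t)"
        if sys: "log_system p q \<beta> \<epsilon> {..<T} u y" and zp: "0 < z y t" for u y
      proof -
        have "y t = - \<epsilon> * z y t" using \<epsilon>\<epsilon>(1) by (simp add: z_def mult.assoc[symmetric])
        moreover have "p_flux (p / (p - 1)) (- \<epsilon> * z y t) = - \<epsilon> * z y t powr \<kappa>"
          using \<epsilon> p_flux_conjugate_pos[OF pq(2) zp] by (auto simp: p_flux_minus \<kappa>_def)
        moreover have "(u has_real_derivative p_flux (p / (p - 1)) (y t)) (at t)"
          using sys t t0 by (auto simp: log_system_def)
        ultimately show ?thesis by simp
      qed
      have b1: "exp (- \<beta> * t) * z y1 t \<in> {c1..c2}"
        by (rule zb[OF sys1 ylim(1) _ t]) (rule ub(1))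
      have b2: "exp (- \<beta> * t) * z y2 t \<in> {c1..c2}"
        by (rule zb[OF sys2 ylim(2) _ t]) (rule ub(2))
      show "((\<lambda>t. u1 t - u2 t) has_real_derivative
          - \<epsilon> * z y1 t powr \<kappa> - - \<epsilon> * z y2 t powr \<kappa>) (at t)"
        by (intro DERIV_diff du[OF sys1 zpos[OF b1]] du[OF sys2 zpos[OF b2]])
      show "((\<lambda>t. M / 2 * (W t - 1)) has_real_derivative
          M / 2 * (\<omega> * \<alpha> * exp (\<alpha> * t) * W t - 0)) (at t)"
        by (intro DERIV_cmult DERIV_diff dW DERIV_const)
      have "\<bar>- \<epsilon> * z y1 t powr \<kappa> - - \<epsilon> * z y2 t powr \<kappa>\<bar> = \<bar>z y1 t powr \<kappa> - z y2 t powr \<kappa>\<bar>"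
        using \<epsilon> by auto
      also have "\<dots> = exp (\<alpha> * t) *
          \<bar>(exp (- \<beta> * t) * z y1 t) powr \<kappa> - (exp (- \<beta> * t) * z y2 t) powr \<kappa>\<bar>"
        by (subst zpow[OF b1], subst zpow[OF b2])
          (simp only: right_diff_distrib[symmetric] abs_mult abs_exp_cancel)
      also have "\<dots> \<le> exp (\<alpha> * t) * (L' * \<bar>exp (- \<beta> * t) * z y1 t - exp (- \<beta> * t) * z y2 t\<bar>)"
        by (intro mult_left_mono L'(2) b1 b2) auto
      also have "\<dots> = exp (\<alpha> * t) * (L' * (exp (- \<beta> * t) * \<bar>z y1 t - z y2 t\<bar>))"
        unfolding right_diff_distrib[symmetric] by (simp add: abs_mult)
      also have "\<dots> \<le> exp (\<alpha> * t) * (L' * (exp (- \<beta> * t) * (L * M / \<beta> * (exp (\<beta> * t) * W t))))"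
        using L'(1) by (intro mult_left_mono zdiff t) auto
      also have "\<dots> = (exp (- \<beta> * t) * exp (\<beta> * t)) * (exp (\<alpha> * t) * (L' * (L * M / \<beta> * W t)))"
        by (simp only: mult_ac)
      also have "\<dots> = M / 2 * (\<omega> * \<alpha> * exp (\<alpha> * t) * W t - 0)"
        using \<alpha> \<beta> by (simp add: \<omega>_def exp_minus field_simps)
      finally show "\<bar>- \<epsilon> * z y1 t powr \<kappa> - - \<epsilon> * z y2 t powr \<kappa>\<bar> \<le>
          M / 2 * (\<omega> * \<alpha> * exp (\<alpha> * t) * W t - 0)" .
    next
      show "((\<lambda>t. u1 t - u2 t) \<longlongrightarrow> 0) at_bot"
        using tendsto_diff[OF lim] by simp
      have "((\<lambda>t. M / 2 * (W t - 1)) \<longlongrightarrow> M / 2 * (1 - 1)) at_bot"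
        by (intro tendsto_intros W0)
      then show "((\<lambda>t. M / 2 * (W t - 1)) \<longlongrightarrow> 0) at_bot" by simp
    qed
    then show ?thesis using M0 by (force simp: right_diff_distrib)
  qed
  have iter: "\<forall>t\<le>t0. \<bar>u1 t - u2 t\<bar> \<le> h / 2 ^ n * W t" for n
  proof (induction n)
    case 0
    show ?case
    proof (intro allI impI)
      fix t assume "t \<le> t0"
      then have "\<bar>u1 t - u2 t\<bar> \<le> h * 1" using ub[of t] l by auto
      also have "\<dots> \<le> h * W t" using h \<omega> by (intro mult_left_mono) (auto simp: W_def)
      finally show "\<bar>u1 t - u2 t\<bar> \<le> h / 2 ^ 0 * W t" by simp
    qed
  next
    case (Suc n)
    then show ?case using step[OF Suc] by (simp add: field_simps)
  qed
  have "(\<lambda>n. h / 2 ^ n * W t0) \<longlonglongrightarrow> 0"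
    by (intro tendsto_mult_left_zero LIMSEQ_divide_realpow_zero) simp
  then have "\<bar>u1 t0 - u2 t0\<bar> \<le> 0"
    by (rule LIMSEQ_le_const) (use iter in auto)
  then show ?thesis by simp
qed

section \<open>Analytic invariant curves of a planar Lotka-Volterra system\<close>

lemma course_of_values_recursion:
  fixes F :: "nat \<Rightarrow> (nat \<Rightarrow> 'a) \<Rightarrow> 'a"
  assumes "\<And>n f g. (\<And>i. i < n \<Longrightarrow> f i = g i) \<Longrightarrow> F n f = F n g"
  shows "\<exists>c. \<forall>n. c n = F n c"
proof -
  have "adm_wf less_than (\<lambda>f n. F n f)"
    unfolding adm_wf_def by (auto intro: assms)
  from wfrec_fixpoint[OF wf_less_than this] show ?thesis
    by (metis)
qed

lemma fps_conv_radius_ge_of_geometric_bound: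
  fixes f :: "real fps"
  assumes "\<rho> > 0" and bd: "\<And>n. \<bar>fps_nth f n\<bar> \<le> C * \<rho> ^ n"
  shows "fps_conv_radius f \<ge> ereal (1 / \<rho>)"
  unfolding fps_conv_radius_def
proof (rule conv_radius_geI_ex)
  fix r :: real assume r: "0 < r" "ereal r < ereal (1 / \<rho>)"
  have "summable (\<lambda>n. fps_nth f n * r ^ n)"
  proof (rule summable_comparison_test')
    have "\<rho> * r < 1" using r assms(1) by (simp add: field_simps)
    then show "summable (\<lambda>n. C * (\<rho> * r) ^ n)"
      using r assms(1) by (intro summable_mult summable_geometric) auto
    show "norm (fps_nth f n * r ^ n) \<le> C * (\<rho> * r) ^ n" for n
      using mult_right_mono[OF bd[of n], of "r ^ n"] r
      by (simp add: abs_mult power_mult_distrib mult.assoc)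
  qed
  then show "\<exists>z. norm z = r \<and> summable (\<lambda>n. fps_nth f n * z ^ n)"
    using r by (intro exI[of _ r]) auto
qed

text \<open>
  The curve \<open>\<theta> \<mapsto> (a \<theta>, b \<theta>)\<close> is tangent to the eigenvector \<open>(a1, b1)\<close>, and with \<open>\<theta> = exp (\<mu> * t)\<close> it becomes
  a solution of the planar system with linear part \<open>A\<close>. Its Taylor coefficients of order \<open>n\<close> solve a
  linear system with matrix \<open>\<mu> * n - A\<close>. By the hypothesis \<open>nonres\<close> no multiple \<open>n * \<mu>\<close>
  with \<open>n \<ge> 2\<close> is an eigenvalue, and the determinants grow fast enough for the series to converge. Since \<open>\<mu>\<close>
  may have either sign, stable and unstable curves are both covered.
\<close>
lemma lotka_volterra_invariant_curve:
  fixes A11 A12 A21 A22 c1 c2 c3 c4 \<mu> a1 b1 \<delta> :: real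
  assumes eig: "A11 * a1 + A12 * b1 = \<mu> * a1" "A21 * a1 + A22 * b1 = \<mu> * b1"
    and \<delta>: "\<delta> > 0"
    and nonres: "\<And>n::nat. n \<ge> 2 \<Longrightarrow>
      \<delta> * (real n * (real n - 1)) \<le> (\<mu> * n - A11) * (\<mu> * n - A22) - A12 * A21"
  shows "\<exists>R>0. \<exists>a b a' b'. a 0 = 0 \<and> b 0 = 0 \<and> a' 0 = a1 \<and> b' 0 = b1 \<and>
    (\<forall>\<theta>. \<bar>\<theta>\<bar> < R \<longrightarrow> (a has_real_derivative a' \<theta>) (at \<theta>) \<and> (b has_real_derivative b' \<theta>) (at \<theta>) \<and>
       \<mu> * \<theta> * a' \<theta> = A11 * a \<theta> + A12 * b \<theta> + a \<theta> * (c1 * a \<theta> + c2 * b \<theta>) \<and>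
       \<mu> * \<theta> * b' \<theta> = A21 * a \<theta> + A22 * b \<theta> + b \<theta> * (c3 * a \<theta> + c4 * b \<theta>))"
proof -
  define P where "P n c = (\<Sum>i=1..<n. fst (c i) * (c1 * fst (c (n - i)) + c2 * snd (c (n - i))))"
    for n and c :: "nat \<Rightarrow> real \<times> real"
  define Q where "Q n c = (\<Sum>i=1..<n. snd (c i) * (c3 * fst (c (n - i)) + c4 * snd (c (n - i))))"
    for n and c :: "nat \<Rightarrow> real \<times> real"
  define \<Delta> where "\<Delta> n = (\<mu> * real n - A11) * (\<mu> * real n - A22) - A12 * A21" for n
  define F where "F n c = (if n = 0 then (0, 0) else if n = 1 then (a1, b1) else
      (((\<mu> * n - A22) * P n c + A12 * Q n c) / \<Delta> n, (A21 * P n c + (\<mu> * n - A11) * Q n c) / \<Delta> n))"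
    for n c
  obtain c where c: "\<And>n. c n = F n c"
  proof (rule exE[OF course_of_values_recursion[of F]])
    fix n and f g :: "nat \<Rightarrow> real \<times> real" assume "\<And>i. i < n \<Longrightarrow> f i = g i"
    then have "P n f = P n g" "Q n f = Q n g"
      unfolding P_def Q_def by (auto intro!: sum.cong)
    then show "F n f = F n g" by (simp add: F_def)
  qed blast
  have c0: "c 0 = (0, 0)" and c1': "c 1 = (a1, b1)"
    using c[of 0] c[of 1] by (auto simp: F_def)
  have \<Delta>: "0 < \<Delta> n" "\<delta> * (real n * (real n - 1)) \<le> \<Delta> n" if "n \<ge> 2" for n
    using nonres[OF that] that \<delta> unfolding \<Delta>_def[symmetric]
    by (auto intro: less_le_trans[rotated])
  have cn: "fst (c n) = ((\<mu> * n - A22) * P n c + A12 * Q n c) / \<Delta> n"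
      "snd (c n) = (A21 * P n c + (\<mu> * n - A11) * Q n c) / \<Delta> n" if "n \<ge> 2" for n
    using c[of n] that by (auto simp: F_def)
  have rec: "\<mu> * n * fst (c n) = A11 * fst (c n) + A12 * snd (c n) + P n c \<and>
      \<mu> * n * snd (c n) = A21 * fst (c n) + A22 * snd (c n) + Q n c" for n
  proof -
    consider "n = 0" | "n = 1" | "n \<ge> 2" by linarith
    then show ?thesis
    proof cases
      case 3
      have "\<Delta> n \<noteq> 0" using \<Delta>(1)[OF 3] by simp
      have f: "fst (c n) * \<Delta> n = (\<mu> * n - A22) * P n c + A12 * Q n c"
        and s: "snd (c n) * \<Delta> n = A21 * P n c + (\<mu> * n - A11) * Q n c"
        using cn[OF 3] \<open>\<Delta> n \<noteq> 0\<close> by auto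
      have "((\<mu> * n - A11) * fst (c n) - A12 * snd (c n)) * \<Delta> n =
          (\<mu> * n - A11) * (fst (c n) * \<Delta> n) - A12 * (snd (c n) * \<Delta> n)"
        by (simp add: algebra_simps)
      also have "\<dots> = P n c * \<Delta> n" unfolding f s by (simp add: \<Delta>_def algebra_simps)
      finally have 1: "(\<mu> * n - A11) * fst (c n) - A12 * snd (c n) = P n c"
        using \<open>\<Delta> n \<noteq> 0\<close> by simp
      have "((\<mu> * n - A22) * snd (c n) - A21 * fst (c n)) * \<Delta> n =
          (\<mu> * n - A22) * (snd (c n) * \<Delta> n) - A21 * (fst (c n) * \<Delta> n)"
        by (simp add: algebra_simps)
      also have "\<dots> = Q n c * \<Delta> n" unfolding f s by (simp add: \<Delta>_def algebra_simps)
      finally have 2: "(\<mu> * n - A22) * snd (c n) - A21 * fst (c n) = Q n c"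
        using \<open>\<Delta> n \<noteq> 0\<close> by simp
      from 1 2 show ?thesis by (simp add: algebra_simps)
    qed (use eig in \<open>auto simp: c0 c1'[simplified] P_def Q_def\<close>)
  qed
  \<comment> \<open>The denominators grow quadratically, which compensates both the linear growth of the
      numerators and the number of terms of the convolution: a geometric bound propagates.\<close>
  define N where "N n = \<bar>fst (c n)\<bar> + \<bar>snd (c n)\<bar>" for n
  define H where "H = \<bar>\<mu>\<bar> + \<bar>A11\<bar> + \<bar>A12\<bar> + \<bar>A21\<bar> + \<bar>A22\<bar>"
  define G where "G = \<bar>c1\<bar> + \<bar>c2\<bar> + \<bar>c3\<bar> + \<bar>c4\<bar>"
  define K where "K = H * G / \<delta> + 1"
  have HG: "H \<ge> 0" "G \<ge> 0" by (auto simp: H_def G_def)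
  have K: "K > 0" using HG \<delta> by (auto simp: K_def intro!: add_nonneg_pos)
  define \<rho> where "\<rho> = K * N 1 + 1"
  have \<rho>: "\<rho> > 0" using K by (auto simp: \<rho>_def N_def intro!: add_nonneg_pos)
  have PQ: "\<bar>P n c\<bar> + \<bar>Q n c\<bar> \<le> G * (\<Sum>i=1..<n. N i * N (n - i))" for n
  proof -
    have "\<bar>P n c\<bar> + \<bar>Q n c\<bar> \<le>
        (\<Sum>i=1..<n. \<bar>fst (c i) * (c1 * fst (c (n - i)) + c2 * snd (c (n - i)))\<bar>) +
        (\<Sum>i=1..<n. \<bar>snd (c i) * (c3 * fst (c (n - i)) + c4 * snd (c (n - i)))\<bar>)"
      unfolding P_def Q_def by (intro add_mono sum_abs)
    also have "\<dots> \<le> (\<Sum>i=1..<n. G * (N i * N (n - i)))"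
      unfolding sum.distrib[symmetric]
    proof (intro sum_mono)
      fix i
      have lin: "\<bar>k * x + l * y\<bar> \<le> G * (\<bar>x\<bar> + \<bar>y\<bar>)" if "\<bar>k\<bar> \<le> G" "\<bar>l\<bar> \<le> G" for k l x y
      proof -
        have "\<bar>k * x + l * y\<bar> \<le> \<bar>k\<bar> * \<bar>x\<bar> + \<bar>l\<bar> * \<bar>y\<bar>" by (metis abs_mult abs_triangle_ineq)
        also have "\<dots> \<le> G * \<bar>x\<bar> + G * \<bar>y\<bar>" using that by (intro add_mono mult_right_mono) auto
        finally show ?thesis by (simp add: algebra_simps)
      qed
      have "\<bar>fst (c i) * (c1 * fst (c (n - i)) + c2 * snd (c (n - i)))\<bar> \<le>
          \<bar>fst (c i)\<bar> * (G * N (n - i))"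
        unfolding abs_mult N_def by (intro mult_left_mono lin) (auto simp: G_def)
      moreover have "\<bar>snd (c i) * (c3 * fst (c (n - i)) + c4 * snd (c (n - i)))\<bar> \<le>
          \<bar>snd (c i)\<bar> * (G * N (n - i))"
        unfolding abs_mult N_def by (intro mult_left_mono lin) (auto simp: G_def)
      ultimately show "\<bar>fst (c i) * (c1 * fst (c (n - i)) + c2 * snd (c (n - i)))\<bar> +
          \<bar>snd (c i) * (c3 * fst (c (n - i)) + c4 * snd (c (n - i)))\<bar> \<le> G * (N i * N (n - i))"
        by (simp add: N_def[of i] algebra_simps)
    qed
    finally show ?thesis by (simp add: sum_distrib_left)
  qed
  have Nbd: "N n \<le> (1 / K) * \<rho> ^ n" for n
  proof (induction n rule: less_induct)
    case (less n)
    consider "n = 0" | "n = 1" | "n \<ge> 2" by linarith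
    then show ?case
    proof cases
      case 1
      then show ?thesis using K by (simp add: N_def c0)
    next
      case 2
      have "K * N 1 \<le> \<rho>" by (simp add: \<rho>_def)
      then show ?thesis using K 2 by (simp add: field_simps)
    next
      case 3
      have n: "real n \<ge> 2" using 3 by simp
      have coef: "\<bar>\<mu> * n - A22\<bar> + \<bar>A21\<bar> \<le> n * H" "\<bar>A12\<bar> + \<bar>\<mu> * n - A11\<bar> \<le> n * H"
      proof -
        have "\<bar>x\<bar> \<le> n * \<bar>x\<bar>" for x :: real using n by (simp add: mult_le_cancel_right1)
        from this[of A11] this[of A22] this[of A12] this[of A21]
        have "\<bar>\<mu> * n\<bar> + \<bar>A11\<bar> + \<bar>A12\<bar> + \<bar>A21\<bar> + \<bar>A22\<bar> \<le> n * H"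
          unfolding H_def by (simp add: abs_mult algebra_simps)
        then show "\<bar>\<mu> * n - A22\<bar> + \<bar>A21\<bar> \<le> n * H" "\<bar>A12\<bar> + \<bar>\<mu> * n - A11\<bar> \<le> n * H" by linarith+
      qed
      have "N n * \<Delta> n = \<bar>(\<mu> * n - A22) * P n c + A12 * Q n c\<bar> + \<bar>A21 * P n c + (\<mu> * n - A11) * Q n c\<bar>"
        unfolding N_def cn[OF 3] using \<Delta>(1)[OF 3] by (simp add: abs_divide field_simps)
      also have "\<dots> \<le> (\<bar>\<mu> * n - A22\<bar> * \<bar>P n c\<bar> + \<bar>A12\<bar> * \<bar>Q n c\<bar>) +
          (\<bar>A21\<bar> * \<bar>P n c\<bar> + \<bar>\<mu> * n - A11\<bar> * \<bar>Q n c\<bar>)"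
        by (intro add_mono) (metis abs_mult abs_triangle_ineq)+
      also have "\<dots> = (\<bar>\<mu> * n - A22\<bar> + \<bar>A21\<bar>) * \<bar>P n c\<bar> + (\<bar>A12\<bar> + \<bar>\<mu> * n - A11\<bar>) * \<bar>Q n c\<bar>"
        by (simp add: algebra_simps)
      also have "\<dots> \<le> n * H * \<bar>P n c\<bar> + n * H * \<bar>Q n c\<bar>"
        by (intro add_mono mult_right_mono coef) auto
      also have "\<dots> = n * H * (\<bar>P n c\<bar> + \<bar>Q n c\<bar>)" by (simp add: algebra_simps)
      also have "\<dots> \<le> n * H * (G * (\<Sum>i=1..<n. N i * N (n - i)))"
        using HG by (intro mult_left_mono PQ) auto
      also have "(\<Sum>i=1..<n. N i * N (n - i)) \<le> (\<Sum>i=1..<n. (1 / K)\<^sup>2 * \<rho> ^ n)"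
      proof (intro sum_mono)
        fix i assume i: "i \<in> {1..<n}"
        have "N i * N (n - i) \<le> (1 / K * \<rho> ^ i) * (1 / K * \<rho> ^ (n - i))"
          using i K \<rho> by (intro mult_mono less.IH) (auto simp: N_def)
        also have "\<dots> = (1 / K)\<^sup>2 * (\<rho> ^ i * \<rho> ^ (n - i))"
          by (simp add: power2_eq_square)
        also have "\<rho> ^ i * \<rho> ^ (n - i) = \<rho> ^ n"
          using i by (simp add: power_add[symmetric])
        finally show "N i * N (n - i) \<le> (1 / K)\<^sup>2 * \<rho> ^ n" .
      qed
      also have "(\<Sum>i=1..<n. (1 / K)\<^sup>2 * \<rho> ^ n) = (real n - 1) * ((1 / K)\<^sup>2 * \<rho> ^ n)"
        using 3 by (simp add: of_nat_diff)
      finally have "N n * \<Delta> n \<le> n * H * (G * ((real n - 1) * ((1 / K)\<^sup>2 * \<rho> ^ n)))"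
        using HG by (simp add: mult_left_mono)
      also have "\<dots> = (H * G) * (real n * (real n - 1) * (1 / K)\<^sup>2 * \<rho> ^ n)"
        by (simp add: algebra_simps)
      also have "\<dots> \<le> (K * \<delta>) * (real n * (real n - 1) * (1 / K)\<^sup>2 * \<rho> ^ n)"
      proof (rule mult_right_mono)
        show "H * G \<le> K * \<delta>" using \<delta> by (simp add: K_def algebra_simps)
        show "0 \<le> real n * (real n - 1) * (1 / K)\<^sup>2 * \<rho> ^ n" using n \<rho> by simp
      qed
      also have "\<dots> = (1 / K * \<rho> ^ n) * (\<delta> * (real n * (real n - 1)))"
        using K by (simp add: power2_eq_square field_simps)
      also have "\<dots> \<le> (1 / K * \<rho> ^ n) * \<Delta> n"
        using K \<rho> by (intro mult_left_mono \<Delta>(2)[OF 3]) auto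
      finally show ?thesis by (rule mult_right_le_imp_le) (rule \<Delta>(1)[OF 3])
    qed
  qed
  define f g where "f = Abs_fps (\<lambda>n. fst (c n))" and "g = Abs_fps (\<lambda>n. snd (c n))"
  define R where "R = 1 / \<rho>"
  have R: "R > 0" using \<rho> by (simp add: R_def)
  have bf: "\<bar>fps_nth f n\<bar> \<le> 1 / K * \<rho> ^ n" and bg: "\<bar>fps_nth g n\<bar> \<le> 1 / K * \<rho> ^ n" for n
    by (rule order_trans[OF _ Nbd], simp add: f_def g_def N_def)+
  have rf: "ereal R \<le> fps_conv_radius f" and rg: "ereal R \<le> fps_conv_radius g"
    unfolding R_def using fps_conv_radius_ge_of_geometric_bound[OF \<rho>] bf bg by blast+
  have convol: "fps_nth (h * (fps_const k * f + fps_const l * g)) n =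
      (\<Sum>i=1..<n. fps_nth h i * (k * fst (c (n - i)) + l * snd (c (n - i))))"
    if "fps_nth h 0 = 0" for h k l n
  proof -
    have "fps_nth (h * (fps_const k * f + fps_const l * g)) n =
        (\<Sum>i=0..n. fps_nth h i * (k * fst (c (n - i)) + l * snd (c (n - i))))"
    proof -
      have "fps_nth (fps_const k * f + fps_const l * g) j = k * fst (c j) + l * snd (c j)" for j
        by (simp add: f_def g_def)
      then show ?thesis by (subst fps_mult_nth) simp
    qed
    also have "\<dots> = (\<Sum>i=1..<n. fps_nth h i * (k * fst (c (n - i)) + l * snd (c (n - i))))"
    proof (rule sum.mono_neutral_right)
      show "\<forall>i\<in>{0..n} - {1..<n}. fps_nth h i * (k * fst (c (n - i)) + l * snd (c (n - i))) = 0"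
      proof
        fix i assume "i \<in> {0..n} - {1..<n}"
        then have "i = 0 \<or> n - i = 0" by auto
        then show "fps_nth h i * (k * fst (c (n - i)) + l * snd (c (n - i))) = 0"
          using that by (auto simp: c0)
      qed
    qed auto
    finally show ?thesis .
  qed
  have fn: "fps_nth f n = fst (c n)" and gn: "fps_nth g n = snd (c n)" for n
    by (auto simp: f_def g_def)
  have Xd: "fps_nth (fps_X * fps_deriv h) n = n * fps_nth h n" for h :: "real fps" and n
    by (cases n) (auto simp: algebra_simps)
  have ode_f: "fps_const \<mu> * (fps_X * fps_deriv f) =
      (fps_const A11 * f + fps_const A12 * g) + f * (fps_const c1 * f + fps_const c2 * g)"
    by (rule fps_ext)
      (use rec c0 in \<open>simp add: Xd convol fn gn P_def mult.assoc\<close>)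
  have ode_g: "fps_const \<mu> * (fps_X * fps_deriv g) =
      (fps_const A21 * f + fps_const A22 * g) + g * (fps_const c3 * f + fps_const c4 * g)"
    by (rule fps_ext)
      (use rec c0 in \<open>simp add: Xd convol fn gn Q_def mult.assoc\<close>)
  have main: "(eval_fps f has_real_derivative eval_fps (fps_deriv f) \<theta>) (at \<theta>) \<and>
      (eval_fps g has_real_derivative eval_fps (fps_deriv g) \<theta>) (at \<theta>) \<and>
      \<mu> * \<theta> * eval_fps (fps_deriv f) \<theta> = A11 * eval_fps f \<theta> + A12 * eval_fps g \<theta> +
        eval_fps f \<theta> * (c1 * eval_fps f \<theta> + c2 * eval_fps g \<theta>) \<and>
      \<mu> * \<theta> * eval_fps (fps_deriv g) \<theta> = A21 * eval_fps f \<theta> + A22 * eval_fps g \<theta> +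
        eval_fps g \<theta> * (c3 * eval_fps f \<theta> + c4 * eval_fps g \<theta>)"
    if th: "\<bar>\<theta>\<bar> < R" for \<theta>
  proof -
    have F: "ereal (norm \<theta>) < fps_conv_radius f" and Gg: "ereal (norm \<theta>) < fps_conv_radius g"
      using less_le_trans[OF _ rf, of "ereal (norm \<theta>)"] less_le_trans[OF _ rg, of "ereal (norm \<theta>)"] th
      by auto
    have DF: "ereal (norm \<theta>) < fps_conv_radius (fps_deriv f)"
      and DG: "ereal (norm \<theta>) < fps_conv_radius (fps_deriv g)"
      using F Gg fps_conv_radius_deriv less_le_trans by blast+
    have cm: "ereal (norm \<theta>) < fps_conv_radius (fps_const k * h)"
      "eval_fps (fps_const k * h) \<theta> = k * eval_fps h \<theta>"
      if "ereal (norm \<theta>) < fps_conv_radius h" for k and h :: "real fps"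
    proof -
      show "ereal (norm \<theta>) < fps_conv_radius (fps_const k * h)"
        using that fps_conv_radius_cmult_left[of k h] by (cases "k = 0") auto
      show "eval_fps (fps_const k * h) \<theta> = k * eval_fps h \<theta>"
        using that by (subst eval_fps_mult) auto
    qed
    have ad: "ereal (norm \<theta>) < fps_conv_radius (h1 + h2)"
      if "ereal (norm \<theta>) < fps_conv_radius h1" "ereal (norm \<theta>) < fps_conv_radius h2" for h1 h2 :: "real fps"
      using that by (intro less_le_trans[OF _ fps_conv_radius_add]) auto
    have mu: "ereal (norm \<theta>) < fps_conv_radius (h1 * h2)"
      if "ereal (norm \<theta>) < fps_conv_radius h1" "ereal (norm \<theta>) < fps_conv_radius h2" for h1 h2 :: "real fps"
      using that by (intro less_le_trans[OF _ fps_conv_radius_mult]) auto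
    have X: "ereal (norm \<theta>) < fps_conv_radius (fps_X :: real fps)" by simp
    note evals = eval_fps_add eval_fps_mult eval_fps_X F Gg DF DG cm ad mu X
    have "\<mu> * (\<theta> * eval_fps (fps_deriv f) \<theta>) = A11 * eval_fps f \<theta> + A12 * eval_fps g \<theta> +
        eval_fps f \<theta> * (c1 * eval_fps f \<theta> + c2 * eval_fps g \<theta>)"
      using arg_cong[OF ode_f, of "\<lambda>h. eval_fps h \<theta>"] by (simp only: evals)
    moreover have "\<mu> * (\<theta> * eval_fps (fps_deriv g) \<theta>) = A21 * eval_fps f \<theta> + A22 * eval_fps g \<theta> +
        eval_fps g \<theta> * (c3 * eval_fps f \<theta> + c4 * eval_fps g \<theta>)"
      using arg_cong[OF ode_g, of "\<lambda>h. eval_fps h \<theta>"] by (simp only: evals)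
    ultimately show ?thesis
      using has_field_derivative_eval_fps[OF F] has_field_derivative_eval_fps[OF Gg]
      by (simp add: mult.assoc)
  qed
  show ?thesis
    by (intro exI[of _ R] conjI R exI[of _ "eval_fps f"] exI[of _ "eval_fps g"]
        exI[of _ "eval_fps (fps_deriv f)"] exI[of _ "eval_fps (fps_deriv g)"])
      (use main in \<open>auto simp: eval_fps_at_0 f_def g_def c0 c1'[simplified]\<close>)
qed

section \<open>Solutions from the Lotka-Volterra system\<close>

text \<open>
  With \<open>D \<noteq> 0\<close> this tells the sign of \<open>a\<close> to the right of zero, that is, the side of the equilibrium on
  which an invariant curve with initial direction \<open>D\<close> lies.
\<close>
lemma tendsto_quotient_at_right:
  fixes a :: "real \<Rightarrow> real"
  assumes "(a has_real_derivative D) (at 0)" "a 0 = 0"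
  shows "((\<lambda>x. a x / x) \<longlongrightarrow> D) (at_right 0)"
  using assms unfolding has_field_derivative_iff
  by (auto intro: tendsto_mono[OF at_le])

lemma exp_mult_at_right:
  assumes "k > 0"
  shows "filterlim (\<lambda>t::real. exp (k * t)) (at_right 0) at_bot"
  unfolding filterlim_at using exp_mult_at_bot[OF assms] by auto

locale log_emden_fowler =
  fixes p q \<beta> :: real
  assumes p: "p > 1" and q: "q > p - 1" and \<beta>: "\<beta> > 0"
begin

definition "m = q - p + 1"
definition "\<gamma> = \<beta> / m"
definition "\<alpha> = \<beta> / (p - 1)"
text \<open>
  The amplitude of the power solution \<open>A * exp (- \<gamma> * t)\<close>; it is the number \<open>a_star\<close>.
\<close>
definition "A = ((p - 1) * \<gamma> powr p) powr (1 / m)"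

abbreviation "inv_flux \<equiv> p_flux (p / (p - 1))"

lemma m: "m > 0" and \<gamma>: "\<gamma> > 0" and \<alpha>: "\<alpha> > 0" and A: "A > 0"
  using p q \<beta> by (auto simp: m_def \<gamma>_def \<alpha>_def A_def)

lemma \<gamma>_m: "\<gamma> * m = \<beta>" and \<alpha>_p: "\<alpha> * (p - 1) = \<beta>"
  using p m by (auto simp: \<gamma>_def \<alpha>_def)

lemma \<gamma>_q: "\<gamma> * q = \<beta> + \<gamma> * (p - 1)"
  using \<gamma>_m by (simp add: m_def algebra_simps)

lemma A_powr: "A powr m = (p - 1) * \<gamma> powr p"
  using p m \<gamma> by (simp add: A_def powr_powr)

lemma inv_flux_powr:
  assumes "z > 0"
  shows "inv_flux (z powr (p - 1)) = z"
  using p_flux_conjugate_pos[OF p, of "z powr (p - 1)"] p assms by (simp add: powr_powr)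

text \<open>
  The formula for \<open>u\<close> comes from \<open>\<bar>y\<bar> = (\<bar>S\<bar> * u) powr (p - 1)\<close> and
  \<open>\<bar>X\<bar> * \<bar>y\<bar> = exp (\<beta> * t) * u powr q\<close>, which determine \<open>u\<close> as
  \<open>u powr m = \<bar>X\<bar> * \<bar>S\<bar> powr (p - 1) * exp (- \<beta> * t)\<close>. The sign \<open>\<kappa>\<close> of \<open>S\<close> is opposite to that of
  \<open>u'\<close>, and the sign of \<open>X\<close> then decides which of the two equations \<open>u\<close> solves.
\<close>
lemma log_system_of_lotka_volterra:
  fixes S X :: "real \<Rightarrow> real" and \<epsilon> \<kappa> :: real
  assumes J: "open J" and \<epsilon>: "\<epsilon> \<in> {1, -1}" and \<kappa>: "\<kappa> \<in> {1, -1}"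
    and S: "\<And>t. t \<in> J \<Longrightarrow> (S has_real_derivative S t * (S t - X t / (p - 1))) (at t)"
    and X: "\<And>t. t \<in> J \<Longrightarrow> (X has_real_derivative X t * (\<beta> - q * S t + X t)) (at t)"
    and sgn: "\<And>t. t \<in> J \<Longrightarrow> 0 < \<kappa> * S t" "\<And>t. t \<in> J \<Longrightarrow> 0 < - (\<epsilon> * \<kappa> * X t)"
  defines "u \<equiv> \<lambda>t. exp ((ln (- (\<epsilon> * \<kappa> * X t)) + (p - 1) * ln (\<kappa> * S t) - \<beta> * t) / m)"
  defines "y \<equiv> \<lambda>t. - \<kappa> * (\<kappa> * S t * u t) powr (p - 1)"
  shows "log_system p q \<beta> \<epsilon> J u y" and "\<And>t. t \<in> J \<Longrightarrow> inv_flux (y t) = - S t * u t"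
proof -
  have pos: "u t > 0" for t by (simp add: u_def)
  have Sn: "S t \<noteq> 0" and Xn: "X t \<noteq> 0" if "t \<in> J" for t using sgn[OF that] by auto
  show root: "inv_flux (y t) = - S t * u t" if "t \<in> J" for t
  proof -
    have z: "0 < \<kappa> * S t * u t" using sgn(1)[OF that] pos by simp
    have "inv_flux ((\<kappa> * S t * u t) powr (p - 1)) = \<kappa> * S t * u t"
      by (rule inv_flux_powr[OF z])
    then show ?thesis using \<kappa> by (auto simp: y_def p_flux_minus)
  qed
  show "log_system p q \<beta> \<epsilon> J u y"
    unfolding log_system_def
  proof (intro ballI conjI)
    fix t assume t: "t \<in> J"
    note s = sgn[OF t] and n = Sn[OF t] Xn[OF t]
    show "0 < u t" by (rule pos)
    have inv: "inverse (k * x) * (k * (x * D)) = D" if "0 < k * x" for k x D :: real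
    proof -
      have "inverse (k * x) * (k * (x * D)) = (inverse (k * x) * (k * x)) * D"
        by (simp only: mult.assoc)
      also have "\<dots> = D" using that by (subst left_inverse) auto
      finally show ?thesis .
    qed
    have lnS: "((\<lambda>t. ln (\<kappa> * S t)) has_real_derivative S t - X t / (p - 1)) (at t)"
      using DERIV_chain2[OF DERIV_ln[OF s(1)] DERIV_cmult[OF S[OF t], of \<kappa>]]
      by (simp only: inv[OF s(1)])
    have s': "0 < (- (\<epsilon> * \<kappa>)) * X t" using s(2) by simp
    have lnX: "((\<lambda>t. ln (- (\<epsilon> * \<kappa> * X t))) has_real_derivative \<beta> - q * S t + X t) (at t)"
      using DERIV_chain2[OF DERIV_ln[OF s'] DERIV_cmult[OF X[OF t], of "- (\<epsilon> * \<kappa>)"]]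
      unfolding inv[OF s'] by (simp only: mult_minus_left)
    have du0: "(u has_real_derivative
        u t * (((\<beta> - q * S t + X t) + (p - 1) * (S t - X t / (p - 1)) - \<beta>) / m)) (at t)"
    proof -
      have "((\<lambda>t. (ln (- (\<epsilon> * \<kappa> * X t)) + (p - 1) * ln (\<kappa> * S t) - \<beta> * t) / m) has_real_derivative
          ((\<beta> - q * S t + X t) + (p - 1) * (S t - X t / (p - 1)) - \<beta> * 1) / m) (at t)"
        by (intro DERIV_cdivide DERIV_diff DERIV_add DERIV_cmult lnS lnX DERIV_ident)
      from DERIV_chain2[OF DERIV_exp this] show ?thesis unfolding u_def by simp
    qed
    have du1: "((\<beta> - q * S t + X t) + (p - 1) * (S t - X t / (p - 1)) - \<beta>) / m = - S t"
    proof -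
      have "(p - 1) * (S t - X t / (p - 1)) = (p - 1) * S t - X t"
        using p by (simp add: right_diff_distrib)
      then have "(\<beta> - q * S t + X t) + (p - 1) * (S t - X t / (p - 1)) - \<beta> = - S t * m"
        by (simp add: m_def algebra_simps)
      then show ?thesis using m by simp
    qed
    have du: "(u has_real_derivative - S t * u t) (at t)"
      using du0 unfolding du1 by (simp add: mult.commute)
    then show "(u has_real_derivative inv_flux (y t)) (at t)" by (simp add: root[OF t])
    have ln_u: "((\<lambda>t. ln (u t)) has_real_derivative - S t) (at t)"
    proof -
      have "inverse (u t) * (- S t * u t) = - S t" using pos[of t] by (simp add: field_simps)
      then show ?thesis using DERIV_chain2[OF DERIV_ln[OF pos] du] by (simp only:)
    qed
    let ?y = "\<lambda>t. - \<kappa> * exp ((p - 1) * (ln (\<kappa> * S t) + ln (u t)))"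
    have d1: "(?y has_real_derivative ?y t * ((p - 1) * (S t - X t / (p - 1) + - S t))) (at t)"
    proof -
      have "((\<lambda>t. (p - 1) * (ln (\<kappa> * S t) + ln (u t))) has_real_derivative
          (p - 1) * ((S t - X t / (p - 1)) + - S t)) (at t)"
        by (intro DERIV_add DERIV_cmult lnS ln_u)
      from DERIV_cmult[OF DERIV_chain2[OF DERIV_exp this], of "- \<kappa>"]
      show ?thesis by (simp add: mult.assoc)
    qed
    have d2: "(p - 1) * (S t - X t / (p - 1) + - S t) = - X t" using p by simp
    have yt: "?y t = y t" if "t \<in> J" for t
      using sgn(1)[OF that] pos[of t] Sn[OF that] \<kappa> by (auto simp add: y_def powr_def ln_mult_pos)
    have d3: "exp ((p - 1) * (ln (\<kappa> * S t) + ln (u t))) * (- (\<epsilon> * \<kappa> * X t))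
        = exp (\<beta> * t) * u t powr q"
    proof -
      have "exp ((p - 1) * (ln (\<kappa> * S t) + ln (u t))) * (- (\<epsilon> * \<kappa> * X t))
          = exp ((p - 1) * (ln (\<kappa> * S t) + ln (u t)) + ln (- (\<epsilon> * \<kappa> * X t)))"
        using s by (simp add: exp_add)
      also have "(p - 1) * (ln (\<kappa> * S t) + ln (u t)) + ln (- (\<epsilon> * \<kappa> * X t)) = \<beta> * t + q * ln (u t)"
      proof -
        have "ln (u t) * m = ln (- (\<epsilon> * \<kappa> * X t)) + (p - 1) * ln (\<kappa> * S t) - \<beta> * t"
          using m by (simp add: u_def)
        then show ?thesis by (simp add: m_def algebra_simps)
      qed
      finally show ?thesis using pos[of t] by (simp add: exp_add powr_def)
    qed
    have "?y t * ((p - 1) * (S t - X t / (p - 1) + - S t)) = - \<epsilon> * exp (\<beta> * t) * u t powr q"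
      unfolding d2 mult.assoc[of "- \<epsilon>"] d3[symmetric] using \<epsilon> by auto
    with d1 have "(?y has_real_derivative - \<epsilon> * exp (\<beta> * t) * u t powr q) (at t)"
      by (simp only:)
    then show "(y has_real_derivative - \<epsilon> * exp (\<beta> * t) * u t powr q) (at t)"
      by (rule has_field_derivative_transform_within_open[OF _ J t]) (rule yt)
  qed
qed

text \<open>
  The expression of \<open>u\<close> through \<open>S\<close> and \<open>X\<close>, at the equilibrium \<open>S = \<gamma>\<close>, \<open>X = (p - 1) * \<gamma>\<close>.
\<close>
lemma power_solution_exp:
  "exp ((ln ((p - 1) * \<gamma>) + (p - 1) * ln \<gamma> - \<beta> * t) / m) = A * exp (- \<gamma> * t)"
proof -
    have "ln A * m = ln ((p - 1) * \<gamma> powr p)"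
      using A A_powr ln_powr[of A m] by (simp add: mult.commute)
    also have "\<dots> = ln ((p - 1) * \<gamma>) + (p - 1) * ln \<gamma>"
    proof -
      have "ln ((p - 1) * \<gamma> powr p) = ln (p - 1) + p * ln \<gamma>"
        using p \<gamma> by (subst ln_mult) (auto simp: ln_powr)
      moreover have "ln ((p - 1) * \<gamma>) = ln (p - 1) + ln \<gamma>"
        using p \<gamma> by (subst ln_mult) auto
      ultimately show ?thesis by (simp add: algebra_simps)
    qed
    finally have L: "ln A * m = ln ((p - 1) * \<gamma>) + (p - 1) * ln \<gamma>" .
    have "(ln ((p - 1) * \<gamma>) + (p - 1) * ln \<gamma> - \<beta> * t) / m = (ln A * m - (\<gamma> * m) * t) / m"
      by (simp only: L \<gamma>_m)
    also have "\<dots> = ln A - \<gamma> * t" using m by (simp add: diff_divide_distrib)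
    finally have "(ln ((p - 1) * \<gamma>) + (p - 1) * ln \<gamma> - \<beta> * t) / m = ln A - \<gamma> * t" .
    then show ?thesis using A by (simp only: exp_diff exp_ln exp_minus divide_inverse mult_minus_left)
qed

lemma log_system_power_solution:
  "log_system p q \<beta> (- 1) UNIV (\<lambda>t. A * exp (- \<gamma> * t)) (\<lambda>t. - ((\<gamma> * (A * exp (- \<gamma> * t))) powr (p - 1)))"
proof -
  have eq: "exp ((ln ((p - 1) * \<gamma>) + (p - 1) * ln \<gamma> - \<beta> * t) / m) = A * exp (- \<gamma> * t)" for t
    by (rule power_solution_exp)
  have 0: "\<beta> - q * \<gamma> + (p - 1) * \<gamma> = 0" using \<gamma>_q by (simp add: algebra_simps)
  let ?e = "\<lambda>t. exp ((ln (- (- 1 * 1 * ((p - 1) * \<gamma>))) + (p - 1) * ln (1 * \<gamma>) - \<beta> * t) / m)"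
  have "log_system p q \<beta> (- 1) UNIV ?e (\<lambda>t. - 1 * (1 * \<gamma> * ?e t) powr (p - 1))"
  proof (rule log_system_of_lotka_volterra(1)[of UNIV "- 1" 1 "\<lambda>_. \<gamma>" "\<lambda>_. (p - 1) * \<gamma>"])
    show "((\<lambda>_. \<gamma>) has_real_derivative \<gamma> * (\<gamma> - (p - 1) * \<gamma> / (p - 1))) (at t)" for t
      using p by simp
    show "((\<lambda>_. (p - 1) * \<gamma>) has_real_derivative
        (p - 1) * \<gamma> * (\<beta> - q * \<gamma> + (p - 1) * \<gamma>)) (at t)" for t
      unfolding 0 by simp
  qed (use p \<gamma> in auto)
  moreover have "?e t = A * exp (- \<gamma> * t)" for t
    using eq[of t] by (simp only: mult_1 mult_minus1 minus_minus)
  ultimately show ?thesis by (simp only: mult_1 mult_minus1)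
qed

text \<open>
  The quadratic part of the system is the same at every equilibrium \<open>(s0, x0)\<close>; only the linear part depends
  on it. So one curve lemma serves the three branches used below.
\<close>
lemma equilibrium_curve:
  fixes s0 x0 \<mu> a1 b1 \<delta> :: real
  assumes equil: "s0 * (s0 - x0 / (p - 1)) = 0" "x0 * (\<beta> - q * s0 + x0) = 0"
    and eig: "(2 * s0 - x0 / (p - 1)) * a1 + (- s0 / (p - 1)) * b1 = \<mu> * a1"
      "(- q * x0) * a1 + (\<beta> - q * s0 + 2 * x0) * b1 = \<mu> * b1"
    and nonres: "\<delta> > 0" "\<And>n::nat. n \<ge> 2 \<Longrightarrow> \<delta> * (real n * (real n - 1)) \<le>
      (\<mu> * n - (2 * s0 - x0 / (p - 1))) * (\<mu> * n - (\<beta> - q * s0 + 2 * x0)) -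
      (- s0 / (p - 1)) * (- q * x0)"
  shows "\<exists>R>0. \<exists>a b. a 0 = 0 \<and> b 0 = 0 \<and> (a has_real_derivative a1) (at 0) \<and> isCont b 0 \<and>
    (\<forall>t. exp (\<mu> * t) < R \<longrightarrow> (let S = \<lambda>t. s0 + a (exp (\<mu> * t)); X = \<lambda>t. x0 + b (exp (\<mu> * t)) in
       (S has_real_derivative S t * (S t - X t / (p - 1))) (at t) \<and>
       (X has_real_derivative X t * (\<beta> - q * S t + X t)) (at t)))"
proof -
  obtain R a b a' b' where R: "R > 0" and 0: "a 0 = 0" "b 0 = 0" "a' 0 = a1"
    and curve: "\<And>\<theta>. \<bar>\<theta>\<bar> < R \<Longrightarrow> (a has_real_derivative a' \<theta>) (at \<theta>) \<and> (b has_real_derivative b' \<theta>) (at \<theta>) \<and>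
       \<mu> * \<theta> * a' \<theta> = (2 * s0 - x0 / (p - 1)) * a \<theta> + (- s0 / (p - 1)) * b \<theta> +
         a \<theta> * (1 * a \<theta> + (- 1 / (p - 1)) * b \<theta>) \<and>
       \<mu> * \<theta> * b' \<theta> = (- q * x0) * a \<theta> + (\<beta> - q * s0 + 2 * x0) * b \<theta> +
         b \<theta> * ((- q) * a \<theta> + 1 * b \<theta>)"
    using lotka_volterra_invariant_curve[OF eig nonres, of 1 "- 1 / (p - 1)" "- q" 1] by blast
  have "(S has_real_derivative S t * (S t - X t / (p - 1))) (at t) \<and>
       (X has_real_derivative X t * (\<beta> - q * S t + X t)) (at t)"
    if t: "exp (\<mu> * t) < R" and S: "S = (\<lambda>t. s0 + a (exp (\<mu> * t)))"
      and X: "X = (\<lambda>t. x0 + b (exp (\<mu> * t)))" for t S X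
  proof -
    let ?\<theta> = "exp (\<mu> * t)"
    have "\<bar>?\<theta>\<bar> < R" using t by simp
    note c = curve[OF this]
    have d\<theta>: "((\<lambda>t. exp (\<mu> * t)) has_real_derivative \<mu> * ?\<theta>) (at t)"
      by (auto intro!: derivative_eq_intros)
    have "(S has_real_derivative 0 + a' ?\<theta> * (\<mu> * ?\<theta>)) (at t)"
      unfolding S by (intro DERIV_add DERIV_const DERIV_chain2[OF conjunct1[OF c] d\<theta>])
    moreover have "0 + a' ?\<theta> * (\<mu> * ?\<theta>) = S t * (S t - X t / (p - 1))"
    proof -
      have "0 + a' ?\<theta> * (\<mu> * ?\<theta>) = \<mu> * ?\<theta> * a' ?\<theta>" by simp
      also have "\<dots> = s0 * (s0 - x0 / (p - 1)) + \<mu> * ?\<theta> * a' ?\<theta>" by (simp only: equil add_0)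
      also have "\<dots> = S t * (S t - X t / (p - 1))"
        unfolding c[THEN conjunct2, THEN conjunct2, THEN conjunct1] S X
        by (simp only: add_divide_distrib) (simp add: algebra_simps add_divide_distrib)
      finally show ?thesis .
    qed
    moreover have "(X has_real_derivative 0 + b' ?\<theta> * (\<mu> * ?\<theta>)) (at t)"
      unfolding X by (intro DERIV_add DERIV_const DERIV_chain2[OF conjunct1[OF conjunct2[OF c]] d\<theta>])
    moreover have "0 + b' ?\<theta> * (\<mu> * ?\<theta>) = X t * (\<beta> - q * S t + X t)"
    proof -
      have "0 + b' ?\<theta> * (\<mu> * ?\<theta>) = \<mu> * ?\<theta> * b' ?\<theta>" by simp
      also have "\<dots> = x0 * (\<beta> - q * s0 + x0) + \<mu> * ?\<theta> * b' ?\<theta>" by (simp only: equil add_0)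
      also have "\<dots> = X t * (\<beta> - q * S t + X t)"
        unfolding c[THEN conjunct2, THEN conjunct2, THEN conjunct2] S X
        by (simp add: algebra_simps)
      finally show ?thesis .
    qed
    ultimately show ?thesis by simp
  qed
  moreover have "(a has_real_derivative a1) (at 0)" "isCont b 0"
    using curve[of 0] R 0 by (auto intro: DERIV_isCont)
  ultimately show ?thesis using R 0 by (intro exI[of _ R] conjI exI[of _ a] exI[of _ b]) (auto simp: Let_def)
qed

section \<open>Regular solutions at minus infinity\<close>

text \<open>
  The unstable curve of the equilibrium \<open>S = 0\<close>, \<open>X = - \<beta>\<close>, whose eigenvalues are \<open>\<alpha>\<close> and \<open>- \<beta>\<close>. The leading
  coefficient \<open>\<epsilon>\<close> of \<open>S\<close> gives \<open>S\<close> the sign \<open>\<epsilon>\<close>, which selects the equation with this \<open>\<epsilon>\<close>. Since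
  \<open>S\<close> is of the order \<open>exp (\<alpha> * t)\<close> and \<open>\<alpha> * (p - 1) = \<beta>\<close>, the exponentials cancel in the formula for
  \<open>u\<close>, and \<open>u\<close> has a positive limit.
\<close>
lemma regular_solution_exists:
  assumes \<epsilon>: "\<epsilon> \<in> {1, -1}"
  shows "\<exists>T u y L. log_system p q \<beta> \<epsilon> {..<T} u y \<and> 0 < L \<and> (u \<longlongrightarrow> L) at_bot \<and> (y \<longlongrightarrow> 0) at_bot \<and>
    ((\<lambda>t. exp (- \<alpha> * t) * inv_flux (y t)) \<longlongrightarrow> - \<epsilon> * (L powr q / \<beta>) powr (1 / (p - 1))) at_bot"
proof -
  define b1 where "b1 = \<beta> * q * \<epsilon> / (\<alpha> + \<beta>)"
  have ab: "\<alpha> + \<beta> > 0" using \<alpha> \<beta> by simp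
  obtain R a b where R: "R > 0" and 0: "a 0 = 0" "b 0 = 0"
    and da: "(a has_real_derivative \<epsilon>) (at 0)" and cb: "isCont b 0"
    and curve: "\<And>t. exp (\<alpha> * t) < R \<Longrightarrow>
      (let S = \<lambda>t. 0 + a (exp (\<alpha> * t)); X = \<lambda>t. - \<beta> + b (exp (\<alpha> * t)) in
        (S has_real_derivative S t * (S t - X t / (p - 1))) (at t) \<and>
        (X has_real_derivative X t * (\<beta> - q * S t + X t)) (at t))"
  proof -
    have al: "2 * 0 - - \<beta> / (p - 1) = \<alpha>" by (simp add: \<alpha>_def)
    have "(\<beta> * q) * \<epsilon> + (- \<beta>) * b1 = \<alpha> * b1"
      unfolding b1_def using ab by (simp add: field_simps)
    moreover have "\<alpha>\<^sup>2 * (real n * (real n - 1)) \<le> (\<alpha> * n - \<alpha>) * (\<alpha> * n - - \<beta>)" if "n \<ge> 2" for n :: nat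
    proof -
      have "\<alpha>\<^sup>2 * (real n * (real n - 1)) = (\<alpha> * n - \<alpha>) * (\<alpha> * n)"
        by (simp add: power2_eq_square algebra_simps)
      also have "\<dots> \<le> (\<alpha> * n - \<alpha>) * (\<alpha> * n - - \<beta>)"
        using that \<alpha> \<beta> by (intro mult_left_mono) auto
      finally show ?thesis .
    qed
    ultimately show thesis
      using equilibrium_curve[of 0 "- \<beta>" \<epsilon> b1 \<alpha> "\<alpha>\<^sup>2"] \<alpha> that unfolding al by (auto simp: mult.commute)
  qed
  define \<theta> where "\<theta> t = exp (\<alpha> * t)" for t
  define S where "S t = a (\<theta> t)" for t
  define X where "X t = b (\<theta> t) - \<beta>" for t
  have \<theta>0: "filterlim \<theta> (at_right 0) at_bot"
    unfolding \<theta>_def[abs_def] by (rule exp_mult_at_right[OF \<alpha>])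
  have Slim: "((\<lambda>t. \<epsilon> * (S t / \<theta> t)) \<longlongrightarrow> 1) at_bot"
  proof -
    have "((\<lambda>x. a x / x) \<longlongrightarrow> \<epsilon>) (at_right 0)"
      by (rule tendsto_quotient_at_right[OF da 0(1)])
    from tendsto_mult_left[OF filterlim_compose[OF this \<theta>0], of \<epsilon>]
    show ?thesis using \<epsilon> by (auto simp: S_def)
  qed
  have Xlim: "((\<lambda>t. - X t) \<longlongrightarrow> \<beta>) at_bot"
  proof -
    have "(b \<longlongrightarrow> 0) (at_right 0)"
      using cb 0 by (auto simp: isCont_def intro: tendsto_mono[OF at_le])
    from filterlim_compose[OF this \<theta>0]
    have "((\<lambda>t. \<beta> - b (\<theta> t)) \<longlongrightarrow> \<beta> - 0) at_bot" by (intro tendsto_intros)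
    then show ?thesis by (simp add: X_def)
  qed
  have \<theta>lim: "(\<theta> \<longlongrightarrow> 0) at_bot" unfolding \<theta>_def[abs_def] by (rule exp_mult_at_bot[OF \<alpha>])
  have "\<forall>\<^sub>F t in at_bot. 0 < \<epsilon> * (S t / \<theta> t) \<and> 0 < - X t \<and> \<theta> t < R"
    using order_tendstoD(1)[OF Slim, of 0] order_tendstoD(1)[OF Xlim, of 0] \<beta>
      order_tendstoD(2)[OF \<theta>lim, of R] R by (simp add: eventually_conj_iff)
  then obtain T where T: "\<And>t. t \<le> T \<Longrightarrow> 0 < \<epsilon> * (S t / \<theta> t) \<and> 0 < - X t \<and> \<theta> t < R"
    by (auto simp: eventually_at_bot_linorder)
  have \<theta>pos: "\<theta> t > 0" for t by (simp add: \<theta>_def)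
  have Spos: "0 < \<epsilon> * S t" if "t \<le> T" for t
    using T[OF that] \<theta>pos[of t] by (simp add: zero_less_mult_iff zero_less_divide_iff)
  define u where "u = (\<lambda>t. exp ((ln (- (\<epsilon> * \<epsilon> * X t)) + (p - 1) * ln (\<epsilon> * S t) - \<beta> * t) / m))"
  define y where "y = (\<lambda>t. - \<epsilon> * (\<epsilon> * S t * u t) powr (p - 1))"
  have \<epsilon>\<epsilon>: "\<epsilon> * \<epsilon> = 1" using \<epsilon> by auto
  have sys: "log_system p q \<beta> \<epsilon> {..<T} u y" and root: "\<And>t. t \<in> {..<T} \<Longrightarrow> inv_flux (y t) = - S t * u t"
  proof -
    have SX: "(\<lambda>t. 0 + a (exp (\<alpha> * t))) = S" "(\<lambda>t. - \<beta> + b (exp (\<alpha> * t))) = X"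
      by (auto simp: S_def X_def \<theta>_def)
    have 1: "(S has_real_derivative S t * (S t - X t / (p - 1))) (at t)"
      and 2: "(X has_real_derivative X t * (\<beta> - q * S t + X t)) (at t)" if "t \<in> {..<T}" for t
      using curve[of t] T[of t] that unfolding SX Let_def by (auto simp: \<theta>_def)
    have 3: "0 < \<epsilon> * S t" "0 < - (\<epsilon> * \<epsilon> * X t)" if "t \<in> {..<T}" for t
      using Spos[of t] T[of t] that \<epsilon>\<epsilon> by auto
    show "log_system p q \<beta> \<epsilon> {..<T} u y" "\<And>t. t \<in> {..<T} \<Longrightarrow> inv_flux (y t) = - S t * u t"
      unfolding u_def y_def
      using log_system_of_lotka_volterra[OF open_lessThan \<epsilon> \<epsilon> 1 2 3] by blast+
  qed
  define L where "L = \<beta> powr (1 / m)"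
  have L: "L > 0" "L powr m = \<beta>" using \<beta> m by (auto simp: L_def powr_powr)
  have ev: "\<forall>\<^sub>F t in at_bot. t < T" by (rule eventually_gt_at_bot)
  have ulim: "(u \<longlongrightarrow> L) at_bot"
  proof -
    have l: "((\<lambda>t. exp ((ln (- X t) + (p - 1) * ln (\<epsilon> * (S t / \<theta> t))) / m)) \<longlongrightarrow>
        exp ((ln \<beta> + (p - 1) * ln 1) / m)) at_bot"
      by (intro tendsto_intros Xlim Slim) (use \<beta> m in auto)
    have l': "exp ((ln \<beta> + (p - 1) * ln 1) / m) = L" using \<beta> by (simp add: L_def powr_def)
    have e: "\<forall>\<^sub>F t in at_bot. exp ((ln (- X t) + (p - 1) * ln (\<epsilon> * (S t / \<theta> t))) / m) = u t"
      using ev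
    proof eventually_elim
      case (elim t)
      have "\<epsilon> * S t \<noteq> 0" "\<theta> t \<noteq> 0" using Spos[of t] \<theta>pos[of t] elim by auto
      then have "ln (\<epsilon> * S t / \<theta> t) = ln (\<epsilon> * S t) - ln (\<theta> t)" by (subst ln_div) auto
      moreover have "ln (\<theta> t) = \<alpha> * t" by (simp add: \<theta>_def)
      ultimately have "(p - 1) * ln (\<epsilon> * (S t / \<theta> t)) = (p - 1) * (ln (\<epsilon> * S t) - \<alpha> * t)"
        by (simp only: times_divide_eq_right)
      also have "\<dots> = (p - 1) * ln (\<epsilon> * S t) - \<beta> * t"
        using arg_cong[OF \<alpha>_p, of "\<lambda>x. x * t"] by (simp add: algebra_simps)
      finally have e: "(p - 1) * ln (\<epsilon> * (S t / \<theta> t)) = (p - 1) * ln (\<epsilon> * S t) - \<beta> * t" .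
      show ?case unfolding u_def e \<epsilon>\<epsilon> by (simp add: add_diff_eq)
    qed
    show ?thesis using Lim_transform_eventually[OF l e] unfolding l' .
  qed
  have r: "\<forall>\<^sub>F t in at_bot. - \<epsilon> * (\<epsilon> * (S t / \<theta> t)) * u t = exp (- \<alpha> * t) * inv_flux (y t)"
    using ev
  proof eventually_elim
    case (elim t)
    then show ?case using root[of t] \<epsilon>\<epsilon>
      by (simp add: \<theta>_def exp_minus divide_inverse mult.assoc[symmetric])
  qed
  have "((\<lambda>t. - \<epsilon> * (\<epsilon> * (S t / \<theta> t)) * u t) \<longlongrightarrow> - \<epsilon> * 1 * L) at_bot"
    by (intro tendsto_intros Slim ulim)
  moreover have "(L powr q / \<beta>) powr (1 / (p - 1)) = L"
  proof -
    have "L powr q / \<beta> = L powr (p - 1)"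
      using L(1) unfolding L(2)[symmetric] by (simp add: powr_diff[symmetric] m_def)
    then show ?thesis using L(1) p by (simp add: powr_powr)
  qed
  ultimately have dlim: "((\<lambda>t. exp (- \<alpha> * t) * inv_flux (y t)) \<longlongrightarrow>
      - \<epsilon> * (L powr q / \<beta>) powr (1 / (p - 1))) at_bot"
    using tendsto_cong[OF r] by simp
  have ylim: "(y \<longlongrightarrow> 0) at_bot"
  proof -
    have "((\<lambda>t. \<epsilon> * (S t / \<theta> t) * \<theta> t * u t) \<longlongrightarrow> 1 * 0 * L) at_bot"
      by (intro tendsto_intros Slim ulim \<theta>lim)
    then have "((\<lambda>t. \<epsilon> * S t * u t) \<longlongrightarrow> 0) at_bot"
      using \<theta>pos by (simp add: less_imp_neq[symmetric])
    then have "((\<lambda>t. (\<epsilon> * S t * u t) powr (p - 1)) \<longlongrightarrow> 0 powr (p - 1)) at_bot"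
    proof (rule tendsto_powr'[OF _ tendsto_const], intro disjI2 conjI)
      show "\<forall>\<^sub>F t in at_bot. 0 \<le> \<epsilon> * S t * u t"
        using ev by eventually_elim (use Spos in \<open>auto simp: u_def intro!: mult_nonneg_nonneg less_imp_le\<close>)
    qed (use p in auto)
    from tendsto_mult_left[OF this, of "- \<epsilon>"] show ?thesis by (simp add: y_def)
  qed
  show ?thesis using sys L(1) ulim ylim dlim by blast
qed

end

section \<open>Solutions asymptotic to the power solution\<close>

context log_emden_fowler begin

text \<open>
  The power solution is the equilibrium \<open>S = \<gamma>\<close>, \<open>X = (p - 1) * \<gamma>\<close>, and \<open>\<mu>\<close> is either eigenvalue. The leading
  coefficient \<open>- 1\<close> of \<open>S - \<gamma>\<close> chooses the branch with \<open>S < \<gamma>\<close>, where \<open>u * exp (\<gamma> * t)\<close> increases: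
  on the stable curve this places \<open>u\<close> below the power solution. The filter \<open>F\<close> is \<open>at_bot\<close> for
  \<open>\<mu> > 0\<close> and \<open>at_top\<close> for \<open>\<mu> < 0\<close>.
\<close>
lemma saddle_branch:
  assumes \<mu>: "\<mu> \<noteq> 0" "\<mu> * \<mu> = p * \<gamma> * \<mu> + \<gamma> * \<beta>"
  shows "\<exists>R>0. \<exists>u y. log_system p q \<beta> (- 1) {t. exp (\<mu> * t) < R} u y \<and>
    (\<forall>t. exp (\<mu> * t) < R \<longrightarrow> - \<gamma> * u t < inv_flux (y t) \<and> y t < 0) \<and>
    (\<forall>F. ((\<lambda>t. exp (\<mu> * t)) \<longlongrightarrow> 0) F \<longrightarrow> ((\<lambda>t. u t * exp (\<gamma> * t)) \<longlongrightarrow> A) F)"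
proof -
  define b1 where "b1 = - ((p - 1) * (\<gamma> - \<mu>) / \<gamma>)"
  obtain R a b where R: "R > 0" and 0: "a 0 = 0" "b 0 = 0"
    and da: "(a has_real_derivative - 1) (at 0)" and cb: "isCont b 0"
    and curve: "\<And>t. exp (\<mu> * t) < R \<Longrightarrow>
      (let S = \<lambda>t. \<gamma> + a (exp (\<mu> * t)); X = \<lambda>t. (p - 1) * \<gamma> + b (exp (\<mu> * t)) in
        (S has_real_derivative S t * (S t - X t / (p - 1))) (at t) \<and>
        (X has_real_derivative X t * (\<beta> - q * S t + X t)) (at t))"
  proof -
    have lin: "2 * \<gamma> - (p - 1) * \<gamma> / (p - 1) = \<gamma>"
      using p by simp
    have lin': "\<beta> - q * \<gamma> + 2 * ((p - 1) * \<gamma>) = (p - 1) * \<gamma>"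
        "- q * ((p - 1) * \<gamma>) = - (p - 1) * (\<gamma> * q)"
      using \<gamma>_q by (simp_all add: algebra_simps)
    have equil: "\<gamma> * (\<gamma> - (p - 1) * \<gamma> / (p - 1)) = 0"
        "(p - 1) * \<gamma> * (\<beta> - q * \<gamma> + (p - 1) * \<gamma>) = 0"
      using p \<gamma>_q by (auto simp: mult.commute)
    have e': "\<gamma> * b1 = - ((p - 1) * (\<gamma> - \<mu>))"
      using \<gamma> by (simp add: b1_def)
    have "\<gamma> * b1 / (p - 1) = - (\<gamma> - \<mu>)" unfolding e' using p by simp
    then have eig1: "\<gamma> * (- 1) + - \<gamma> / (p - 1) * b1 = \<mu> * (- 1)" by simp
    have "\<gamma> * (\<gamma> * q) + (p - 1) * (\<gamma> * (\<mu> - \<gamma>)) - \<mu> * (\<mu> - \<gamma>) =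
        \<gamma> * (\<gamma> * q - \<gamma> * (p - 1) - \<beta>) - (\<mu> * \<mu> - p * \<gamma> * \<mu> - \<gamma> * \<beta>)"
      by (simp add: algebra_simps)
    also have "\<dots> = 0" unfolding \<mu>(2) \<gamma>_q by simp
    finally have "(p - 1) * (\<gamma> * (\<gamma> * q) + (p - 1) * (\<gamma> * (\<mu> - \<gamma>)) - \<mu> * (\<mu> - \<gamma>)) = 0" by simp
    then have "\<gamma> * (- (p - 1) * (\<gamma> * q) * - 1) + (p - 1) * \<gamma> * (\<gamma> * b1) = \<mu> * (\<gamma> * b1)"
      unfolding e' by (simp add: algebra_simps)
    then have "\<gamma> * (- (p - 1) * (\<gamma> * q) * - 1 + (p - 1) * \<gamma> * b1) = \<gamma> * (\<mu> * b1)"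
      by (simp only: distrib_left mult.left_commute)
    then have eig2: "- (p - 1) * (\<gamma> * q) * - 1 + (p - 1) * \<gamma> * b1 = \<mu> * b1"
      unfolding mult_left_cancel[OF less_imp_neq[OF \<gamma>, symmetric]] .
    have nonres: "\<mu>\<^sup>2 * (real n * (real n - 1)) \<le> (\<mu> * n - \<gamma>) * (\<mu> * n - (p - 1) * \<gamma>) -
        - \<gamma> / (p - 1) * (- (p - 1) * (\<gamma> * q))" if "n \<ge> 2" for n :: nat
    proof -
      have n: "real n \<ge> 2" using that by simp
      have c: "- \<gamma> / (p - 1) * (- (p - 1) * (\<gamma> * q)) = \<gamma> * (\<gamma> * q)" using p by (simp add: field_simps)
      have "(\<mu> * n - \<gamma>) * (\<mu> * n - (p - 1) * \<gamma>) - \<gamma> * (\<gamma> * q)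
          = n * n * (\<mu> * \<mu>) - n * (p * \<gamma> * \<mu>) - \<gamma> * (\<gamma> * q - \<gamma> * (p - 1))"
        by (simp add: algebra_simps)
      also have "\<gamma> * q - \<gamma> * (p - 1) = \<beta>" using \<gamma>_q by simp
      also have "p * \<gamma> * \<mu> = \<mu> * \<mu> - \<gamma> * \<beta>" using \<mu>(2) by simp
      finally have "(\<mu> * n - \<gamma>) * (\<mu> * n - (p - 1) * \<gamma>) - \<gamma> * (\<gamma> * q)
          = \<mu>\<^sup>2 * (real n * (real n - 1)) + \<gamma> * \<beta> * (real n - 1)"
        by (simp add: power2_eq_square algebra_simps)
      moreover have "0 \<le> \<gamma> * \<beta> * (real n - 1)" using n \<gamma> \<beta> by simp
      ultimately show ?thesis
        unfolding c by linarith
    qed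
    have "0 < \<mu>\<^sup>2" using \<mu> by simp
    from equilibrium_curve[OF equil, unfolded lin lin', OF eig1 eig2 this nonres]
    show thesis using that by blast
  qed
  have ca: "(a \<longlongrightarrow> 0) (at 0)" and cb': "(b \<longlongrightarrow> 0) (at 0)"
    using DERIV_isCont[OF da] cb 0 by (auto simp: isCont_def)
  have "((\<lambda>x. a x / x) \<longlongrightarrow> - 1) (at_right 0)"
    by (rule tendsto_quotient_at_right[OF da 0(1)])
  then have "\<forall>\<^sub>F x in at_right 0. a x / x < 0" by (rule order_tendstoD) simp
  moreover have "\<forall>\<^sub>F x in at_right 0. - \<gamma> < a x"
    using order_tendstoD(1)[OF ca, of "- \<gamma>"] \<gamma> by (auto simp: eventually_at_split)
  moreover have "\<forall>\<^sub>F x in at_right 0. - ((p - 1) * \<gamma>) < b x"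
    using order_tendstoD(1)[OF cb', of "- ((p - 1) * \<gamma>)"] \<gamma> p by (auto simp: eventually_at_split)
  ultimately have "\<forall>\<^sub>F x in at_right 0. a x / x < 0 \<and> - \<gamma> < a x \<and> - ((p - 1) * \<gamma>) < b x"
    by (simp add: eventually_conj_iff)
  then obtain R' where R': "R' > 0"
    "\<And>x. 0 < x \<Longrightarrow> x < R' \<Longrightarrow> a x / x < 0 \<and> - \<gamma> < a x \<and> - ((p - 1) * \<gamma>) < b x"
    unfolding eventually_at_right_field by auto
  define R0 where "R0 = min R R'"
  define \<theta> where "\<theta> t = exp (\<mu> * t)" for t
  define S where "S t = \<gamma> + a (\<theta> t)" for t
  define X where "X t = (p - 1) * \<gamma> + b (\<theta> t)" for t
  define J where "J = {t. \<theta> t < R0}"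
  have \<theta>pos: "\<theta> t > 0" for t by (simp add: \<theta>_def)
  have J: "open J" unfolding J_def \<theta>_def by (intro open_Collect_less continuous_intros)
  have SX: "(\<lambda>t. \<gamma> + a (exp (\<mu> * t))) = S" "(\<lambda>t. (p - 1) * \<gamma> + b (exp (\<mu> * t))) = X"
    by (auto simp: S_def X_def \<theta>_def)
  have 1: "(S has_real_derivative S t * (S t - X t / (p - 1))) (at t)"
    and 2: "(X has_real_derivative X t * (\<beta> - q * S t + X t)) (at t)" if "t \<in> J" for t
    using curve[of t] that unfolding SX Let_def by (auto simp: \<theta>_def J_def R0_def)
  have sgn: "S t < \<gamma>" "0 < S t" "0 < X t" if "t \<in> J" for t
    using R'(2)[of "\<theta> t"] \<theta>pos[of t] that by (auto simp: S_def X_def J_def R0_def divide_less_0_iff)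
  define u where "u = (\<lambda>t. exp ((ln (- (- 1 * 1 * X t)) + (p - 1) * ln (1 * S t) - \<beta> * t) / m))"
  define y where "y = (\<lambda>t. - 1 * (1 * S t * u t) powr (p - 1))"
  have 3: "0 < 1 * S t" "0 < - (- 1 * 1 * X t)" if "t \<in> J" for t
    using sgn[OF that] by auto
  have sys: "log_system p q \<beta> (- 1) J u y" and root: "\<And>t. t \<in> J \<Longrightarrow> inv_flux (y t) = - S t * u t"
    unfolding u_def y_def using log_system_of_lotka_volterra[OF J _ _ 1 2 3] by auto
  have upos: "u t > 0" for t by (simp add: u_def)
  have bd: "- \<gamma> * u t < inv_flux (y t) \<and> y t < 0" if "t \<in> J" for t
    using root[OF that] sgn[OF that] upos[of t] by (auto simp: y_def)
  have lim: "((\<lambda>t. u t * exp (\<gamma> * t)) \<longlongrightarrow> A) F" if F: "(\<theta> \<longlongrightarrow> 0) F" for F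
  proof -
    have "((\<lambda>t. a (\<theta> t)) \<longlongrightarrow> a 0) F" "((\<lambda>t. b (\<theta> t)) \<longlongrightarrow> b 0) F"
      using DERIV_isCont[OF da] cb isCont_tendsto_compose[OF _ F] by auto
    then have "((\<lambda>t. exp ((ln (X t) + (p - 1) * ln (S t)) / m)) \<longlongrightarrow>
        exp ((ln ((p - 1) * \<gamma> + b 0) + (p - 1) * ln (\<gamma> + a 0)) / m)) F"
      unfolding X_def S_def by (intro tendsto_intros) (use m p \<gamma> 0 in auto)
    moreover have "exp ((ln ((p - 1) * \<gamma> + b 0) + (p - 1) * ln (\<gamma> + a 0)) / m) = A"
      using power_solution_exp[of 0] by (simp add: 0)
    moreover have "exp ((ln (X t) + (p - 1) * ln (S t)) / m) = u t * exp (\<gamma> * t)" for t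
    proof -
      have "\<beta> * t / m = \<gamma> * t" by (simp add: \<gamma>_def)
      then show ?thesis by (simp add: u_def exp_add[symmetric] diff_divide_distrib)
    qed
    ultimately show ?thesis by simp
  qed
  show ?thesis
    by (intro exI[of _ R0] conjI exI[of _ u] exI[of _ y])
      (use R R'(1) sys bd lim in \<open>auto simp: J_def \<theta>_def[abs_def] R0_def\<close>)
qed

lemma eigenvalues_exist:
  "\<exists>\<mu>>0. \<mu> * \<mu> = p * \<gamma> * \<mu> + \<gamma> * \<beta>" "\<exists>\<mu><0. \<mu> * \<mu> = p * \<gamma> * \<mu> + \<gamma> * \<beta>"
proof -
  define d where "d = sqrt ((p * \<gamma>)\<^sup>2 + 4 * (\<gamma> * \<beta>))"
  have gb: "\<gamma> * \<beta> > 0" and pg: "p * \<gamma> > 0" using \<gamma> \<beta> p by auto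
  have d2: "d * d = (p * \<gamma>)\<^sup>2 + 4 * (\<gamma> * \<beta>)" using gb by (simp add: d_def)
  have "d > p * \<gamma>" unfolding d_def using gb pg by (intro real_less_rsqrt) auto
  then show "\<exists>\<mu>>0. \<mu> * \<mu> = p * \<gamma> * \<mu> + \<gamma> * \<beta>" "\<exists>\<mu><0. \<mu> * \<mu> = p * \<gamma> * \<mu> + \<gamma> * \<beta>"
    using pg d2
    by (intro exI[of _ "(p * \<gamma> + d) / 2"] exI[of _ "(p * \<gamma> - d) / 2"];
        simp add: power2_eq_square algebra_simps add_divide_distrib diff_divide_distrib)+
qed

lemma unstable_branch_exists:
  "\<exists>T u y. log_system p q \<beta> (- 1) {..<T} u y \<and> ((\<lambda>t. u t * exp (\<gamma> * t)) \<longlongrightarrow> A) at_bot \<and>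
     (\<forall>t<T. - \<gamma> * u t < inv_flux (y t))"
proof -
  obtain \<mu> where \<mu>: "\<mu> > 0" "\<mu> * \<mu> = p * \<gamma> * \<mu> + \<gamma> * \<beta>" using eigenvalues_exist(1) by blast
  obtain R u y where R: "R > 0" and *: "log_system p q \<beta> (- 1) {t. exp (\<mu> * t) < R} u y"
    "\<And>t. exp (\<mu> * t) < R \<Longrightarrow> - \<gamma> * u t < inv_flux (y t)"
    "((\<lambda>t. exp (\<mu> * t)) \<longlongrightarrow> 0) at_bot \<longrightarrow> ((\<lambda>t. u t * exp (\<gamma> * t)) \<longlongrightarrow> A) at_bot"
    using saddle_branch[of \<mu>] \<mu> by blast
  have e: "exp (\<mu> * t) < R" if "t < ln R / \<mu>" for t
    using that \<mu>(1) R by (subst ln_less_cancel_iff[symmetric]) (auto simp: field_simps)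
  have "log_system p q \<beta> (- 1) {..<ln R / \<mu>} u y"
    by (rule log_system_subset[OF *(1)]) (use e in auto)
  then show ?thesis using *(2,3) e exp_mult_at_bot[OF \<mu>(1)] by blast
qed

lemma stable_branch_exists:
  "\<exists>T u y. log_system p q \<beta> (- 1) {T<..} u y \<and> ((\<lambda>t. u t * exp (\<gamma> * t)) \<longlongrightarrow> A) at_top \<and>
     (\<forall>t>T. - \<gamma> * u t < inv_flux (y t) \<and> y t < 0)"
proof -
  obtain \<mu> where \<mu>: "\<mu> < 0" "\<mu> * \<mu> = p * \<gamma> * \<mu> + \<gamma> * \<beta>" using eigenvalues_exist(2) by blast
  obtain R u y where R: "R > 0" and *: "log_system p q \<beta> (- 1) {t. exp (\<mu> * t) < R} u y"
    "\<And>t. exp (\<mu> * t) < R \<Longrightarrow> - \<gamma> * u t < inv_flux (y t) \<and> y t < 0"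
    "((\<lambda>t. exp (\<mu> * t)) \<longlongrightarrow> 0) at_top \<longrightarrow> ((\<lambda>t. u t * exp (\<gamma> * t)) \<longlongrightarrow> A) at_top"
    using saddle_branch[of \<mu>] \<mu> by blast
  have e: "exp (\<mu> * t) < R" if "ln R / \<mu> < t" for t
    using that \<mu>(1) R by (subst ln_less_cancel_iff[symmetric]) (auto simp: field_simps)
  have "log_system p q \<beta> (- 1) {ln R / \<mu><..} u y"
    by (rule log_system_subset[OF *(1)]) (use e in auto)
  moreover have "((\<lambda>t. exp (\<mu> * t)) \<longlongrightarrow> 0) at_top"
    using exp_mult_at_bot[of "- \<mu>"] \<mu>(1) by (simp add: at_bot_mirror filterlim_filtermap)
  ultimately show ?thesis using *(2,3) e by blast
qed

end

section \<open>Monotone integral equations\<close>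

lemma integral_lower_limit_has_derivative:
  fixes f :: "real \<Rightarrow> real"
  assumes cont: "continuous_on {..b} f" and t: "t \<le> b"
  shows "((\<lambda>x. integral {x..b} f) has_real_derivative - f t) (at t within {..b})"
proof -
  let ?a = "t - 1"
  have c: "continuous_on {?a..b} f" by (rule continuous_on_subset[OF cont]) auto
  have "((\<lambda>x. integral {?a..b} f - integral {?a..x} f) has_real_derivative 0 - f t)
      (at t within {?a..b})"
    by (intro DERIV_diff DERIV_const integral_has_real_derivative[OF c]) (use t in auto)
  then have d: "((\<lambda>x. integral {x..b} f) has_real_derivative - f t) (at t within {?a..b})"
  proof (rule has_field_derivative_transform_within[OF _ zero_less_one, THEN DERIV_cong])
    fix x assume "x \<in> {?a..b}"
    then show "integral {?a..b} f - integral {?a..x} f = integral {x..b} f"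
      using Henstock_Kurzweil_Integration.integral_combine[where a = ?a and c = x and b = b and f = f] integrable_continuous_interval[OF c] by force
  qed (use t in auto)
  have "at t within {?a..b} = at t within {..b}"
    by (rule at_within_nhd[of _ "{?a<..}"]) (use t in auto)
  with d show ?thesis by simp
qed

text \<open>
  The class on which integral equations are solved. It is closed under pointwise suprema, and its
  members inherit continuity from \<open>g\<close>, so that integrals over compact intervals exist.
\<close>
definition osc_le :: "(real \<Rightarrow> real) \<Rightarrow> real \<Rightarrow> (real \<Rightarrow> real) \<Rightarrow> bool" where
  "osc_le g b f \<longleftrightarrow>
     f b = g b \<and> (\<forall>s t. s \<le> t \<longrightarrow> t \<le> b \<longrightarrow> 0 \<le> f s - f t \<and> f s - f t \<le> g s - g t)"

lemma osc_le_bounds: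
  assumes "osc_le g b f" "t \<le> b"
  shows "g b \<le> f t" "f t \<le> g t"
  using assms unfolding osc_le_def by fastforce+

lemma osc_le_continuous:
  fixes g :: "real \<Rightarrow> real"
  assumes f: "osc_le g b f" and g: "continuous_on {..b} g"
  shows "continuous_on {..b} f"
  unfolding continuous_on_iff
proof (intro ballI allI impI)
  fix x e :: real assume x: "x \<in> {..b}" and e: "e > 0"
  then obtain d where d: "d > 0" "\<And>x'. x' \<in> {..b} \<Longrightarrow> dist x' x < d \<Longrightarrow> dist (g x') (g x) < e"
    using g unfolding continuous_on_iff by blast
  have "dist (f x') (f x) \<le> dist (g x') (g x)" if "x' \<in> {..b}" for x'
  proof -
    have "0 \<le> f s - f t \<and> f s - f t \<le> g s - g t" if "s \<le> t" "t \<le> b" for s t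
      using f that unfolding osc_le_def by blast
    from this[of x x'] this[of x' x] show ?thesis
      using that x by (cases "x \<le> x'") (auto simp: dist_real_def)
  qed
  then show "\<exists>d>0. \<forall>x'\<in>{..b}. dist x' x < d \<longrightarrow> dist (f x') (f x) < e"
    using d by (meson le_less_trans)
qed

text \<open>
  The Knaster-Tarski argument: the operator \<open>f \<mapsto> g b + integral {t..b} (N f)\<close> is increasing and maps the class
  of functions with oscillation dominated by \<open>g\<close> into itself, because \<open>N f\<close> is at most the slope \<open>k\<close>
  of \<open>g\<close>. The supremum of all \<open>f\<close> in the class that lie below their image is a fixed point.
\<close>
lemma monotone_integral_equation:
  fixes g k :: "real \<Rightarrow> real" and N :: "(real \<Rightarrow> real) \<Rightarrow> real \<Rightarrow> real"
  assumes dg: "\<And>t. t \<le> b \<Longrightarrow> (g has_real_derivative - k t) (at t)"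
    and k: "\<And>t. t \<le> b \<Longrightarrow> 0 \<le> k t"
    and N_cont: "\<And>f. osc_le g b f \<Longrightarrow> continuous_on {..b} (N f)"
    and N_bd: "\<And>f t. osc_le g b f \<Longrightarrow> t \<le> b \<Longrightarrow> 0 \<le> N f t \<and> N f t \<le> k t"
    and N_mono: "\<And>f1 f2 t. osc_le g b f1 \<Longrightarrow> osc_le g b f2 \<Longrightarrow>
        (\<And>s. s \<le> b \<Longrightarrow> f1 s \<le> f2 s) \<Longrightarrow> t \<le> b \<Longrightarrow> N f1 t \<le> N f2 t"
  shows "\<exists>u. osc_le g b u \<and>
    (\<forall>t\<le>b. (u has_real_derivative - N u t) (at t within {..b}))"
proof -
  let ?C = "osc_le g b"
  have g_anti: "g t \<le> g s" if "s \<le> t" "t \<le> b" for s t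
  proof (rule DERIV_nonpos_imp_nonincreasing[OF that(1)])
    fix x assume "s \<le> x" "x \<le> t"
    then show "\<exists>y. (g has_real_derivative y) (at x) \<and> y \<le> 0"
      using dg[of x] k[of x] that by (intro exI[of _ "- k x"]) auto
  qed
  define \<Phi> where "\<Phi> f t = g b + integral {t..b} (N f)" for f t
  have int: "N f integrable_on {s..t}" if "?C f" "t \<le> b" for f s t
    by (rule integrable_continuous_interval, rule continuous_on_subset[OF N_cont[OF that(1)]])
      (use that in auto)
  have \<Phi>C: "?C (\<Phi> f)" if f: "?C f" for f
  proof -
    have "0 \<le> \<Phi> f s - \<Phi> f t \<and> \<Phi> f s - \<Phi> f t \<le> g s - g t" if st: "s \<le> t" "t \<le> b" for s t
    proof -
      have e: "\<Phi> f s - \<Phi> f t = integral {s..t} (N f)"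
        unfolding \<Phi>_def using st int[OF f order_refl, of s]
          Henstock_Kurzweil_Integration.integral_combine[where a = s and c = t and b = b and f = "N f"]
        by simp
      have bd: "0 \<le> N f x \<and> N f x \<le> k x" if "x \<in> {s..t}" for x
        using that st by (intro N_bd[OF f]) auto
      have i: "N f integrable_on {s..t}"
        by (rule int[OF f st(2)])
      have k_int: "(k has_integral - g t - - g s) {s..t}"
      proof (rule fundamental_theorem_of_calculus[where f = "\<lambda>x. - g x", OF st(1)])
        fix x assume "x \<in> {s..t}"
        then have "(g has_real_derivative - k x) (at x within {s..t})"
          using st by (intro has_field_derivative_at_within[OF dg]) auto
        from DERIV_minus[OF this]
        show "((\<lambda>x. - g x) has_vector_derivative k x) (at x within {s..t})"
          by (simp add: has_real_derivative_iff_has_vector_derivative)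
      qed
      have "0 \<le> integral {s..t} (N f)"
      proof (rule integral_nonneg)
        show "N f integrable_on {s..t}" by (rule i)
        fix x assume x: "x \<in> {s..t}"
        from bd[OF x] show "0 \<le> N f x" by (rule conjunct1)
      qed
      moreover have "integral {s..t} (N f) \<le> - g t - - g s"
        by (rule has_integral_le[OF integrable_integral[OF i] k_int]) (rule bd[THEN conjunct2])
      ultimately show ?thesis using e by linarith
    qed
    moreover have "\<Phi> f b = g b" by (simp add: \<Phi>_def)
    ultimately show ?thesis by (simp add: osc_le_def)
  qed
  have \<Phi>mono: "\<Phi> f1 t \<le> \<Phi> f2 t"
    if "?C f1" "?C f2" "\<And>s. s \<le> b \<Longrightarrow> f1 s \<le> f2 s" for f1 f2 t
  proof (cases "t \<le> b")
    case True
    show ?thesis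
      unfolding \<Phi>_def
    proof (intro add_left_mono integral_le int[OF that(1) order_refl] int[OF that(2) order_refl])
      fix x assume "x \<in> {t..b}"
      then show "N f1 x \<le> N f2 x" by (intro N_mono[OF that]) auto
    qed
  qed (simp add: \<Phi>_def)
  define P where "P = {f. ?C f \<and> (\<forall>t\<le>b. f t \<le> \<Phi> f t)}"
  have const: "?C (\<lambda>_. g b)"
    unfolding osc_le_def using g_anti by auto
  have "(\<lambda>_. g b) \<in> P"
    unfolding P_def using const osc_le_bounds(1)[OF \<Phi>C[OF const]] by auto
  then have ne: "P \<noteq> {}" by blast
  define u where "u t = (SUP f\<in>P. f t)" for t
  have bdd: "bdd_above ((\<lambda>f. f t) ` P)" if "t \<le> b" for t
    using osc_le_bounds(2)[OF _ that] by (auto simp: P_def bdd_above_def)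
  have le_u: "f t \<le> u t" if "f \<in> P" "t \<le> b" for f t
    unfolding u_def by (rule cSUP_upper[OF that(1) bdd[OF that(2)]])
  have u_le: "u t \<le> c" if "\<And>f. f \<in> P \<Longrightarrow> f t \<le> c" for t c
    unfolding u_def using ne that by (intro cSUP_least)
  have uC: "?C u"
    unfolding osc_le_def
  proof (intro conjI allI impI)
    have "f b = g b" if "f \<in> P" for f using that by (auto simp: P_def osc_le_def)
    then have "(\<lambda>f. f b) ` P = {g b}" using ne by auto
    then show "u b = g b" by (simp add: u_def)
    fix s t assume st: "s \<le> t" "t \<le> b"
    have f: "0 \<le> f s - f t \<and> f s - f t \<le> g s - g t" if "f \<in> P" for f
      using that st by (auto simp: P_def osc_le_def)
    have "u t \<le> u s"
    proof (rule u_le)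
      fix f' assume "f' \<in> P"
      with f[of f'] le_u[of f' s] st show "f' t \<le> u s" by simp
    qed
    then show "0 \<le> u s - u t" by simp
    have "u s \<le> u t + (g s - g t)"
    proof (rule u_le)
      fix f' assume "f' \<in> P"
      with f[of f'] le_u[of f' t] st show "f' s \<le> u t + (g s - g t)" by simp
    qed
    then show "u s - u t \<le> g s - g t" by simp
  qed
  have sub: "u t \<le> \<Phi> u t" if "t \<le> b" for t
  proof (rule u_le)
    fix f assume f: "f \<in> P"
    then have "f t \<le> \<Phi> f t" using that by (auto simp: P_def)
    also have "\<dots> \<le> \<Phi> u t" using f by (intro \<Phi>mono[OF _ uC] le_u) (auto simp: P_def)
    finally show "f t \<le> \<Phi> u t" .
  qed
  have "\<Phi> u \<in> P"
    unfolding P_def using \<Phi>C[OF uC] \<Phi>mono[OF uC \<Phi>C[OF uC]] sub by auto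
  then have fixpt: "u t = \<Phi> u t" if "t \<le> b" for t
    using le_u[of "\<Phi> u" t] sub[of t] that by auto
  have "(u has_real_derivative - N u t) (at t within {..b})" if t: "t \<le> b" for t
  proof (rule has_field_derivative_transform_within[OF _ zero_less_one])
    show "((\<lambda>x. g b + integral {x..b} (N u)) has_real_derivative - N u t) (at t within {..b})"
      using DERIV_add[OF DERIV_const integral_lower_limit_has_derivative[OF N_cont[OF uC] t]] by simp
  qed (use fixpt t in \<open>auto simp: \<Phi>_def\<close>)
  then show ?thesis using uC by blast
qed

text \<open>
  The integral of \<open>h\<close> over the half-line up to \<open>t\<close>, written in the reflected variable, where the
  dominating function is a decaying exponential.
\<close>
lemma tail_integral:
  fixes h :: "real \<Rightarrow> real"
  assumes cont: "continuous_on {..b} h" and bd: "\<And>s. s \<le> b \<Longrightarrow> 0 \<le> h s \<and> h s \<le> M * exp (\<eta> * s)"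
    and \<eta>: "\<eta> > 0" and t: "t \<le> b"
  shows "(\<lambda>x. h (- x)) integrable_on {- t..}"
    and "0 \<le> integral {- t..} (\<lambda>x. h (- x))"
    and "integral {- t..} (\<lambda>x. h (- x)) \<le> M / \<eta> * exp (\<eta> * t)"
    and "((\<lambda>t. integral {- t..} (\<lambda>x. h (- x))) has_real_derivative h t) (at t within {..b})"
proof -
  have c: "continuous_on {- b..} (\<lambda>x. h (- x))"
    by (rule continuous_on_compose2[OF cont]) (auto intro!: continuous_intros)
  have E: "((\<lambda>x. M * exp (- \<eta> * x)) has_integral M * (exp (- \<eta> * - t) / \<eta>)) {- t..}" for t
    by (intro has_integral_mult_right has_integral_exp_minus_to_infinity \<eta>)
  have leb: "{c..} \<in> sets lebesgue" for c :: real
    by (simp add: sets_completionI_sets)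
  have I: "(\<lambda>x. h (- x)) integrable_on {- t..}" if "t \<le> b" for t
  proof (rule measurable_bounded_by_integrable_imp_integrable_real[OF _ has_integral_integrable[OF E[of t]]])
    show "(\<lambda>x. h (- x)) \<in> borel_measurable (lebesgue_on {- t..})"
      by (rule continuous_imp_measurable_on_sets_lebesgue[OF continuous_on_subset[OF c]])
        (use that leb in auto)
    show "\<bar>h (- x)\<bar> \<le> M * exp (- \<eta> * x)" if x: "x \<in> {- t..}" for x
      using bd[of "- x"] x \<open>t \<le> b\<close> by auto
  qed (rule leb)
  show "(\<lambda>x. h (- x)) integrable_on {- t..}" using I t .
  show "0 \<le> integral {- t..} (\<lambda>x. h (- x))"
    using bd t by (intro integral_nonneg I) auto
  have "integral {- t..} (\<lambda>x. h (- x)) \<le> M * (exp (- \<eta> * - t) / \<eta>)"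
  proof (rule has_integral_le[OF integrable_integral[OF I[OF t]] E])
    fix x assume "x \<in> {- t..}"
    then show "h (- x) \<le> M * exp (- \<eta> * x)" using bd[of "- x"] t by auto
  qed
  then show "integral {- t..} (\<lambda>x. h (- x)) \<le> M / \<eta> * exp (\<eta> * t)" by simp
  let ?a = "t - 1"
  have ca: "continuous_on {?a..b} h" by (rule continuous_on_subset[OF cont]) auto
  have "((\<lambda>x. integral {- ?a..} (\<lambda>x. h (- x)) + integral {?a..x} h) has_real_derivative 0 + h t)
      (at t within {?a..b})"
    by (intro DERIV_add DERIV_const integral_has_real_derivative[OF ca]) (use t in auto)
  then have d: "((\<lambda>t. integral {- t..} (\<lambda>x. h (- x))) has_real_derivative h t) (at t within {?a..b})"
  proof (rule has_field_derivative_transform_within[OF _ zero_less_one, THEN DERIV_cong])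
    fix x assume x: "x \<in> {?a..b}"
    have "((\<lambda>x. h (- x)) has_integral integral {?a..x} h) {- x..- ?a}"
      using x by (subst has_integral_reflect_real)
        (auto intro!: integrable_integral integrable_continuous_interval continuous_on_subset[OF cont])
    moreover have "((\<lambda>x. h (- x)) has_integral integral {- ?a..} (\<lambda>x. h (- x))) {- ?a..}"
      using t by (intro integrable_integral I) auto
    moreover have "negligible ({- x..- ?a} \<inter> {- ?a..})"
      by (rule negligible_subset[of "{- ?a}"]) auto
    ultimately have "((\<lambda>x. h (- x)) has_integral integral {?a..x} h + integral {- ?a..} (\<lambda>x. h (- x)))
        ({- x..- ?a} \<union> {- ?a..})"
      by (rule has_integral_Un)
    moreover have "{- x..- ?a} \<union> {- ?a..} = {- x..}" using x by auto
    ultimately show "integral {- ?a..} (\<lambda>x. h (- x)) + integral {?a..x} h = integral {- x..} (\<lambda>x. h (- x))"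
      by (simp add: integral_unique)
  qed (use t in auto)
  have "at t within {?a..b} = at t within {..b}"
    by (rule at_within_nhd[of _ "{?a<..}"]) (use t in auto)
  with d show "((\<lambda>t. integral {- t..} (\<lambda>x. h (- x))) has_real_derivative h t) (at t within {..b})"
    by simp
qed

section \<open>Solutions of logarithmic growth\<close>

text \<open>
  L'Hospital's rule, after the reflection \<open>t \<mapsto> - t\<close>.
\<close>
lemma linear_growth_of_deriv_tendsto_at_bot:
  fixes u D :: "real \<Rightarrow> real"
  assumes du: "\<And>t. t < T \<Longrightarrow> (u has_real_derivative D t) (at t)"
    and D: "(D \<longlongrightarrow> - C) at_bot"
  shows "((\<lambda>t. u t / \<bar>t\<bar>) \<longlongrightarrow> C) at_bot"
proof -
  have "((\<lambda>t. u (- t) / t) \<longlongrightarrow> C) at_top"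
  proof (rule lhospital_at_top_at_top[where f' = "\<lambda>t. - D (- t)" and g' = "\<lambda>_. 1"])
    show "\<forall>\<^sub>F t in at_top. ((\<lambda>t. u (- t)) has_real_derivative - D (- t)) (at t)"
      using eventually_gt_at_top[of "- T"]
    proof eventually_elim
      case (elim t)
      then have "(u has_real_derivative D (- t)) (at (- t))" by (intro du) simp
      from DERIV_chain2[OF this DERIV_minus[OF DERIV_ident]]
      show ?case by simp
    qed
    have "((\<lambda>t. - D (- t)) \<longlongrightarrow> - (- C)) at_top"
      by (intro tendsto_minus filterlim_compose[OF D] filterlim_uminus_at_bot_at_top)
    then show "((\<lambda>t. - D (- t) / 1) \<longlongrightarrow> C) at_top" by simp
  qed (auto intro: filterlim_ident)
  from filterlim_compose[OF this filterlim_uminus_at_top_at_bot]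
  have "((\<lambda>t. u t / - t) \<longlongrightarrow> C) at_bot" by simp
  moreover have "\<forall>\<^sub>F t in at_bot. u t / - t = u t / \<bar>t\<bar>"
    using eventually_gt_at_bot[of 0] by eventually_elim simp
  ultimately show ?thesis by (rule Lim_transform_eventually)
qed

lemma has_real_derivative_glue:
  fixes f g D :: "real \<Rightarrow> real"
  assumes f: "\<And>t. t \<le> b \<Longrightarrow> (f has_real_derivative D t) (at t within {..b})"
    and g: "\<And>t. b \<le> t \<Longrightarrow> (g has_real_derivative D t) (at t)" and eq: "f b = g b"
  shows "((\<lambda>t. if t \<le> b then f t else g t) has_real_derivative D t) (at t)"
proof -
  have cl: "{..b} \<union> (closure {..b} \<inter> closure {b<..}) = {..b}" "{b<..} \<union> (closure {..b} \<inter> closure {b<..}) = {b..}"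
    by auto
  have "((\<lambda>t. if t \<in> {..b} then f t else g t) has_vector_derivative
      (if t \<in> {..b} then D t else D t)) (at t within UNIV)"
  proof (rule has_vector_derivative_If_within_closures[of t "{..b}" "{b<..}"], unfold cl)
    show "(f has_vector_derivative D t) (at t within {..b})" if "t \<in> {..b}"
      using f that by (simp add: has_real_derivative_iff_has_vector_derivative[symmetric])
    show "(g has_vector_derivative D t) (at t within {b..})" if "t \<in> {b..}"
      using g that by (auto simp: has_real_derivative_iff_has_vector_derivative[symmetric]
          intro: has_field_derivative_at_within[of g _ t])
  qed (use eq in auto)
  then show ?thesis by (simp add: has_real_derivative_iff_has_vector_derivative)
qed

lemma monotone_bounded_tendsto_at_bot:
  fixes z :: "real \<Rightarrow> real"
  assumes anti: "\<And>s t. s \<le> t \<Longrightarrow> t \<le> b \<Longrightarrow> z t \<le> z s" and bd: "\<And>t. t \<le> b \<Longrightarrow> z t \<le> B"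
  shows "\<exists>L\<ge>z b. (z \<longlongrightarrow> L) at_bot"
proof -
  define L where "L = (SUP t\<in>{..b}. z t)"
  have bdd: "bdd_above (z ` {..b})" using bd by (auto simp: bdd_above_def)
  have up: "z t \<le> L" if "t \<le> b" for t
    unfolding L_def by (rule cSUP_upper[OF _ bdd]) (use that in auto)
  have "(z \<longlongrightarrow> L) at_bot"
  proof (rule order_tendstoI)
    fix a assume "a < L"
    then obtain t0 where t0: "t0 \<le> b" "a < z t0"
      unfolding L_def using less_cSUP_iff[OF _ bdd] by auto
    show "\<forall>\<^sub>F t in at_bot. a < z t"
      using eventually_le_at_bot[of t0]
      by eventually_elim (use t0 anti in \<open>force intro: less_le_trans\<close>)
  next
    fix a assume "L < a"
    show "\<forall>\<^sub>F t in at_bot. z t < a"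
      using eventually_le_at_bot[of b]
      by eventually_elim (use up \<open>L < a\<close> in \<open>force intro: le_less_trans\<close>)
  qed
  then show ?thesis using up[of b] by auto
qed

context log_emden_fowler begin

lemma q_pos: "q > 0" using p q by simp

lemma inv_flux_minus_pos: "z > 0 \<Longrightarrow> inv_flux (- z) = - (z powr (1 / (p - 1)))"
  using p_flux_conjugate_pos[OF p] by (simp add: p_flux_minus)

lemma continuous_nonlinearity:
  assumes "continuous_on S u" "\<And>t. t \<in> S \<Longrightarrow> 0 < u t"
  shows "continuous_on S (\<lambda>t. exp (\<beta> * t) * u t powr q)"
  using assms by (intro continuous_intros) force+

text \<open>
  The flux is prescribed to be \<open>- 1\<close> at minus infinity and \<open>u\<close> to be \<open>1\<close> at \<open>b\<close>. A function of at most linear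
  growth is bounded by \<open>K * exp (\<delta> * (b - t))\<close> with \<open>\<delta> * q = \<beta> / 2\<close>, so that the
  nonlinearity is integrable at minus infinity. The number \<open>b\<close> is so negative that its integral up to
  \<open>b\<close> is at most \<open>1\<close>; the flux then stays in \<open>[- 2, - 1]\<close>, and the slope \<open>G\<close> of the barrier is
  the inverse flux of \<open>2\<close>.
\<close>
lemma log_growth_solution_exists:
  "\<exists>T u y C. log_system p q \<beta> 1 {..<T} u y \<and> 0 < C \<and> ((\<lambda>t. inv_flux (y t)) \<longlongrightarrow> - C) at_bot"
proof -
  define \<kappa> where "\<kappa> = 1 / (p - 1)"
  define G where "G = 2 powr \<kappa>"
  define \<eta> where "\<eta> = \<beta> / 2"
  define \<delta> where "\<delta> = \<eta> / q"
  define K where "K = 1 + G / \<delta>"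
  define b where "b = - ln (K powr q / \<eta>) / \<beta>"
  define M where "M = K powr q * exp (\<eta> * b)"
  define g where "g t = 1 + G * (b - t)" for t
  define h where "h f s = exp (\<beta> * s) * f s powr q" for f :: "real \<Rightarrow> real" and s
  define N where "N f t = (1 + integral {- t..} (\<lambda>x. h f (- x))) powr \<kappa>" for f t
  have pos: "\<kappa> > 0" "G > 0" "\<eta> > 0" "\<delta> > 0" "K > 0" "\<delta> * q = \<eta>" "\<eta> + \<eta> = \<beta>"
    using p \<beta> q_pos by (auto simp: \<kappa>_def G_def \<eta>_def \<delta>_def K_def intro!: add_pos_pos)
  have M1: "M / \<eta> * exp (\<eta> * b) = 1"
  proof -
    have "exp (\<eta> * b) * exp (\<eta> * b) = exp (\<beta> * b)"
      by (simp add: exp_add[symmetric] distrib_right[symmetric] pos(7))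
    also have "\<beta> * b = - ln (K powr q / \<eta>)" using \<beta> by (simp add: b_def)
    also have "exp \<dots> = \<eta> / K powr q" using pos by (simp add: exp_minus field_simps)
    finally have "K powr q / \<eta> * (exp (\<eta> * b) * exp (\<eta> * b)) = 1" using pos by simp
    then show ?thesis by (simp add: M_def)
  qed
  have g_b: "g b = 1" by (simp add: g_def)
  have g_cont: "continuous_on {..b} g" unfolding g_def by (intro continuous_intros)
  have h_bd: "0 \<le> h f s \<and> h f s \<le> M * exp (\<eta> * s)"
    if f: "osc_le g b f" and s: "s \<le> b" for f s
  proof -
    have f1: "1 \<le> f s" "f s \<le> 1 + G * (b - s)"
      using osc_le_bounds[OF f s] by (auto simp: g_def)
    have "1 + G * (b - s) \<le> K * exp (\<delta> * (b - s))"
    proof -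
      have "1 + \<delta> * (b - s) \<le> exp (\<delta> * (b - s))" by (rule exp_ge_add_one_self)
      moreover have "0 \<le> \<delta> * (b - s)" using pos s by simp
      ultimately have "1 \<le> exp (\<delta> * (b - s))" "\<delta> * (b - s) \<le> exp (\<delta> * (b - s))" by linarith+
      then have "1 + G / \<delta> * (\<delta> * (b - s)) \<le> exp (\<delta> * (b - s)) + G / \<delta> * exp (\<delta> * (b - s))"
        using pos by (intro add_mono mult_left_mono) auto
      then show ?thesis using pos by (simp add: K_def distrib_right)
    qed
    with f1 have "f s powr q \<le> (K * exp (\<delta> * (b - s))) powr q"
      using q_pos by (intro powr_mono2) auto
    also have "\<dots> = K powr q * exp (\<eta> * (b - s))"
      using pos(5) by (simp add: powr_mult powr_def[of "exp _"] pos(6)[symmetric] mult_ac)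
    finally have "h f s \<le> exp (\<beta> * s) * (K powr q * exp (\<eta> * (b - s)))"
      unfolding h_def by (intro mult_left_mono) auto
    also have "\<dots> = K powr q * exp (\<beta> * s + \<eta> * (b - s))"
      by (simp add: exp_add)
    also have "\<beta> * s + \<eta> * (b - s) = \<eta> * b + \<eta> * s"
      unfolding pos(7)[symmetric] by (simp add: algebra_simps)
    finally show ?thesis using f1 by (simp add: h_def M_def exp_add)
  qed
  have h_cont: "continuous_on {..b} (h f)" if f: "osc_le g b f" for f
    unfolding h_def
    by (rule continuous_nonlinearity[OF osc_le_continuous[OF f g_cont]])
      (use osc_le_bounds(1)[OF f] g_b in force)
  note tail = tail_integral[OF h_cont h_bd pos(3)]
  have tail1: "0 \<le> integral {- t..} (\<lambda>x. h f (- x)) \<and> integral {- t..} (\<lambda>x. h f (- x)) \<le> 1"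
    if f: "osc_le g b f" and t: "t \<le> b" for f t
  proof -
    have M0: "M / \<eta> \<ge> 0" using pos by (simp add: M_def)
    have "integral {- t..} (\<lambda>x. h f (- x)) \<le> M / \<eta> * exp (\<eta> * t)"
      using tail(3)[OF f f _ t] by blast
    also have "\<dots> \<le> M / \<eta> * exp (\<eta> * b)" using t pos M0 by (intro mult_left_mono) auto
    finally show ?thesis using tail(2)[OF f f _ t] M1 by simp
  qed
  have "\<exists>u. osc_le g b u \<and>
    (\<forall>t\<le>b. (u has_real_derivative - N u t) (at t within {..b}))"
  proof (rule monotone_integral_equation[where k = "\<lambda>_. G"])
    show "(g has_real_derivative - G) (at t)" for t
      unfolding g_def by (auto intro!: derivative_eq_intros)
    show "0 \<le> G" using pos by simp
  next
    fix f assume f: "osc_le g b f"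
    have "continuous_on {..b} (\<lambda>t. integral {- t..} (\<lambda>x. h f (- x)))"
      by (rule DERIV_continuous_on) (use tail(4)[OF f f] in auto)
    then show "continuous_on {..b} (N f)"
      unfolding N_def using tail1[OF f] by (intro continuous_intros) force+
  next
    fix f t assume "osc_le g b f" "t \<le> b"
    then show "0 \<le> N f t \<and> N f t \<le> G"
      unfolding N_def G_def using tail1[of f t] pos by (auto intro!: powr_mono2)
  next
    fix f1 f2 t assume f: "osc_le g b f1" "osc_le g b f2"
      and le: "\<And>s. s \<le> b \<Longrightarrow> f1 s \<le> f2 s" and t: "t \<le> b"
    have "integral {- t..} (\<lambda>x. h f1 (- x)) \<le> integral {- t..} (\<lambda>x. h f2 (- x))"
    proof (rule integral_le)
      show "(\<lambda>x. h f1 (- x)) integrable_on {- t..}" "(\<lambda>x. h f2 (- x)) integrable_on {- t..}"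
        using tail(1)[OF f(1) f(1) _ t] tail(1)[OF f(2) f(2) _ t] by auto
      fix x assume "x \<in> {- t..}"
      then have "- x \<le> b" using t by auto
      then show "h f1 (- x) \<le> h f2 (- x)"
        unfolding h_def using le osc_le_bounds(1)[OF f(1)] g_b q_pos
        by (intro mult_left_mono powr_mono2) (auto intro: order_trans[of 0 1])
    qed
    then show "N f1 t \<le> N f2 t"
      unfolding N_def using tail1[OF f(1) t] pos by (intro powr_mono2) auto
  qed
  then obtain u where u: "osc_le g b u"
    "\<And>t. t \<le> b \<Longrightarrow> (u has_real_derivative - N u t) (at t within {..b})" by blast
  define z where "z t = 1 + integral {- t..} (\<lambda>x. h u (- x))" for t
  have zpos: "z t > 0" if "t \<le> b" for t using tail1[OF u(1) that] by (simp add: z_def)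
  have flux: "inv_flux (- z t) = - N u t" if "t \<le> b" for t
    using inv_flux_minus_pos[OF zpos[OF that]] by (simp add: N_def z_def \<kappa>_def)
  have "log_system p q \<beta> 1 {..<b} u (\<lambda>t. - z t)"
    unfolding log_system_def
  proof (intro ballI conjI)
    fix t assume t: "t \<in> {..<b}"
    then have at: "at t within {..b} = at t" by (intro at_within_interior) simp
    show "0 < u t" using osc_le_bounds(1)[OF u(1), of t] t g_b by simp
    show "(u has_real_derivative inv_flux (- z t)) (at t)"
      using u(2)[of t] flux[of t] t at by simp
    have "((\<lambda>t. 1 + integral {- t..} (\<lambda>x. h u (- x))) has_real_derivative 0 + h u t) (at t within {..b})"
      by (intro DERIV_add DERIV_const) (use tail(4)[OF u(1) u(1)] t in auto)
    from DERIV_minus[OF this]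
    show "((\<lambda>t. - z t) has_real_derivative - 1 * exp (\<beta> * t) * u t powr q) (at t)"
      unfolding at z_def by (simp add: h_def)
  qed
  moreover have "((\<lambda>t. inv_flux (- z t)) \<longlongrightarrow> - 1) at_bot"
  proof -
    have "((\<lambda>t. integral {- t..} (\<lambda>x. h u (- x))) \<longlongrightarrow> 0) at_bot"
    proof (rule tendsto_sandwich[OF _ _ tendsto_const])
      show "\<forall>\<^sub>F t in at_bot. 0 \<le> integral {- t..} (\<lambda>x. h u (- x))"
        using eventually_le_at_bot[of b] by eventually_elim (use tail1[OF u(1)] in auto)
      show "\<forall>\<^sub>F t in at_bot. integral {- t..} (\<lambda>x. h u (- x)) \<le> M / \<eta> * exp (\<eta> * t)"
        using eventually_le_at_bot[of b] by eventually_elim (use tail(3)[OF u(1) u(1)] in auto)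
      show "((\<lambda>t. M / \<eta> * exp (\<eta> * t)) \<longlongrightarrow> 0) at_bot"
        by (rule tendsto_mult_right_zero[OF exp_mult_at_bot[OF pos(3)]])
    qed
    then have "((\<lambda>t. - ((1 + integral {- t..} (\<lambda>x. h u (- x))) powr \<kappa>)) \<longlongrightarrow> - ((1 + 0) powr \<kappa>)) at_bot"
      by (intro tendsto_intros) auto
    then have l: "((\<lambda>t. - N u t) \<longlongrightarrow> - 1) at_bot" by (simp add: N_def)
    have "\<forall>\<^sub>F t in at_bot. - N u t = inv_flux (- z t)"
      using eventually_le_at_bot[of b] by eventually_elim (simp add: flux)
    from Lim_transform_eventually[OF l this] show ?thesis .
  qed
  ultimately show ?thesis by (intro exI[of _ b] exI[of _ u] exI[of _ "\<lambda>t. - z t"] exI[of _ 1]) auto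
qed

end

section \<open>The global solutions\<close>

context log_emden_fowler begin

text \<open>
  For the power solution the last inequality is an equality with \<open>c = \<gamma>\<close>; below the power solution it is
  strict for \<open>c = \<gamma>\<close> and therefore persists for slightly smaller \<open>c\<close>.
\<close>
lemma rate_below_critical_exists:
  assumes u0: "u0 > 0" "u0 * exp (\<gamma> * b) < A" and s: "0 \<le> s" "s < \<gamma>"
  shows "\<exists>c. s < c \<and> c < \<gamma> \<and> exp (\<beta> * b) * u0 powr m < (p - 1) * c powr p"
proof -
  have "exp (\<beta> * b) * u0 powr m = (u0 * exp (\<gamma> * b)) powr m"
    using u0(1) arg_cong[OF \<gamma>_m, of "\<lambda>x. x * b"]
    by (auto simp: powr_mult powr_def[of "exp _"] mult_ac)
  also have "\<dots> < A powr m" using u0 m by (intro powr_less_mono2) auto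
  finally have "exp (\<beta> * b) * u0 powr m < (p - 1) * \<gamma> powr p" by (simp add: A_powr)
  moreover have "((\<lambda>c. (p - 1) * c powr p) \<longlongrightarrow> (p - 1) * \<gamma> powr p) (at_left \<gamma>)"
    using \<gamma> by (intro tendsto_intros) auto
  ultimately have "\<forall>\<^sub>F c in at_left \<gamma>. exp (\<beta> * b) * u0 powr m < (p - 1) * c powr p"
    by (rule order_tendstoD(1)[rotated])
  moreover have "\<forall>\<^sub>F c in at_left \<gamma>. c \<in> {s<..<\<gamma>}"
    by (rule eventually_at_left_real[OF s(2)])
  ultimately have "\<forall>\<^sub>F c in at_left \<gamma>. s < c \<and> c < \<gamma> \<and> exp (\<beta> * b) * u0 powr m < (p - 1) * c powr p"
    by eventually_elim auto
  then show ?thesis using eventually_happens trivial_limit_at_left_real by blast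
qed

text \<open>
  Initial data below the power solution and with a logarithmic slope less than \<open>\<gamma>\<close> are dominated
  by an exponential with a rate \<open>c < \<gamma>\<close>, and this exponential is a supersolution of the integral equation on
  all of \<open>(- \<infinity>, b]\<close>. So the solution cannot blow up backward in time, although the nonlinearity is
  superlinear.
\<close>
lemma backward_continuation:
  assumes u0: "u0 > 0" "u0 * exp (\<gamma> * b) < A" and z0: "z0 > 0"
    and slope: "z0 powr (1 / (p - 1)) < \<gamma> * u0"
  shows "\<exists>u z c. u b = u0 \<and> z b = z0 \<and> 0 < c \<and> c < \<gamma> \<and>
    (\<forall>t\<le>b. u0 \<le> u t \<and> u t \<le> u0 * exp (c * (b - t)) \<and> z0 \<le> z t \<and>
       (u has_real_derivative - (z t powr (1 / (p - 1)))) (at t within {..b}) \<and>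
       (z has_real_derivative - (exp (\<beta> * t) * u t powr q)) (at t within {..b}))"
proof -
  define \<kappa> where "\<kappa> = 1 / (p - 1)"
  have \<kappa>: "\<kappa> > 0" "\<kappa> * (p - 1) = 1" using p by (auto simp: \<kappa>_def)
  obtain c where c: "z0 powr \<kappa> / u0 < c" "c < \<gamma>" "exp (\<beta> * b) * u0 powr m < (p - 1) * c powr p"
    using rate_below_critical_exists[OF u0, of "z0 powr \<kappa> / u0"] u0(1) slope
    by (auto simp: \<kappa>_def field_simps)
  have c0: "c > 0" using c(1) u0(1) by (smt (verit) divide_nonneg_nonneg powr_ge_zero)
  define g where "g t = u0 * exp (c * (b - t))" for t
  define B where "B t = (c * u0) powr (p - 1) * exp (c * (p - 1) * (b - t))" for t
  define h where "h f s = exp (\<beta> * s) * f s powr q" for f :: "real \<Rightarrow> real" and s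
  define Z where "Z f t = z0 + integral {t..b} (h f)" for f t
  define N where "N f t = Z f t powr \<kappa>" for f t
  have g_b: "g b = u0" by (simp add: g_def)
  have g_cont: "continuous_on {..b} g" unfolding g_def by (intro continuous_intros)
  have B_root: "B t powr \<kappa> = c * g t" for t
  proof -
    have "B t powr \<kappa> = (c * u0) powr (\<kappa> * (p - 1)) * exp (\<kappa> * (p - 1) * (c * (b - t)))"
      using c0 u0 by (simp add: B_def powr_mult powr_powr powr_def[of "exp _"] mult_ac)
    then show ?thesis using c0 u0 by (simp add: \<kappa>(2) g_def)
  qed
  have z0B: "z0 \<le> B b"
  proof -
    have "z0 = (z0 powr \<kappa>) powr (p - 1)" using z0 by (simp add: powr_powr \<kappa>(2))
    also have "\<dots> \<le> (c * u0) powr (p - 1)"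
      using c(1) u0(1) p by (intro powr_mono2) (auto simp: field_simps)
    finally show ?thesis by (simp add: B_def)
  qed
  have dB: "(B has_real_derivative - (c * (p - 1) * B t)) (at t)" for t
    unfolding B_def by (auto intro!: derivative_eq_intros)
  have h_cont: "continuous_on {..b} (h f)" if f: "osc_le g b f" for f
    unfolding h_def
    by (rule continuous_nonlinearity[OF osc_le_continuous[OF f g_cont]])
      (use osc_le_bounds(1)[OF f] g_b u0 in force)
  have h_int: "h f integrable_on {t..b}" if f: "osc_le g b f" for f t
    by (rule integrable_continuous_interval[OF continuous_on_subset[OF h_cont[OF f]]]) auto
  have h_nonneg: "0 \<le> h f s" for f s by (simp add: h_def)
  \<comment> \<open>Since \<open>c * m < \<beta>\<close>, the function \<open>exp (\<beta> * s) * g s powr m\<close> is largest at \<open>s = b\<close>, where the choice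
      of \<open>c\<close> bounds it by \<open>(p - 1) * c powr p\<close>; this is what makes \<open>g\<close> a barrier.\<close>
  have barrier: "h f s \<le> c * (p - 1) * B s" if f: "osc_le g b f" and s: "s \<le> b" for f s
  proof -
    have "f s powr q \<le> g s powr q"
      using osc_le_bounds[OF f s] g_b u0 q_pos by (intro powr_mono2) auto
    then have "h f s \<le> exp (\<beta> * s) * g s powr q"
      unfolding h_def by (intro mult_left_mono) auto
    also have "g s powr q = u0 powr q * exp (c * q * (b - s))"
      using u0 by (simp add: g_def powr_mult powr_def[of "exp _"] mult_ac)
    also have "u0 powr q = u0 powr m * u0 powr (p - 1)"
      by (simp add: powr_add[symmetric] m_def)
    also have "c * q * (b - s) = c * m * (b - s) + c * (p - 1) * (b - s)"
      by (simp add: m_def algebra_simps)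
    also have "exp (\<beta> * s) * (u0 powr m * u0 powr (p - 1) * exp (c * m * (b - s) + c * (p - 1) * (b - s)))
        = (exp (\<beta> * s + c * m * (b - s)) * u0 powr m) * (u0 powr (p - 1) * exp (c * (p - 1) * (b - s)))"
      by (simp add: exp_add mult_ac)
    also have "\<dots> \<le> ((p - 1) * c powr p) * (u0 powr (p - 1) * exp (c * (p - 1) * (b - s)))"
    proof (rule mult_right_mono)
      have "c * m * (b - s) \<le> \<gamma> * m * (b - s)"
        using c m s by (intro mult_right_mono) auto
      then have "\<beta> * s + c * m * (b - s) \<le> \<beta> * b"
        unfolding \<gamma>_m by (simp add: algebra_simps)
      then have "exp (\<beta> * s + c * m * (b - s)) * u0 powr m \<le> exp (\<beta> * b) * u0 powr m"
        by (intro mult_right_mono) auto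
      then show "exp (\<beta> * s + c * m * (b - s)) * u0 powr m \<le> (p - 1) * c powr p"
        using c(3) by simp
    qed simp
    also have "c powr p = c * c powr (p - 1)"
      using c0 by (simp add: powr_mult_base)
    also have "(p - 1) * (c * c powr (p - 1)) * (u0 powr (p - 1) * exp (c * (p - 1) * (b - s)))
        = c * (p - 1) * B s"
      using c0 u0 by (simp add: B_def powr_mult mult_ac)
    finally show ?thesis .
  qed
  have Z_bd: "z0 \<le> Z f t" "Z f t \<le> B t" if f: "osc_le g b f" and t: "t \<le> b" for f t
  proof -
    show "z0 \<le> Z f t"
      unfolding Z_def using integral_nonneg[OF h_int[OF f] h_nonneg] by simp
    have "((\<lambda>s. c * (p - 1) * B s) has_integral - B b - - B t) {t..b}"
    proof (rule fundamental_theorem_of_calculus[where f = "\<lambda>x. - B x", OF t])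
      fix x
      have "((\<lambda>x. - B x) has_real_derivative c * (p - 1) * B x) (at x)"
        using DERIV_minus[OF dB] by simp
      then show "((\<lambda>x. - B x) has_vector_derivative c * (p - 1) * B x) (at x within {t..b})"
        by (metis has_field_derivative_at_within has_real_derivative_iff_has_vector_derivative)
    qed
    then have "integral {t..b} (h f) \<le> - B b - - B t"
      by (rule has_integral_le[OF integrable_integral[OF h_int[OF f]]]) (rule barrier[OF f], simp)
    then show "Z f t \<le> B t" using z0B by (simp add: Z_def)
  qed
  have dZ: "(Z f has_real_derivative - h f t) (at t within {..b})"
    if f: "osc_le g b f" and t: "t \<le> b" for f t
  proof -
    have "((\<lambda>t. z0 + integral {t..b} (h f)) has_real_derivative 0 + - h f t) (at t within {..b})"
      by (intro DERIV_add DERIV_const integral_lower_limit_has_derivative h_cont f t)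
    then show ?thesis by (simp add: Z_def[abs_def])
  qed
  have "\<exists>u. osc_le g b u \<and>
    (\<forall>t\<le>b. (u has_real_derivative - N u t) (at t within {..b}))"
  proof (rule monotone_integral_equation[where k = "\<lambda>t. c * g t"])
    show "(g has_real_derivative - (c * g t)) (at t)" for t
      unfolding g_def by (auto intro!: derivative_eq_intros)
    show "0 \<le> c * g t" for t using c0 u0 by (simp add: g_def)
  next
    fix f assume f: "osc_le g b f"
    have "continuous_on {..b} (Z f)"
      by (rule DERIV_continuous_on) (use dZ[OF f] in auto)
    then show "continuous_on {..b} (N f)"
      unfolding N_def using Z_bd(1)[OF f] z0 by (intro continuous_intros) force+
  next
    fix f t assume f: "osc_le g b f" "t \<le> b"
    have "N f t \<le> B t powr \<kappa>"
      unfolding N_def using Z_bd[OF f] z0 \<kappa> by (intro powr_mono2) auto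
    then show "0 \<le> N f t \<and> N f t \<le> c * g t" by (simp add: B_root) (simp add: N_def)
  next
    fix f1 f2 t assume f: "osc_le g b f1" "osc_le g b f2"
      and le: "\<And>s. s \<le> b \<Longrightarrow> f1 s \<le> f2 s" and t: "t \<le> b"
    have "integral {t..b} (h f1) \<le> integral {t..b} (h f2)"
    proof (rule integral_le[OF h_int[OF f(1)] h_int[OF f(2)]])
      fix x assume x: "x \<in> {t..b}"
      have "0 \<le> f1 x" using osc_le_bounds(1)[OF f(1), of x] x g_b u0 by simp
      then show "h f1 x \<le> h f2 x"
        unfolding h_def using le[of x] x q_pos by (intro mult_left_mono powr_mono2) auto
    qed
    then show "N f1 t \<le> N f2 t"
      unfolding N_def using Z_bd(1)[OF f(1) t] z0 \<kappa> by (intro powr_mono2) (auto simp: Z_def)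
  qed
  then obtain u where u: "osc_le g b u"
    "\<And>t. t \<le> b \<Longrightarrow> (u has_real_derivative - N u t) (at t within {..b})" by blast
  show ?thesis
  proof (rule exI[of _ u], rule exI[of _ "Z u"], rule exI[of _ c], intro conjI allI impI)
    show "u b = u0" using u(1) g_b by (simp add: osc_le_def)
    show "Z u b = z0" by (simp add: Z_def)
    show "0 < c" "c < \<gamma>" by fact+
    fix t assume t: "t \<le> b"
    show "u0 \<le> u t" "u t \<le> u0 * exp (c * (b - t))"
      using osc_le_bounds[OF u(1) t] g_b by (auto simp: g_def)
    show "z0 \<le> Z u t" using Z_bd(1)[OF u(1) t] .
    show "(u has_real_derivative - (Z u t powr (1 / (p - 1)))) (at t within {..b})"
      using u(2)[OF t] by (simp add: N_def \<kappa>_def)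
    show "(Z u has_real_derivative - (exp (\<beta> * t) * u t powr q)) (at t within {..b})"
      using dZ[OF u(1) t] by (simp add: h_def)
  qed
qed

text \<open>
  Since \<open>z\<close> decreases, \<open>u\<close> is at most a linear function of \<open>b - t\<close> times \<open>z powr (1 / (p - 1))\<close>. Splitting
  \<open>u powr q = u powr m * u powr (p - 1)\<close> and using the rate \<open>c < \<gamma>\<close> only for the first factor shows
  that the logarithmic derivative of \<open>z\<close> decays exponentially, since \<open>\<beta> - m * c > 0\<close>. So \<open>z\<close> is
  bounded, and it is monotone.
\<close>
lemma flux_converges_at_bot:
  assumes u0: "u0 > 0" and z0: "z0 > 0" and c: "0 < c" "c < \<gamma>"
    and ub: "\<And>t. t \<le> b \<Longrightarrow> u0 \<le> u t \<and> u t \<le> u0 * exp (c * (b - t))" and zb: "\<And>t. t \<le> b \<Longrightarrow> z0 \<le> z t"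
    and du: "\<And>t. t \<le> b \<Longrightarrow> (u has_real_derivative - (z t powr (1 / (p - 1)))) (at t within {..b})"
    and dz: "\<And>t. t \<le> b \<Longrightarrow> (z has_real_derivative - (exp (\<beta> * t) * u t powr q)) (at t within {..b})"
    and ub0: "u b = u0"
  shows "\<exists>L>0. (z \<longlongrightarrow> L) at_bot"
proof -
  define \<kappa> where "\<kappa> = 1 / (p - 1)"
  have \<kappa>: "\<kappa> > 0" "\<kappa> * (p - 1) = 1" using p by (auto simp: \<kappa>_def)
  have at: "at t within {..b} = at t" if "t < b" for t
    by (rule at_within_interior) (use that in simp)
  have zpos: "z t > 0" and upos: "u t > 0" if "t \<le> b" for t
    using zb[OF that] ub[OF that] u0 z0 by auto
  have ucont: "continuous_on {..b} u" and zcont: "continuous_on {..b} z"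
    by (rule DERIV_continuous_on, (rule du dz, simp))+
  have anti: "z t \<le> z s" if "s \<le> t" "t \<le> b" for s t
  proof (rule DERIV_nonpos_imp_decreasing_open[OF that(1)])
    fix x assume x: "s < x" "x < t"
    then have "(z has_real_derivative - (exp (\<beta> * x) * u x powr q)) (at x)"
      using dz[of x] at[of x] that by simp
    then show "\<exists>y. (z has_real_derivative y) (at x) \<and> y \<le> 0"
      by (intro exI[of _ "- (exp (\<beta> * x) * u x powr q)"]) simp
  qed (rule continuous_on_subset[OF zcont], use that in auto)
  define \<eta> where "\<eta> = (\<beta> - m * c) / 2"
  have "m * c < m * \<gamma>" using m c by simp
  then have \<eta>: "\<eta> > 0" using \<gamma>_m by (simp add: \<eta>_def mult.commute)
  define K1 where "K1 = u0 / z0 powr \<kappa>"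
  define K2 where "K2 = K1 + 1 / (\<eta> * \<kappa>)"
  have K: "K1 > 0" "K2 > 0" using u0 z0 \<eta> \<kappa> by (auto simp: K1_def K2_def intro!: add_pos_pos)
  have u_le: "u t \<le> K2 * exp (\<eta> * \<kappa> * (b - t)) * z t powr \<kappa>" if t: "t \<le> b" for t
  proof -
    have "u t - u b \<le> (b - t) * z t powr \<kappa>"
    proof (cases "t = b")
      case False
      then have "t < b" using t by simp
      moreover have "continuous_on {t..b} u" by (rule continuous_on_subset[OF ucont]) auto
      ultimately obtain x where x: "t < x" "x < b" "u b - u t = - (z x powr \<kappa>) * (b - t)"
      proof (rule mvt[of t b u "\<lambda>x. (*) (- (z x powr \<kappa>))"])
        fix x assume "t < x" "x < b"
        then show "(u has_derivative (*) (- (z x powr \<kappa>))) (at x)"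
          using du[of x] at[of x] by (simp add: has_field_derivative_def \<kappa>_def)
      qed
      have "z x powr \<kappa> \<le> z t powr \<kappa>"
        using anti[of t x] zpos[of x] x \<kappa> by (intro powr_mono2) auto
      then have "z x powr \<kappa> * (b - t) \<le> z t powr \<kappa> * (b - t)"
        using t by (intro mult_right_mono) auto
      then show ?thesis using x(3) by (simp add: mult.commute)
    qed simp
    moreover have "u0 \<le> K1 * z t powr \<kappa>"
    proof -
      have "u0 = K1 * z0 powr \<kappa>" using z0 by (simp add: K1_def)
      also have "\<dots> \<le> K1 * z t powr \<kappa>"
        using zb[OF t] z0 K \<kappa> by (intro mult_left_mono powr_mono2) auto
      finally show ?thesis .
    qed
    ultimately have "u t \<le> (K1 + (b - t)) * z t powr \<kappa>"
      using ub0 by (simp add: algebra_simps)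
    also have "\<dots> \<le> K2 * exp (\<eta> * \<kappa> * (b - t)) * z t powr \<kappa>"
    proof (rule mult_right_mono)
      have "1 + \<eta> * \<kappa> * (b - t) \<le> exp (\<eta> * \<kappa> * (b - t))" by (rule exp_ge_add_one_self)
      moreover have "0 \<le> \<eta> * \<kappa> * (b - t)" using \<eta> \<kappa> t by simp
      ultimately have "1 \<le> exp (\<eta> * \<kappa> * (b - t))" "\<eta> * \<kappa> * (b - t) \<le> exp (\<eta> * \<kappa> * (b - t))"
        by linarith+
      then have "K1 * 1 + 1 / (\<eta> * \<kappa>) * (\<eta> * \<kappa> * (b - t)) \<le>
          K1 * exp (\<eta> * \<kappa> * (b - t)) + 1 / (\<eta> * \<kappa>) * exp (\<eta> * \<kappa> * (b - t))"
        using K \<eta> \<kappa> by (intro add_mono mult_left_mono) auto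
      then show "K1 + (b - t) \<le> K2 * exp (\<eta> * \<kappa> * (b - t))"
        using \<eta> \<kappa> by (simp add: K2_def distrib_right)
    qed simp
    finally show ?thesis .
  qed
  define K3 where "K3 = u0 powr m * exp (m * c * b) * K2 powr (p - 1) * exp (\<eta> * b)"
  have X: "exp (\<beta> * t) * u t powr q \<le> K3 * exp (\<eta> * t) * z t" if t: "t \<le> b" for t
  proof -
    have "u t powr q = u t powr m * u t powr (p - 1)" by (simp add: powr_add[symmetric] m_def)
    also have "\<dots> \<le> (u0 * exp (c * (b - t))) powr m * (K2 * exp (\<eta> * \<kappa> * (b - t)) * z t powr \<kappa>) powr (p - 1)"
      using ub[OF t] u_le[OF t] upos[OF t] m p by (intro mult_mono powr_mono2) auto
    also have "(u0 * exp (c * (b - t))) powr m = u0 powr m * exp (m * c * (b - t))"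
      using u0 by (simp add: powr_mult powr_def[of "exp _"] mult_ac)
    also have "(K2 * exp (\<eta> * \<kappa> * (b - t)) * z t powr \<kappa>) powr (p - 1) =
        K2 powr (p - 1) * exp ((\<kappa> * (p - 1)) * (\<eta> * (b - t))) * z t powr (\<kappa> * (p - 1))"
      using K zpos[OF t] by (simp add: powr_mult powr_powr powr_def[of "exp _"] mult_ac)
    also have "\<dots> = K2 powr (p - 1) * exp (\<eta> * (b - t)) * z t"
      unfolding \<kappa>(2) using zpos[OF t] by simp
    finally have "exp (\<beta> * t) * u t powr q \<le> exp (\<beta> * t) *
        (u0 powr m * exp (m * c * (b - t)) * (K2 powr (p - 1) * exp (\<eta> * (b - t)) * z t))"
      by (intro mult_left_mono) auto
    also have "\<dots> = u0 powr m * K2 powr (p - 1) * z t * exp (\<beta> * t + m * c * (b - t) + \<eta> * (b - t))"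
      by (simp add: exp_add mult_ac)
    also have "\<beta> * t + m * c * (b - t) + \<eta> * (b - t) = m * c * b + \<eta> * b + \<eta> * t"
      by (simp add: \<eta>_def field_simps)
    also have "u0 powr m * K2 powr (p - 1) * z t * exp (m * c * b + \<eta> * b + \<eta> * t) = K3 * exp (\<eta> * t) * z t"
      by (simp add: K3_def exp_add mult_ac)
    finally show ?thesis .
  qed
  \<comment> \<open>The logarithmic derivative of \<open>z\<close> is at most \<open>K3 * exp (\<eta> * t)\<close> in absolute value, which is
      integrable at minus infinity.\<close>
  define V where "V t = ln (z t) + K3 / \<eta> * exp (\<eta> * t)" for t
  have V: "V t \<le> V b" if t: "t \<le> b" for t
  proof (rule DERIV_nonneg_imp_increasing_open[OF t])
    fix x assume x: "t < x" "x < b"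
    have "(z has_real_derivative - (exp (\<beta> * x) * u x powr q)) (at x)"
      using dz[of x] at[of x] x by simp
    then have "(V has_real_derivative inverse (z x) * - (exp (\<beta> * x) * u x powr q) +
        K3 / \<eta> * (exp (\<eta> * x) * (\<eta> * 1))) (at x)"
      unfolding V_def using zpos[of x] x
      by (intro DERIV_add DERIV_cmult DERIV_chain2[OF DERIV_ln] DERIV_chain2[OF DERIV_exp] DERIV_ident) auto
    moreover have "inverse (z x) * - (exp (\<beta> * x) * u x powr q) + K3 / \<eta> * (exp (\<eta> * x) * (\<eta> * 1)) \<ge> 0"
      using X[of x] x zpos[of x] \<eta> by (simp add: field_simps)
    ultimately show "\<exists>y. (V has_real_derivative y) (at x) \<and> 0 \<le> y" by blast
  next
    show "continuous_on {t..b} V"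
      unfolding V_def by (intro continuous_intros continuous_on_subset[OF zcont]) (use zpos in force)+
  qed
  have K3: "K3 > 0" using u0 K by (simp add: K3_def)
  have "z t \<le> exp (V b)" if t: "t \<le> b" for t
  proof -
    have "ln (z t) \<le> V t" using K3 \<eta> by (simp add: V_def)
    then have "ln (z t) \<le> V b" using V[OF t] by simp
    then have "exp (ln (z t)) \<le> exp (V b)" by simp
    then show ?thesis using zpos[OF t] by simp
  qed
  from monotone_bounded_tendsto_at_bot[of b z, OF anti this]
  show ?thesis using zpos[of b] by (meson less_le_trans order_refl)
qed

text \<open>
  Along the stable branch \<open>u * exp (\<gamma> * t)\<close> increases to \<open>A\<close>, so at every point the branch lies below the
  power solution and has a smaller logarithmic slope, which are the data that can be continued backward.
\<close>
lemma global_solution_exists: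
  "\<exists>u y C. log_system p q \<beta> (- 1) UNIV u y \<and> 0 < C \<and> ((\<lambda>t. inv_flux (y t)) \<longlongrightarrow> - C) at_bot \<and>
     ((\<lambda>t. u t * exp (\<gamma> * t)) \<longlongrightarrow> A) at_top"
proof -
  obtain T u2 y2 where sys2: "log_system p q \<beta> (- 1) {T<..} u2 y2"
    and lim2: "((\<lambda>t. u2 t * exp (\<gamma> * t)) \<longlongrightarrow> A) at_top"
    and slope2: "\<And>t. t > T \<Longrightarrow> - \<gamma> * u2 t < inv_flux (y2 t) \<and> y2 t < 0"
    using stable_branch_exists by blast
  define b where "b = T + 1"
  define u0 z0 where "u0 = u2 b" and "z0 = - y2 b"
  have b: "b > T" by (simp add: b_def)
  have u0: "u0 > 0" using sys2 b by (simp add: log_system_def u0_def)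
  have z0: "z0 > 0" using slope2[OF b] by (simp add: z0_def)
  have slope: "z0 powr (1 / (p - 1)) < \<gamma> * u0"
    using slope2[OF b] inv_flux_minus_pos[OF z0] by (simp add: z0_def u0_def)
  have below: "u0 * exp (\<gamma> * b) < A"
  proof -
    define v where "v t = u2 t * exp (\<gamma> * t)" for t
    have dv: "\<exists>y. (v has_real_derivative y) (at t) \<and> 0 < y" if "t > T" for t
    proof -
      have "(u2 has_real_derivative inv_flux (y2 t)) (at t)"
        using sys2 that by (simp add: log_system_def)
      then have "(v has_real_derivative inv_flux (y2 t) * exp (\<gamma> * t) + exp (\<gamma> * t) * (\<gamma> * 1) * u2 t) (at t)"
        unfolding v_def by (intro DERIV_mult DERIV_chain2[OF DERIV_exp] DERIV_cmult DERIV_ident)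
      moreover have "inv_flux (y2 t) * exp (\<gamma> * t) + exp (\<gamma> * t) * (\<gamma> * 1) * u2 t
          = exp (\<gamma> * t) * (inv_flux (y2 t) + \<gamma> * u2 t)" by (simp add: algebra_simps)
      moreover have "0 < inv_flux (y2 t) + \<gamma> * u2 t" using slope2[OF that] by simp
      ultimately show ?thesis by (metis exp_gt_zero mult_pos_pos)
    qed
    have mono: "v s < v t" if "T < s" "s < t" for s t
      by (rule DERIV_pos_imp_increasing[OF that(2)]) (use dv that in force)
    have "v (b + 1) \<le> A"
    proof (rule tendsto_lowerbound)
      show "(v \<longlongrightarrow> A) at_top" using lim2 by (simp add: v_def[abs_def])
      show "\<forall>\<^sub>F t in at_top. v (b + 1) \<le> v t"
        using eventually_gt_at_top[of "b + 1"]
        by eventually_elim (use mono[of "b + 1"] b in force)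
    qed simp
    moreover have "v b < v (b + 1)" using mono[of b "b + 1"] b by simp
    ultimately show ?thesis by (simp add: v_def u0_def)
  qed
  obtain u1 z c where u1: "u1 b = u0" "z b = z0" and c: "0 < c" "c < \<gamma>"
    and bd: "\<And>t. t \<le> b \<Longrightarrow> u0 \<le> u1 t \<and> u1 t \<le> u0 * exp (c * (b - t))" "\<And>t. t \<le> b \<Longrightarrow> z0 \<le> z t"
    and d: "\<And>t. t \<le> b \<Longrightarrow> (u1 has_real_derivative - (z t powr (1 / (p - 1)))) (at t within {..b})"
      "\<And>t. t \<le> b \<Longrightarrow> (z has_real_derivative - (exp (\<beta> * t) * u1 t powr q)) (at t within {..b})"
    using backward_continuation[OF u0 below z0 slope] by blast
  obtain L where L: "L > 0" "(z \<longlongrightarrow> L) at_bot"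
    using flux_converges_at_bot[OF u0 z0 c bd d u1(1)] by blast
  define u where "u t = (if t \<le> b then u1 t else u2 t)" for t
  define y where "y t = (if t \<le> b then - z t else y2 t)" for t
  have flux: "inv_flux (y t) = - (z t powr (1 / (p - 1)))" if "t \<le> b" for t
    using inv_flux_minus_pos[of "z t"] bd(2)[OF that] z0 that by (simp add: y_def)
  have ub: "u t = u2 t" and yb: "y t = y2 t" if "b \<le> t" for t
    using that u1 by (auto simp: u_def y_def u0_def z0_def)
  have "log_system p q \<beta> (- 1) UNIV u y"
    unfolding log_system_def
  proof (intro ballI conjI)
    fix t
    show "0 < u t" using bd(1)[of t] u0 sys2 b by (auto simp: u_def log_system_def)
    show "(u has_real_derivative inv_flux (y t)) (at t)"
      unfolding u_def
    proof (rule has_real_derivative_glue)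
      show "(u1 has_real_derivative inv_flux (y t)) (at t within {..b})" if "t \<le> b" for t
        using d(1)[OF that] flux[OF that] by simp
      show "(u2 has_real_derivative inv_flux (y t)) (at t)" if "b \<le> t" for t
        using sys2 that b by (simp add: yb log_system_def)
    qed (simp add: u1 u0_def)
    show "(y has_real_derivative - (- 1) * exp (\<beta> * t) * u t powr q) (at t)"
      unfolding y_def
    proof (rule has_real_derivative_glue)
      show "((\<lambda>t. - z t) has_real_derivative - (- 1) * exp (\<beta> * t) * u t powr q) (at t within {..b})"
        if "t \<le> b" for t
        using DERIV_minus[OF d(2)[OF that]] that by (simp add: u_def)
      show "(y2 has_real_derivative - (- 1) * exp (\<beta> * t) * u t powr q) (at t)" if "b \<le> t" for t
        using sys2 that b by (simp add: ub log_system_def)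
    qed (simp add: u1 z0_def)
  qed
  moreover have "((\<lambda>t. inv_flux (y t)) \<longlongrightarrow> - (L powr (1 / (p - 1)))) at_bot"
  proof (rule Lim_transform_eventually)
    show "((\<lambda>t. - (z t powr (1 / (p - 1)))) \<longlongrightarrow> - (L powr (1 / (p - 1)))) at_bot"
      using L by (intro tendsto_intros) auto
    show "\<forall>\<^sub>F t in at_bot. - (z t powr (1 / (p - 1))) = inv_flux (y t)"
      using eventually_le_at_bot[of b] by eventually_elim (simp add: flux)
  qed
  moreover have "((\<lambda>t. u t * exp (\<gamma> * t)) \<longlongrightarrow> A) at_top"
  proof (rule Lim_transform_eventually[OF lim2])
    show "\<forall>\<^sub>F t in at_top. u2 t * exp (\<gamma> * t) = u t * exp (\<gamma> * t)"
      using eventually_ge_at_top[of b] by eventually_elim (simp add: ub)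
  qed
  moreover have "0 < L powr (1 / (p - 1))" using L by simp
  ultimately show ?thesis by blast
qed

end

section \<open>Back to the radial variable\<close>

text \<open>
  The filter \<open>G\<close> may be finer than \<open>F\<close>: functions on the whole half-line are told apart by their behaviour at
  one end.
\<close>
lemma infinitely_many_along_of_distinct_limits:
  fixes w :: "nat \<Rightarrow> real \<Rightarrow> real" and k :: "real \<Rightarrow> real"
  assumes G: "G \<noteq> bot" "G \<le> F" and P: "\<And>n. P (w n)"
    and lim: "\<And>n. ((\<lambda>r. w n r / k r) \<longlongrightarrow> C n) G" and inj: "inj C"
  shows "infinitely_many_along F P"
  unfolding infinitely_many_along_def
proof (intro exI[of _ "range w"] conjI)
  have eq: "m = n" if "\<forall>\<^sub>F r in F. w m r = w n r" for m n
  proof -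
    have "\<forall>\<^sub>F r in G. w m r = w n r" using that G(2) by (simp add: le_filter_def)
    then have "\<forall>\<^sub>F r in G. w m r / k r = w n r / k r" by eventually_elim simp
    from Lim_transform_eventually[OF lim this] have "C m = C n"
      by (rule tendsto_unique[OF G(1) _ lim])
    then show ?thesis using inj by (simp add: inj_eq)
  qed
  have "inj w"
  proof (rule injI)
    fix m n assume "w m = w n"
    then show "m = n" by (intro eq) simp
  qed
  then show "infinite (range w)" by (rule range_inj_infinite)
  show "\<forall>w\<in>range w. P w" using P by auto
  show "pairwise (\<lambda>v w. \<not> (\<forall>\<^sub>F r in F. v r = w r)) (range w)"
    unfolding pairwise_def using eq by blast
qed

lemma infinitely_many_along_mono:
  "infinitely_many_along F P \<Longrightarrow> (\<And>w. P w \<Longrightarrow> Q w) \<Longrightarrow> infinitely_many_along F Q"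
  unfolding infinitely_many_along_def by blast

lemma positive_solution_cong:
  assumes v: "positive_solution p q \<sigma> \<epsilon> I v" and I: "open I" and p: "p > 1"
    and eq: "\<And>r. r \<in> I \<Longrightarrow> v r = w r"
  shows "positive_solution p q \<sigma> \<epsilon> I w"
proof -
  obtain Y where Y: "\<And>r. r \<in> I \<Longrightarrow> 0 < v r \<and> (v has_real_derivative p_flux (p / (p - 1)) (Y r)) (at r) \<and>
       (Y has_real_derivative - \<epsilon> * r powr \<sigma> * v r powr q - (p - 1) / r * Y r) (at r)"
    using v unfolding positive_solution_iff_system[OF p I] by blast
  have "(w has_real_derivative p_flux (p / (p - 1)) (Y r)) (at r)" if "r \<in> I" for r
    by (rule has_field_derivative_transform_within_open[OF conjunct1[OF conjunct2[OF Y[OF that]]] I that])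
      (rule eq)
  then show ?thesis
    unfolding positive_solution_iff_system[OF p I] using Y eq by (intro exI[of _ Y]) auto
qed

lemma filterlim_shift_at_bot: "filterlim (\<lambda>t::real. t + \<tau>) at_bot at_bot"
  unfolding filterlim_at_bot
proof
  fix Z show "\<forall>\<^sub>F t in at_bot. t + \<tau> \<le> Z"
    using eventually_le_at_bot[of "Z - \<tau>"] by eventually_elim simp
qed

lemma filterlim_shift_at_top: "filterlim (\<lambda>t::real. t + \<tau>) at_top at_top"
  unfolding filterlim_at_top
proof
  fix Z show "\<forall>\<^sub>F t in at_top. Z \<le> t + \<tau>"
    using eventually_ge_at_top[of "Z - \<tau>"] by eventually_elim simp
qed

context log_emden_fowler begin

lemma inv_flux_scaled: "inv_flux (exp (\<gamma> * \<tau> * (p - 1)) * x) = exp (\<gamma> * \<tau>) * inv_flux x"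
proof -
  have e: "p / (p - 1) - 1 = 1 / (p - 1)" using p by (auto simp: field_simps)
  show ?thesis using p by (simp add: p_flux_mult_pos e powr_def)
qed

text \<open>
  The translation by \<open>\<tau>\<close> produces a factor \<open>exp (\<beta> * \<tau>)\<close>; since the two sides of the equation are
  homogeneous in \<open>u\<close> of the different degrees \<open>p - 1\<close> and \<open>q\<close>, the multiplier \<open>exp (\<gamma> * \<tau>)\<close> absorbs it.
\<close>
lemma log_system_scaling:
  assumes sys: "log_system p q \<beta> \<epsilon> J u y"
  shows "log_system p q \<beta> \<epsilon> {t. t + \<tau> \<in> J}
     (\<lambda>t. exp (\<gamma> * \<tau>) * u (t + \<tau>)) (\<lambda>t. exp (\<gamma> * \<tau> * (p - 1)) * y (t + \<tau>))"
  unfolding log_system_def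
proof (intro ballI conjI)
  fix t assume "t \<in> {t. t + \<tau> \<in> J}"
  then have u: "0 < u (t + \<tau>)" "(u has_real_derivative inv_flux (y (t + \<tau>))) (at (t + \<tau>))"
    "(y has_real_derivative - \<epsilon> * exp (\<beta> * (t + \<tau>)) * u (t + \<tau>) powr q) (at (t + \<tau>))"
    using sys by (auto simp: log_system_def)
  show "0 < exp (\<gamma> * \<tau>) * u (t + \<tau>)" using u by simp
  show "((\<lambda>t. exp (\<gamma> * \<tau>) * u (t + \<tau>)) has_real_derivative
      inv_flux (exp (\<gamma> * \<tau> * (p - 1)) * y (t + \<tau>))) (at t)"
    unfolding inv_flux_scaled using u(2) DERIV_shift[of u _ t \<tau>] DERIV_cmult by metis
  have "\<gamma> * \<tau> * (p - 1) + \<beta> * (t + \<tau>) = \<gamma> * \<tau> * q + \<beta> * t"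
    using arg_cong[OF \<gamma>_q, of "\<lambda>x. \<tau> * x"] by (simp add: algebra_simps)
  then have ee: "exp (\<gamma> * \<tau> * (p - 1)) * exp (\<beta> * (t + \<tau>)) = exp (\<gamma> * \<tau> * q) * exp (\<beta> * t)"
    by (simp only: exp_add[symmetric])
  have "exp (\<gamma> * \<tau> * (p - 1)) * (- \<epsilon> * exp (\<beta> * (t + \<tau>)) * u (t + \<tau>) powr q)
      = - \<epsilon> * (exp (\<gamma> * \<tau> * (p - 1)) * exp (\<beta> * (t + \<tau>))) * u (t + \<tau>) powr q"
    by simp
  also have "\<dots> = - \<epsilon> * exp (\<beta> * t) * (exp (\<gamma> * \<tau>) * u (t + \<tau>)) powr q"
    unfolding ee using u(1) by (simp add: powr_mult powr_def[of "exp _"] mult.commute)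
  finally show "((\<lambda>t. exp (\<gamma> * \<tau> * (p - 1)) * y (t + \<tau>)) has_real_derivative
      - \<epsilon> * exp (\<beta> * t) * (exp (\<gamma> * \<tau>) * u (t + \<tau>)) powr q) (at t)"
    using u(3) DERIV_shift[of y _ t \<tau>] DERIV_cmult by metis
qed

text \<open>
  If \<open>u\<close> tends to \<open>w0\<close> at minus infinity and its flux vanishes there, the flux is asymptotic to
  \<open>- \<epsilon> * exp (\<beta> * t) * w0 powr q / \<beta>\<close>; the inverse flux of this is
  \<open>- \<epsilon> * exp (\<alpha> * t) * reg_slope w0\<close>.
\<close>
definition "reg_slope w0 = (w0 powr q / \<beta>) powr (1 / (p - 1))"

lemma reg_slope_pos: "w0 > 0 \<Longrightarrow> reg_slope w0 > 0"
  using \<beta> by (simp add: reg_slope_def)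

lemma reg_slope_scaled:
  assumes "L > 0"
  shows "reg_slope (exp (\<gamma> * \<tau>) * L) = exp (\<gamma> * \<tau>) * exp (\<alpha> * \<tau>) * reg_slope L"
proof -
  have "\<gamma> * q / (p - 1) = \<alpha> + \<gamma>"
    using p by (simp add: \<gamma>_q add_divide_distrib \<alpha>_def)
  then have "\<tau> * (\<gamma> * q / (p - 1)) = \<tau> * (\<alpha> + \<gamma>)" by simp
  then have e: "exp (\<gamma> * \<tau> * q * (1 / (p - 1))) = exp (\<gamma> * \<tau>) * exp (\<alpha> * \<tau>)"
    by (simp add: exp_add[symmetric] algebra_simps)
  have "(exp (\<gamma> * \<tau>) * L) powr q / \<beta> = exp (\<gamma> * \<tau> * q) * (L powr q / \<beta>)"
    using assms by (simp add: powr_mult powr_def[of "exp _"] mult_ac)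
  then have "reg_slope (exp (\<gamma> * \<tau>) * L) = exp (\<gamma> * \<tau> * q) powr (1 / (p - 1)) * reg_slope L"
    using assms \<beta> by (simp only: reg_slope_def) (subst powr_mult, auto)
  also have "exp (\<gamma> * \<tau> * q) powr (1 / (p - 1)) = exp (\<gamma> * \<tau> * q * (1 / (p - 1)))"
    by (simp add: powr_def)
  finally show ?thesis by (simp only: e)
qed

lemma regular_solution_with_limit:
  assumes \<epsilon>: "\<epsilon> \<in> {1, -1}" and w0: "w0 > 0"
  shows "\<exists>T u y. log_system p q \<beta> \<epsilon> {..<T} u y \<and> (u \<longlongrightarrow> w0) at_bot \<and>
    ((\<lambda>t. exp (- \<alpha> * t) * inv_flux (y t)) \<longlongrightarrow> - \<epsilon> * reg_slope w0) at_bot"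
proof -
  obtain T u y L where sys: "log_system p q \<beta> \<epsilon> {..<T} u y" and L: "0 < L"
    and lim: "(u \<longlongrightarrow> L) at_bot" "((\<lambda>t. exp (- \<alpha> * t) * inv_flux (y t)) \<longlongrightarrow> - \<epsilon> * reg_slope L) at_bot"
    using regular_solution_exists[OF \<epsilon>] unfolding reg_slope_def by blast
  define \<tau> where "\<tau> = ln (w0 / L) / \<gamma>"
  have e: "exp (\<gamma> * \<tau>) * L = w0" using \<gamma> L w0 by (simp add: \<tau>_def)
  note shift = filterlim_shift_at_bot[of \<tau>]
  show ?thesis
  proof (rule exI[of _ "T - \<tau>"], rule exI[of _ "\<lambda>t. exp (\<gamma> * \<tau>) * u (t + \<tau>)"],
      rule exI[of _ "\<lambda>t. exp (\<gamma> * \<tau> * (p - 1)) * y (t + \<tau>)"], intro conjI)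
    show "log_system p q \<beta> \<epsilon> {..<T - \<tau>} (\<lambda>t. exp (\<gamma> * \<tau>) * u (t + \<tau>))
        (\<lambda>t. exp (\<gamma> * \<tau> * (p - 1)) * y (t + \<tau>))"
      by (rule log_system_subset[OF log_system_scaling[OF sys]]) auto
    show "((\<lambda>t. exp (\<gamma> * \<tau>) * u (t + \<tau>)) \<longlongrightarrow> w0) at_bot"
      using tendsto_mult_left[OF filterlim_compose[OF lim(1) shift], of "exp (\<gamma> * \<tau>)"] by (simp add: e)
    have l: "((\<lambda>t. exp (\<gamma> * \<tau>) * exp (\<alpha> * \<tau>) * (exp (- \<alpha> * (t + \<tau>)) * inv_flux (y (t + \<tau>)))) \<longlongrightarrow>
        exp (\<gamma> * \<tau>) * exp (\<alpha> * \<tau>) * (- \<epsilon> * reg_slope L)) at_bot"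
      by (rule tendsto_mult_left[OF filterlim_compose[OF lim(2) shift]])
    have e1: "exp (\<gamma> * \<tau>) * exp (\<alpha> * \<tau>) * (- \<epsilon> * reg_slope L) = - \<epsilon> * reg_slope w0"
      unfolding e[symmetric] reg_slope_scaled[OF L] by simp
    have e2: "exp (\<gamma> * \<tau>) * exp (\<alpha> * \<tau>) * (exp (- \<alpha> * (t + \<tau>)) * x) =
        exp (- \<alpha> * t) * (exp (\<gamma> * \<tau>) * x)" for t x
    proof -
      have "exp (\<alpha> * \<tau>) * exp (- \<alpha> * (t + \<tau>)) = exp (- \<alpha> * t)"
        by (simp add: exp_add[symmetric] algebra_simps)
      then show ?thesis by (metis mult.assoc mult.left_commute)
    qed
    show "((\<lambda>t. exp (- \<alpha> * t) * inv_flux (exp (\<gamma> * \<tau> * (p - 1)) * y (t + \<tau>))) \<longlongrightarrow>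
        - \<epsilon> * reg_slope w0) at_bot"
      using l by (simp only: e1 e2 inv_flux_scaled)
  qed
qed

lemma flux_tendsto_zero_of_slope:
  assumes "((\<lambda>t. exp (- \<alpha> * t) * inv_flux (y t)) \<longlongrightarrow> l) at_bot"
  shows "(y \<longlongrightarrow> 0) at_bot"
proof -
  have "((\<lambda>t. exp (\<alpha> * t) * (exp (- \<alpha> * t) * inv_flux (y t))) \<longlongrightarrow> 0 * l) at_bot"
    by (intro tendsto_mult exp_mult_at_bot \<alpha> assms)
  then have "((\<lambda>t. inv_flux (y t)) \<longlongrightarrow> 0) at_bot"
    by (simp add: mult.assoc[symmetric] exp_add[symmetric])
  then have "((\<lambda>t. \<bar>inv_flux (y t)\<bar> powr (p - 1)) \<longlongrightarrow> 0 powr (p - 1)) at_bot"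
    by (intro tendsto_powr' tendsto_rabs_zero tendsto_const) (use p in auto)
  moreover have "\<bar>inv_flux x\<bar> powr (p - 1) = \<bar>x\<bar>" for x
  proof -
    have "\<bar>p_flux p z\<bar> = \<bar>z\<bar> powr (p - 1)" for z
      by (cases "z = 0") (auto simp: p_flux_def abs_mult powr_mult_base[symmetric] powr_diff power2_eq_square)
    then show ?thesis using p_flux_inverse[OF p, of x] by metis
  qed
  ultimately show ?thesis by (simp add: tendsto_rabs_zero_iff)
qed

lemma not_power_solution_of_slope:
  assumes sys: "log_system p q \<beta> \<epsilon> J u y" and K: "open K" and t: "t \<in> K" "t \<in> J"
    and slope: "- \<gamma> * u t < inv_flux (y t)"
  shows "\<not> (\<forall>x\<in>K. u x = A * exp (- \<gamma> * x))"
proof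
  assume eq: "\<forall>x\<in>K. u x = A * exp (- \<gamma> * x)"
  have "((\<lambda>x. A * exp (- \<gamma> * x)) has_real_derivative - \<gamma> * (A * exp (- \<gamma> * t))) (at t)"
    by (auto intro!: derivative_eq_intros)
  then have "(u has_real_derivative - \<gamma> * (A * exp (- \<gamma> * t))) (at t)"
    by (rule has_field_derivative_transform_within_open[OF _ K t(1)]) (use eq in auto)
  moreover have "(u has_real_derivative inv_flux (y t)) (at t)"
    using sys t(2) by (auto simp: log_system_def)
  ultimately have "inv_flux (y t) = - \<gamma> * u t" using DERIV_unique eq t(1) by metis
  then show False using slope by simp
qed

end

text \<open>
  The end of the half-line at which \<open>t\<close> tends to minus infinity is described by the filter \<open>F0\<close>, the other
  one by \<open>F1\<close>. For \<open>s = 1\<close> they are \<open>at_right 0\<close> and \<open>at_top\<close>, for \<open>s = - 1\<close> the roles are exchanged.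
\<close>
locale radial_emden_fowler = log_emden_fowler +
  fixes s \<sigma> :: real and F0 F1 :: "real filter"
  assumes s: "s \<in> {1, -1}" and \<beta>_eq: "s * (p + \<sigma>) = \<beta>"
    and F0: "F0 \<noteq> bot" "\<forall>\<^sub>F r in F0. 0 < r" "filterlim (\<lambda>r. s * ln r) at_bot F0"
      "filterlim (\<lambda>t. exp (s * t)) F0 at_bot"
    and F1: "\<forall>\<^sub>F r in F1. 0 < r" "filterlim (\<lambda>r. s * ln r) at_top F1"
      "filterlim (\<lambda>t. exp (s * t)) F1 at_top"
begin

text \<open>
  Neighbourhoods of the two ends \<open>F0\<close> and \<open>F1\<close>, as half-lines of the variable \<open>t\<close>.
\<close>
definition "near T = {r. 0 < r \<and> s * ln r < T}"
definition "far T = {r. 0 < r \<and> T < s * ln r}"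

lemma ss: "s * s = 1" "s * (s * x) = x" using s by auto

lemma open_near: "open (near T)" and open_far: "open (far T)"
proof -
  have "near T = {0<..} \<inter> (\<lambda>r. s * ln r) -` {..<T}" "far T = {0<..} \<inter> (\<lambda>r. s * ln r) -` {T<..}"
    by (auto simp: near_def far_def)
  moreover have "continuous_on {0<..} (\<lambda>r. s * ln r)"
    by (intro continuous_intros) auto
  ultimately show "open (near T)" "open (far T)"
    by (auto intro!: continuous_open_preimage)
qed

lemma eventually_near: "\<forall>\<^sub>F r in F0. r \<in> near T"
proof -
  have "\<forall>\<^sub>F r in F0. s * ln r < T"
    by (rule eventually_compose_filterlim[OF eventually_gt_at_bot F0(3)])
  with F0(2) show ?thesis by eventually_elim (simp add: near_def)
qed

lemma positive_solution_transfer: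
  assumes "log_system p q \<beta> \<epsilon> J u y" "open I" "\<And>r. r \<in> I \<Longrightarrow> 0 < r \<and> s * ln r \<in> J"
  shows "positive_solution p q \<sigma> \<epsilon> I (\<lambda>r. u (s * ln r))"
    and "\<And>r. r \<in> I \<Longrightarrow> deriv (\<lambda>r. u (s * ln r)) r = s / r * inv_flux (y (s * ln r))"
  using positive_solution_of_log_system[OF p s, of q \<sigma> \<epsilon> J u y I] assms
  by (auto simp: \<beta>_eq intro: DERIV_imp_deriv)

lemma w_star_eq: "r > 0 \<Longrightarrow> w_star p q \<sigma> r = A * exp (- \<gamma> * (s * ln r))"
proof -
  assume r: "r > 0"
  have "p + \<sigma> = s * \<beta>" using \<beta>_eq s by auto
  then have g: "gamma_exp p q \<sigma> = s * \<gamma>"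
    by (simp add: gamma_exp_def \<gamma>_def m_def algebra_simps)
  then have g': "\<bar>gamma_exp p q \<sigma>\<bar> = \<gamma>" using s \<gamma> by auto
  have "a_star p q \<sigma> = A"
    unfolding a_star_def g'
  proof (rule the1_equality)
    have "\<sigma> \<noteq> - p" using \<beta>_eq \<beta> by auto
    then show "\<exists>!a. 0 < a \<and> a powr (q - p + 1) = (p - 1) * \<gamma> powr p"
      using a_star_ex1[of p q \<sigma>] p q unfolding g' by simp
    show "0 < A \<and> A powr (q - p + 1) = (p - 1) * \<gamma> powr p"
      using A A_powr by (simp add: m_def)
  qed
  then show ?thesis using r by (simp add: w_star_def g powr_def mult_ac)
qed

lemma asymp_equiv_w_star:
  assumes "((\<lambda>t. u t * exp (\<gamma> * t)) \<longlongrightarrow> A) G" "filterlim (\<lambda>r. s * ln r) G F" "\<forall>\<^sub>F r in F. 0 < r"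
  shows "(\<lambda>r. u (s * ln r)) \<sim>[F] w_star p q \<sigma>"
proof (rule asymp_equivI')
  have "((\<lambda>r. u (s * ln r) * exp (\<gamma> * (s * ln r)) / A) \<longlongrightarrow> A / A) F"
    using A by (intro tendsto_divide filterlim_compose[OF assms(1,2)] tendsto_const) auto
  then have l: "((\<lambda>r. u (s * ln r) * exp (\<gamma> * (s * ln r)) / A) \<longlongrightarrow> 1) F" using A by simp
  have "\<forall>\<^sub>F r in F. u (s * ln r) * exp (\<gamma> * (s * ln r)) / A = u (s * ln r) / w_star p q \<sigma> r"
    using assms(3) by eventually_elim (simp add: w_star_eq exp_minus field_simps)
  from Lim_transform_eventually[OF l this]
  show "((\<lambda>r. u (s * ln r) / w_star p q \<sigma> r) \<longlongrightarrow> 1) F" .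
qed

lemma slope_exponent:
  assumes "r > 0"
  shows "r powr (- (\<sigma> + 1) / (p - 1)) = exp (- \<alpha> * (s * ln r)) * r"
proof -
  have "p + \<sigma> = s * \<beta>" using \<beta>_eq s by auto
  then have e: "- (\<sigma> + 1) = (p - 1) - s * \<beta>" by simp
  have "- (\<sigma> + 1) / (p - 1) = 1 - s * \<alpha>"
    unfolding e using p by (simp add: diff_divide_distrib \<alpha>_def)
  then have "- (\<sigma> + 1) / (p - 1) * ln r = (1 - s * \<alpha>) * ln r" by (simp only:)
  also have "\<dots> = - \<alpha> * (s * ln r) + ln r" by (simp add: algebra_simps)
  finally have "- (\<sigma> + 1) / (p - 1) * ln r = - \<alpha> * (s * ln r) + ln r" .
  then have "exp (- (\<sigma> + 1) / (p - 1) * ln r) = exp (- \<alpha> * (s * ln r)) * r"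
    using assms by (simp only: exp_add exp_ln)
  then show ?thesis using assms by (simp add: powr_def)
qed

lemma regular_solution:
  assumes \<epsilon>: "\<epsilon> \<in> {1, -1}" and w0: "w0 > 0"
  shows "\<exists>w T. positive_solution p q \<sigma> \<epsilon> (near T) w \<and> (w \<longlongrightarrow> w0) F0 \<and>
    ((\<lambda>r. r powr (- (\<sigma> + 1) / (p - 1)) * deriv w r) \<longlongrightarrow> - s * \<epsilon> * reg_slope w0) F0"
proof -
  obtain T u y where sys: "log_system p q \<beta> \<epsilon> {..<T} u y" and lim: "(u \<longlongrightarrow> w0) at_bot"
    "((\<lambda>t. exp (- \<alpha> * t) * inv_flux (y t)) \<longlongrightarrow> - \<epsilon> * reg_slope w0) at_bot"
    using regular_solution_with_limit[OF \<epsilon> w0] by blast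
  have sol: "positive_solution p q \<sigma> \<epsilon> (near T) (\<lambda>r. u (s * ln r))"
    "\<And>r. r \<in> near T \<Longrightarrow> deriv (\<lambda>r. u (s * ln r)) r = s / r * inv_flux (y (s * ln r))"
    using positive_solution_transfer[OF sys open_near] by (auto simp: near_def)
  have "((\<lambda>r. s * (exp (- \<alpha> * (s * ln r)) * inv_flux (y (s * ln r)))) \<longlongrightarrow> s * (- \<epsilon> * reg_slope w0)) F0"
    by (intro tendsto_mult_left filterlim_compose[OF lim(2) F0(3)])
  moreover have "\<forall>\<^sub>F r in F0. s * (exp (- \<alpha> * (s * ln r)) * inv_flux (y (s * ln r))) =
      r powr (- (\<sigma> + 1) / (p - 1)) * deriv (\<lambda>r. u (s * ln r)) r"
    using eventually_near[of T]
  proof eventually_elim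
    case (elim r)
    then have r: "r > 0" by (simp add: near_def)
    have "r powr (- (\<sigma> + 1) / (p - 1)) = exp (- \<alpha> * (s * ln r)) * r"
      unfolding slope_exponent[OF r] ..
    then show ?case using sol(2)[OF elim] r by simp
  qed
  ultimately have "((\<lambda>r. r powr (- (\<sigma> + 1) / (p - 1)) * deriv (\<lambda>r. u (s * ln r)) r) \<longlongrightarrow>
      s * (- \<epsilon> * reg_slope w0)) F0"
    by (rule Lim_transform_eventually)
  moreover have "s * (- \<epsilon> * reg_slope w0) = - s * \<epsilon> * reg_slope w0" by simp
  ultimately show ?thesis
    using sol(1) filterlim_compose[OF lim(1) F0(3)]
    by (intro exI[of _ "\<lambda>r. u (s * ln r)"] exI[of _ T] conjI) (simp_all only:)
qed

text \<open>
  The bound on \<open>w'\<close> contained in the slope condition forces the flux in the variable \<open>t\<close> to vanish at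
  minus infinity; together with the limit \<open>w0\<close> this determines the solution.
\<close>
lemma regular_solution_unique:
  assumes \<epsilon>: "\<epsilon> \<in> {1, -1}" and w0: "w0 > 0"
    and w1: "positive_solution p q \<sigma> \<epsilon> (near T1) w1" "(w1 \<longlongrightarrow> w0) F0"
      "((\<lambda>r. r powr (- (\<sigma> + 1) / (p - 1)) * deriv w1 r) \<longlongrightarrow> l1) F0"
    and w2: "positive_solution p q \<sigma> \<epsilon> (near T2) w2" "(w2 \<longlongrightarrow> w0) F0"
      "((\<lambda>r. r powr (- (\<sigma> + 1) / (p - 1)) * deriv w2 r) \<longlongrightarrow> l2) F0"
    and r: "r \<in> near T1" "r \<in> near T2"
  shows "w1 r = w2 r"
proof -
  have pull: "\<exists>y. log_system p q \<beta> \<epsilon> {..<min T1 T2} (\<lambda>t. w (exp (s * t))) y \<and> (y \<longlongrightarrow> 0) at_bot"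
    if w: "positive_solution p q \<sigma> \<epsilon> (near T) w" and T: "min T1 T2 \<le> T"
      and d: "((\<lambda>r. r powr (- (\<sigma> + 1) / (p - 1)) * deriv w r) \<longlongrightarrow> l) F0" for w T l
  proof -
    have "exp (s * t) \<in> near T" if "t \<in> {..<T}" for t
      using that by (simp add: near_def ss)
    from log_system_of_positive_solution[where J = "{..<T}", OF p s open_near w this]
    obtain y where y: "log_system p q \<beta> \<epsilon> {..<T} (\<lambda>t. w (exp (s * t))) y"
      "\<And>t. t < T \<Longrightarrow> inv_flux (y t) = s * exp (s * t) * deriv w (exp (s * t))"
      unfolding \<beta>_eq by auto
    have "((\<lambda>t. s * (exp (s * t) powr (- (\<sigma> + 1) / (p - 1)) * deriv w (exp (s * t)))) \<longlongrightarrow> s * l) at_bot"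
      by (intro tendsto_mult_left filterlim_compose[OF d F0(4)])
    moreover have "\<forall>\<^sub>F t in at_bot. s * (exp (s * t) powr (- (\<sigma> + 1) / (p - 1)) * deriv w (exp (s * t))) =
        exp (- \<alpha> * t) * inv_flux (y t)"
      using eventually_gt_at_bot[of T]
    proof eventually_elim
      case (elim t)
      have "exp (s * t) powr (- (\<sigma> + 1) / (p - 1)) = exp (- \<alpha> * t) * exp (s * t)"
        using slope_exponent[of "exp (s * t)"] by (simp add: ss)
      then show ?case by (simp add: y(2)[OF elim])
    qed
    ultimately have "(y \<longlongrightarrow> 0) at_bot"
      by (intro flux_tendsto_zero_of_slope) (rule Lim_transform_eventually)
    moreover have "log_system p q \<beta> \<epsilon> {..<min T1 T2} (\<lambda>t. w (exp (s * t))) y"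
      by (rule log_system_subset[OF y(1)]) (use T in auto)
    ultimately show ?thesis by blast
  qed
  obtain y1 where y1: "log_system p q \<beta> \<epsilon> {..<min T1 T2} (\<lambda>t. w1 (exp (s * t))) y1" "(y1 \<longlongrightarrow> 0) at_bot"
    using pull[OF w1(1) _ w1(3)] by auto
  obtain y2 where y2: "log_system p q \<beta> \<epsilon> {..<min T1 T2} (\<lambda>t. w2 (exp (s * t))) y2" "(y2 \<longlongrightarrow> 0) at_bot"
    using pull[OF w2(1) _ w2(3)] by auto
  have "w1 (exp (s * (s * ln r))) = w2 (exp (s * (s * ln r)))"
    by (rule log_system_unique[OF q p \<beta> \<epsilon> y1(1) y2(1) w0 _ _ y1(2) y2(2)])
      (use r filterlim_compose[OF w1(2) F0(4)] filterlim_compose[OF w2(2) F0(4)] in \<open>auto simp: near_def\<close>)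
  then show ?thesis using r by (simp add: ss near_def)
qed

lemma log_growth_transfer:
  assumes sys: "log_system p q \<beta> \<epsilon> {..<T} u y" and lim: "((\<lambda>t. inv_flux (y t)) \<longlongrightarrow> - C) at_bot"
  shows "((\<lambda>r. u (s * ln r) / \<bar>ln r\<bar>) \<longlongrightarrow> C) F0"
    and "((\<lambda>r. r * deriv (\<lambda>r. u (s * ln r)) r) \<longlongrightarrow> - s * C) F0"
proof -
  have "((\<lambda>t. u t / \<bar>t\<bar>) \<longlongrightarrow> C) at_bot"
    by (rule linear_growth_of_deriv_tendsto_at_bot[OF _ lim, of T])
      (use sys in \<open>auto simp: log_system_def\<close>)
  from filterlim_compose[OF this F0(3)]
  show "((\<lambda>r. u (s * ln r) / \<bar>ln r\<bar>) \<longlongrightarrow> C) F0" using s by (auto simp: abs_mult)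
  have "((\<lambda>r. s * inv_flux (y (s * ln r))) \<longlongrightarrow> s * - C) F0"
    by (intro tendsto_mult_left filterlim_compose[OF lim F0(3)])
  moreover have "\<forall>\<^sub>F r in F0. s * inv_flux (y (s * ln r)) = r * deriv (\<lambda>r. u (s * ln r)) r"
    using eventually_near[of T]
  proof eventually_elim
    case (elim r)
    then have "deriv (\<lambda>r. u (s * ln r)) r = s / r * inv_flux (y (s * ln r))"
      by (intro positive_solution_transfer(2)[OF sys open_near[of T]]) (auto simp: near_def)
    then show ?case using elim by (simp add: near_def)
  qed
  ultimately have "((\<lambda>r. r * deriv (\<lambda>r. u (s * ln r)) r) \<longlongrightarrow> s * - C) F0"
    by (rule Lim_transform_eventually)
  then show "((\<lambda>r. r * deriv (\<lambda>r. u (s * ln r)) r) \<longlongrightarrow> - s * C) F0" by simp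
qed

text \<open>
  The scaled solutions have the pairwise different constants \<open>exp (\<gamma> * \<tau>) * C\<close>.
\<close>
lemma log_growth_transfer_scaled:
  assumes sys: "log_system p q \<beta> \<epsilon> {..<T} u y" and lim: "((\<lambda>t. inv_flux (y t)) \<longlongrightarrow> - C) at_bot"
  defines "w \<equiv> \<lambda>\<tau> r. exp (\<gamma> * \<tau>) * u (s * ln r + \<tau>)"
  shows "((\<lambda>r. w \<tau> r / \<bar>ln r\<bar>) \<longlongrightarrow> exp (\<gamma> * \<tau>) * C) F0"
    and "((\<lambda>r. r * deriv (w \<tau>) r) \<longlongrightarrow> - s * (exp (\<gamma> * \<tau>) * C)) F0"
proof -
  have sys': "log_system p q \<beta> \<epsilon> {..<T - \<tau>} (\<lambda>t. exp (\<gamma> * \<tau>) * u (t + \<tau>))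
      (\<lambda>t. exp (\<gamma> * \<tau> * (p - 1)) * y (t + \<tau>))"
    by (rule log_system_subset[OF log_system_scaling[OF sys]]) auto
  have "((\<lambda>t. exp (\<gamma> * \<tau>) * inv_flux (y (t + \<tau>))) \<longlongrightarrow> exp (\<gamma> * \<tau>) * - C) at_bot"
    by (intro tendsto_mult_left filterlim_compose[OF lim filterlim_shift_at_bot])
  then have lim': "((\<lambda>t. inv_flux (exp (\<gamma> * \<tau> * (p - 1)) * y (t + \<tau>))) \<longlongrightarrow> - (exp (\<gamma> * \<tau>) * C)) at_bot"
    by (simp add: inv_flux_scaled)
  show "((\<lambda>r. w \<tau> r / \<bar>ln r\<bar>) \<longlongrightarrow> exp (\<gamma> * \<tau>) * C) F0"
    "((\<lambda>r. r * deriv (w \<tau>) r) \<longlongrightarrow> - s * (exp (\<gamma> * \<tau>) * C)) F0"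
    using log_growth_transfer[OF sys' lim'] by (simp_all add: w_def)
qed

lemma inj_scaled_constant: "C > 0 \<Longrightarrow> inj (\<lambda>n::nat. exp (\<gamma> * real n) * C)"
  using \<gamma> by (auto intro!: injI)

lemma log_growth_solutions:
  "infinitely_many_along F0 (\<lambda>w. (\<exists>T. positive_solution p q \<sigma> 1 (near T) w) \<and>
     (\<exists>C>0. ((\<lambda>r. w r / \<bar>ln r\<bar>) \<longlongrightarrow> C) F0 \<and> ((\<lambda>r. r * deriv w r) \<longlongrightarrow> - s * C) F0))"
proof -
  obtain T u y C where sys: "log_system p q \<beta> 1 {..<T} u y" and C: "C > 0"
    and lim: "((\<lambda>t. inv_flux (y t)) \<longlongrightarrow> - C) at_bot"
    using log_growth_solution_exists by blast
  note lims = log_growth_transfer_scaled[OF sys lim]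
  show ?thesis
  proof (rule infinitely_many_along_of_distinct_limits[OF F0(1) order_refl _ lims(1) inj_scaled_constant[OF C]])
    fix n :: nat
    have sol: "positive_solution p q \<sigma> 1 (near (T - n)) (\<lambda>r. exp (\<gamma> * n) * u (s * ln r + n))"
      by (rule positive_solution_transfer(1)[OF log_system_scaling[OF sys, of "real n"] open_near]) (auto simp: near_def)
    show "(\<exists>T. positive_solution p q \<sigma> 1 (near T) (\<lambda>r. exp (\<gamma> * n) * u (s * ln r + n))) \<and>
      (\<exists>C>0. ((\<lambda>r. exp (\<gamma> * n) * u (s * ln r + n) / \<bar>ln r\<bar>) \<longlongrightarrow> C) F0 \<and>
         ((\<lambda>r. r * deriv (\<lambda>r. exp (\<gamma> * n) * u (s * ln r + n)) r) \<longlongrightarrow> - s * C) F0)"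
    proof (intro conjI)
      show "\<exists>T. positive_solution p q \<sigma> 1 (near T) (\<lambda>r. exp (\<gamma> * n) * u (s * ln r + n))"
        using sol by blast
      show "\<exists>C>0. ((\<lambda>r. exp (\<gamma> * n) * u (s * ln r + n) / \<bar>ln r\<bar>) \<longlongrightarrow> C) F0 \<and>
         ((\<lambda>r. r * deriv (\<lambda>r. exp (\<gamma> * n) * u (s * ln r + n)) r) \<longlongrightarrow> - s * C) F0"
        using lims[of "real n"] C by (intro exI[of _ "exp (\<gamma> * n) * C"]) auto
    qed
  qed
qed

lemma w_star_solution: "positive_solution p q \<sigma> (- 1) {0<..} (w_star p q \<sigma>)"
proof -
  have "positive_solution p q \<sigma> (- 1) {0<..} (\<lambda>r. A * exp (- \<gamma> * (s * ln r)))"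
    by (rule positive_solution_transfer(1)[OF log_system_power_solution]) auto
  then show ?thesis by (rule positive_solution_cong[OF _ open_greaterThan p]) (simp add: w_star_eq)
qed

lemma near_w_star_solution:
  "\<exists>w T. positive_solution p q \<sigma> (- 1) (near T) w \<and> w \<sim>[F0] w_star p q \<sigma> \<and>
     \<not> (\<forall>\<^sub>F r in F0. w r = w_star p q \<sigma> r)"
proof -
  obtain T u y where sys: "log_system p q \<beta> (- 1) {..<T} u y"
    and lim: "((\<lambda>t. u t * exp (\<gamma> * t)) \<longlongrightarrow> A) at_bot"
    and slope: "\<And>t. t < T \<Longrightarrow> - \<gamma> * u t < inv_flux (y t)"
    using unstable_branch_exists by blast
  have "\<not> (\<forall>\<^sub>F r in F0. u (s * ln r) = w_star p q \<sigma> r)"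
  proof
    assume "\<forall>\<^sub>F r in F0. u (s * ln r) = w_star p q \<sigma> r"
    then have "\<forall>\<^sub>F t in at_bot. u (s * ln (exp (s * t))) = w_star p q \<sigma> (exp (s * t))"
      by (rule eventually_compose_filterlim[OF _ F0(4)])
    then obtain N where N: "\<And>t. t \<le> N \<Longrightarrow> u t = A * exp (- \<gamma> * t)"
      by (auto simp: eventually_at_bot_linorder w_star_eq ss)
    have "\<not> (\<forall>x\<in>{..<N}. u x = A * exp (- \<gamma> * x))"
      by (rule not_power_solution_of_slope[OF sys open_lessThan _ _ slope, of "min N T - 1"]) auto
    then show False using N by auto
  qed
  moreover have "positive_solution p q \<sigma> (- 1) (near T) (\<lambda>r. u (s * ln r))"
    by (rule positive_solution_transfer(1)[OF sys open_near]) (auto simp: near_def)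
  ultimately show ?thesis using asymp_equiv_w_star[OF lim F0(3,2)] by blast
qed

lemma far_w_star_solution:
  "\<exists>w T. positive_solution p q \<sigma> (- 1) (far T) w \<and> w \<sim>[F1] w_star p q \<sigma> \<and>
     \<not> (\<forall>\<^sub>F r in F1. w r = w_star p q \<sigma> r)"
proof -
  obtain T u y where sys: "log_system p q \<beta> (- 1) {T<..} u y"
    and lim: "((\<lambda>t. u t * exp (\<gamma> * t)) \<longlongrightarrow> A) at_top"
    and slope: "\<And>t. t > T \<Longrightarrow> - \<gamma> * u t < inv_flux (y t)"
    using stable_branch_exists by blast
  have "\<not> (\<forall>\<^sub>F r in F1. u (s * ln r) = w_star p q \<sigma> r)"
  proof
    assume "\<forall>\<^sub>F r in F1. u (s * ln r) = w_star p q \<sigma> r"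
    then have "\<forall>\<^sub>F t in at_top. u (s * ln (exp (s * t))) = w_star p q \<sigma> (exp (s * t))"
      by (rule eventually_compose_filterlim[OF _ F1(3)])
    then obtain N where N: "\<And>t. t \<ge> N \<Longrightarrow> u t = A * exp (- \<gamma> * t)"
      by (auto simp: eventually_at_top_linorder w_star_eq ss)
    have "\<not> (\<forall>x\<in>{N<..}. u x = A * exp (- \<gamma> * x))"
      by (rule not_power_solution_of_slope[OF sys open_greaterThan _ _ slope, of "max N T + 1"]) auto
    then show False using N by auto
  qed
  moreover have "positive_solution p q \<sigma> (- 1) (far T) (\<lambda>r. u (s * ln r))"
    by (rule positive_solution_transfer(1)[OF sys open_far]) (auto simp: far_def)
  ultimately show ?thesis using asymp_equiv_w_star[OF lim F1(2,1)] by blast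
qed

lemma global_solutions:
  "infinitely_many_along (principal {0<..}) (\<lambda>w. positive_solution p q \<sigma> (- 1) {0<..} w \<and>
     (\<exists>C>0. ((\<lambda>r. w r / \<bar>ln r\<bar>) \<longlongrightarrow> C) F0 \<and> ((\<lambda>r. r * deriv w r) \<longlongrightarrow> - s * C) F0) \<and>
     w \<sim>[F1] w_star p q \<sigma>)"
proof -
  obtain u y C where sys: "log_system p q \<beta> (- 1) UNIV u y" and C: "C > 0"
    and lim: "((\<lambda>t. inv_flux (y t)) \<longlongrightarrow> - C) at_bot" "((\<lambda>t. u t * exp (\<gamma> * t)) \<longlongrightarrow> A) at_top"
    using global_solution_exists by blast
  note lims = log_growth_transfer_scaled[OF log_system_subset[OF sys subset_UNIV, of "{..<0}"] lim(1)]
  have le: "F0 \<le> principal {0<..}" using F0(2) by (simp add: le_principal)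
  show ?thesis
  proof (rule infinitely_many_along_of_distinct_limits[OF F0(1) le _ lims(1) inj_scaled_constant[OF C]], intro conjI)
    fix n :: nat
    show "positive_solution p q \<sigma> (- 1) {0<..} (\<lambda>r. exp (\<gamma> * n) * u (s * ln r + n))"
      by (rule positive_solution_transfer(1)[OF log_system_scaling[OF sys, of "real n"]]) auto
    show "\<exists>C>0. ((\<lambda>r. exp (\<gamma> * n) * u (s * ln r + n) / \<bar>ln r\<bar>) \<longlongrightarrow> C) F0 \<and>
         ((\<lambda>r. r * deriv (\<lambda>r. exp (\<gamma> * n) * u (s * ln r + n)) r) \<longlongrightarrow> - s * C) F0"
      using lims[of "real n"] C by (intro exI[of _ "exp (\<gamma> * n) * C"]) auto
    have "((\<lambda>t. u (t + real n) * exp (\<gamma> * (t + real n))) \<longlongrightarrow> A) at_top"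
      by (rule filterlim_compose[OF lim(2) filterlim_shift_at_top])
    then have "((\<lambda>t::real. exp (\<gamma> * n) * u (t + n) * exp (\<gamma> * t)) \<longlongrightarrow> A) at_top"
      by (simp add: distrib_left distrib_right exp_add mult_ac)
    from asymp_equiv_w_star[OF this F1(2,1)]
    show "(\<lambda>r. exp (\<gamma> * n) * u (s * ln r + n)) \<sim>[F1] w_star p q \<sigma>" .
  qed
qed

end

lemma ln_less_iff_less_exp: "r > 0 \<Longrightarrow> ln r < (T::real) \<longleftrightarrow> r < exp T"
  using exp_less_cancel_iff[of "ln r" T] by simp

lemma less_ln_iff_exp_less: "r > 0 \<Longrightarrow> (T::real) < ln r \<longleftrightarrow> exp T < r"
  using exp_less_cancel_iff[of T "ln r"] by simp

lemma ln_preimage_intervals: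
  fixes T :: real
  shows "{r. 0 < r \<and> 1 * ln r < T} = {0<..<exp T}" "{r. 0 < r \<and> T < 1 * ln r} = {exp T<..}"
    "{r. 0 < r \<and> - 1 * ln r < T} = {exp (- T)<..}" "{r. 0 < r \<and> T < - 1 * ln r} = {0<..<exp (- T)}"
proof -
  have gt: "0 < r" if "exp S < r" for r S :: real using that exp_gt_zero less_trans by blast
  show "{r. 0 < r \<and> 1 * ln r < T} = {0<..<exp T}"
    by (rule set_eqI) (simp add: ln_less_iff_less_exp cong: conj_cong)
  show "{r. 0 < r \<and> - 1 * ln r < T} = {exp (- T)<..}"
    using gt by (intro set_eqI) (simp add: minus_less_iff[of "ln _" T] less_ln_iff_exp_less cong: conj_cong, blast)
  show "{r. 0 < r \<and> T < 1 * ln r} = {exp T<..}"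
    using gt by (intro set_eqI) (simp add: less_ln_iff_exp_less cong: conj_cong, blast)
  show "{r. 0 < r \<and> T < - 1 * ln r} = {0<..<exp (- T)}"
    by (rule set_eqI) (simp add: less_minus_iff[of T "ln _"] ln_less_iff_less_exp cong: conj_cong)
qed

lemma tendsto_ln_quotient_iff_abs:
  "((\<lambda>r. w r / \<bar>ln r\<bar>) \<longlongrightarrow> C) at_top \<longleftrightarrow> ((\<lambda>r::real. w r / ln r) \<longlongrightarrow> (C::real)) at_top"
proof (rule tendsto_cong)
  show "\<forall>\<^sub>F r in at_top. w r / \<bar>ln r\<bar> = w r / ln r"
    using eventually_gt_at_top[of 1] by eventually_elim simp
qed

theorem theorem4p20:
  fixes p q \<sigma> :: real
  assumes "q > p - 1" and "p - 1 > 0" and "\<sigma> \<noteq> - p"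
  shows
    "(p > - \<sigma> \<longrightarrow>
       (\<exists>c :: real \<Rightarrow> real. \<forall>\<epsilon>\<in>{1, -1}. \<forall>w0>0. c w0 > 0 \<and>
          unique_local_solution_zero p q \<sigma> \<epsilon> (\<lambda>w.
            (w \<longlongrightarrow> w0) (at_right 0) \<and>
            ((\<lambda>r. r powr (- (\<sigma> + 1) / (p - 1)) * deriv w r) \<longlongrightarrow> - \<epsilon> * c w0) (at_right 0)))
     \<and> infinitely_many_along (at_right 0) (\<lambda>w.
          local_solution_zero p q \<sigma> 1 w \<and>
          (\<exists>C>0. ((\<lambda>r. w r / \<bar>ln r\<bar>) \<longlongrightarrow> C) (at_right 0) \<and>
                 ((\<lambda>r. r * deriv w r) \<longlongrightarrow> - C) (at_right 0)))
     \<and> positive_solution p q \<sigma> (-1) {0<..} (w_star p q \<sigma>)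
     \<and> (\<exists>w. local_solution_zero p q \<sigma> (-1) w \<and> w \<sim>[at_right 0] w_star p q \<sigma> \<and>
            \<not> (\<forall>\<^sub>F r in at_right 0. w r = w_star p q \<sigma> r))
     \<and> (\<exists>w. local_solution_infinity p q \<sigma> (-1) w \<and> w \<sim>[at_top] w_star p q \<sigma> \<and>
            \<not> (\<forall>\<^sub>F r in at_top. w r = w_star p q \<sigma> r))
     \<and> infinitely_many_along (principal {0<..}) (\<lambda>w.
          positive_solution p q \<sigma> (-1) {0<..} w \<and>
          (\<exists>C>0. ((\<lambda>r. w r / \<bar>ln r\<bar>) \<longlongrightarrow> C) (at_right 0) \<and>
                 ((\<lambda>r. r * deriv w r) \<longlongrightarrow> - C) (at_right 0)) \<and>
          w \<sim>[at_top] w_star p q \<sigma>))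
   \<and> (p < - \<sigma> \<longrightarrow>
       (\<exists>c :: real \<Rightarrow> real. \<forall>\<epsilon>\<in>{1, -1}. \<forall>w0>0. c w0 > 0 \<and>
          unique_local_solution_infinity p q \<sigma> \<epsilon> (\<lambda>w.
            (w \<longlongrightarrow> w0) at_top \<and>
            ((\<lambda>r. r powr (- (\<sigma> + 1) / (p - 1)) * deriv w r) \<longlongrightarrow> \<epsilon> * c w0) at_top))
     \<and> infinitely_many_along at_top (\<lambda>w.
          local_solution_infinity p q \<sigma> 1 w \<and>
          (\<exists>C>0. ((\<lambda>r. w r / ln r) \<longlongrightarrow> C) at_top \<and>
                 ((\<lambda>r. r * deriv w r) \<longlongrightarrow> C) at_top))
     \<and> positive_solution p q \<sigma> (-1) {0<..} (w_star p q \<sigma>)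
     \<and> (\<exists>w. local_solution_zero p q \<sigma> (-1) w \<and> w \<sim>[at_right 0] w_star p q \<sigma> \<and>
            \<not> (\<forall>\<^sub>F r in at_right 0. w r = w_star p q \<sigma> r))
     \<and> (\<exists>w. local_solution_infinity p q \<sigma> (-1) w \<and> w \<sim>[at_top] w_star p q \<sigma> \<and>
            \<not> (\<forall>\<^sub>F r in at_top. w r = w_star p q \<sigma> r))
     \<and> infinitely_many_along (principal {0<..}) (\<lambda>w.
          positive_solution p q \<sigma> (-1) {0<..} w \<and>
          (\<exists>C>0. ((\<lambda>r. w r / ln r) \<longlongrightarrow> C) at_top \<and>
                 ((\<lambda>r. r * deriv w r) \<longlongrightarrow> C) at_top) \<and>
          w \<sim>[at_right 0] w_star p q \<sigma>))"
proof (intro conjI[OF impI impI], goal_cases)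
  case 1
  then interpret radial_emden_fowler p q "p + \<sigma>" 1 \<sigma> "at_right 0" at_top
    using assms exp_mult_at_right[of 1] exp_at_top ln_at_0 ln_at_top eventually_gt_at_top[of 0]
    by unfold_locales (auto simp: eventually_at_right_less)
  have near: "near T = {0<..<exp T}" and far: "far T = {exp T<..}" for T
    by (simp_all only: near_def far_def ln_preimage_intervals)
  show ?case
  proof (intro conjI, goal_cases)
    case 1
    show ?case
      (is "\<exists>c. \<forall>\<epsilon>\<in>_. \<forall>w0>0. _ \<and> unique_local_solution_zero p q \<sigma> \<epsilon> (?P c \<epsilon> w0)")
    proof (intro exI[of _ reg_slope] ballI allI impI conjI reg_slope_pos)
      fix \<epsilon> w0 :: real assume *: "\<epsilon> \<in> {1, -1}" "0 < w0"
      show "unique_local_solution_zero p q \<sigma> \<epsilon> (?P reg_slope \<epsilon> w0)"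
        unfolding unique_local_solution_zero_def
      proof (intro conjI allI impI ballI)
        obtain w T where "positive_solution p q \<sigma> \<epsilon> {0<..<exp T} w" "?P reg_slope \<epsilon> w0 w"
          using regular_solution[OF *] unfolding near by auto
        then show "\<exists>w. local_solution_zero p q \<sigma> \<epsilon> w \<and> ?P reg_slope \<epsilon> w0 w"
          unfolding local_solution_zero_def by (intro exI[of _ w] conjI exI[of _ "exp T"]) auto
      next
        fix r1 r2 :: real and w1 w2 r
        assume r12: "0 < r1" "0 < r2" and w: "positive_solution p q \<sigma> \<epsilon> {0<..<r1} w1 \<and> ?P reg_slope \<epsilon> w0 w1 \<and>
            positive_solution p q \<sigma> \<epsilon> {0<..<r2} w2 \<and> ?P reg_slope \<epsilon> w0 w2"
          and r: "r \<in> {0<..<r1} \<inter> {0<..<r2}"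
        have n: "{0<..<r1} = near (ln r1)" "{0<..<r2} = near (ln r2)" using r12 by (simp_all add: near)
        show "w1 r = w2 r"
          by (rule regular_solution_unique[OF *, of "ln r1" w1 _ "ln r2" w2])
            (use w r in \<open>unfold n, blast+\<close>)
      qed
    qed
  next
    case 2
    show ?case
      by (rule infinitely_many_along_mono[OF log_growth_solutions])
        (auto simp: near local_solution_zero_def intro: exp_gt_zero)
  next
    case 3
    show ?case by (rule w_star_solution)
  next
    case 4
    show ?case
      using near_w_star_solution unfolding near local_solution_zero_def by (meson exp_gt_zero)
  next
    case 5
    show ?case
      using far_w_star_solution unfolding far local_solution_infinity_def by (meson exp_gt_zero)
  next
    case 6
    show ?case
      using global_solutions by simp
  qed
next
  case 2
  then interpret radial_emden_fowler p q "- (p + \<sigma>)" "- 1" \<sigma> at_top "at_right 0"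
  proof unfold_locales
    show "filterlim (\<lambda>r::real. - 1 * ln r) at_bot at_top"
      using filterlim_compose[OF filterlim_uminus_at_bot_at_top ln_at_top] by simp
    show "filterlim (\<lambda>t::real. exp (- 1 * t)) at_top at_bot"
      using filterlim_compose[OF exp_at_top filterlim_uminus_at_top_at_bot] by simp
    show "filterlim (\<lambda>r::real. - 1 * ln r) at_top (at_right 0)"
      using filterlim_compose[OF filterlim_uminus_at_top_at_bot ln_at_0] by simp
    show "filterlim (\<lambda>t::real. exp (- 1 * t)) (at_right 0) at_top"
      using filterlim_compose[OF exp_mult_at_right[of 1] filterlim_uminus_at_bot_at_top] by simp
  qed (use assms eventually_gt_at_top[of 0] in \<open>auto simp: eventually_at_right_less\<close>)
  have near: "near T = {exp (- T)<..}" and far: "far T = {0<..<exp (- T)}" for T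
    by (simp_all only: near_def far_def ln_preimage_intervals)
  show ?case
  proof (intro conjI, goal_cases)
    case 1
    show ?case
      (is "\<exists>c. \<forall>\<epsilon>\<in>_. \<forall>w0>0. _ \<and> unique_local_solution_infinity p q \<sigma> \<epsilon> (?P c \<epsilon> w0)")
    proof (intro exI[of _ reg_slope] ballI allI impI conjI reg_slope_pos)
      fix \<epsilon> w0 :: real assume *: "\<epsilon> \<in> {1, -1}" "0 < w0"
      show "unique_local_solution_infinity p q \<sigma> \<epsilon> (?P reg_slope \<epsilon> w0)"
        unfolding unique_local_solution_infinity_def
      proof (intro conjI allI impI ballI)
        obtain w T where "positive_solution p q \<sigma> \<epsilon> {exp (- T)<..} w" "?P reg_slope \<epsilon> w0 w"
          using regular_solution[OF *] unfolding near by auto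
        then show "\<exists>w. local_solution_infinity p q \<sigma> \<epsilon> w \<and> ?P reg_slope \<epsilon> w0 w"
          unfolding local_solution_infinity_def by (intro exI[of _ w] conjI exI[of _ "exp (- T)"]) auto
      next
        fix r1 r2 :: real and w1 w2 r
        assume r12: "0 < r1" "0 < r2" and w: "positive_solution p q \<sigma> \<epsilon> {r1<..} w1 \<and> ?P reg_slope \<epsilon> w0 w1 \<and>
            positive_solution p q \<sigma> \<epsilon> {r2<..} w2 \<and> ?P reg_slope \<epsilon> w0 w2"
          and r: "r \<in> {r1<..} \<inter> {r2<..}"
        have n: "{r1<..} = near (- ln r1)" "{r2<..} = near (- ln r2)" using r12 by (simp_all add: near)
        show "w1 r = w2 r"
          by (rule regular_solution_unique[OF *, of "- ln r1" w1 _ "- ln r2" w2])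
            (use w r in \<open>unfold n, blast+\<close>)
      qed
    qed
  next
    case 2
    show ?case
      by (rule infinitely_many_along_mono[OF log_growth_solutions])
        (auto simp: near local_solution_infinity_def tendsto_ln_quotient_iff_abs intro: exp_gt_zero)
  next
    case 3
    show ?case by (rule w_star_solution)
  next
    case 4
    show ?case
      using far_w_star_solution unfolding far local_solution_zero_def by (meson exp_gt_zero)
  next
    case 5
    show ?case
      using near_w_star_solution unfolding near local_solution_infinity_def by (meson exp_gt_zero)
  next
    case 6
    show ?case
      using global_solutions by (simp add: tendsto_ln_quotient_iff_abs)
  qed
qed

end
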